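(* Let $P\subset\mathbb{R}^2$ be a lattice polygon with precisely $g$ interior lattice points, and let $\Delta$ be a (not necessarily regular) unimodular triangulation of $P$ with skeleton $G$. If $G$ has a sprawling triangle, then $g=4$, and, up to unimodular equivalence, we have \[ P = A_{(-2,0;-2,0;-2,0)} \quad\text{and}\quad \Delta = \Delta_{(-2,0;-2,0;-2,0)} . \]
   Context: A lattice polygon is the (two-dimensional) convex hull of finitely many points of $\mathbb{Z}^2$. A unimodular triangulation of $P$ is a triangulation of $V=P\cap\mathbb{Z}^2$ (a subdivision of $P$ into triangles with vertices in $V$) all of whose triangles have Euclidean area $\tfrac12$. Unimodular equivalence means equivalence under maps $x\mapsto Mx+t$ with $M\in GL_2(\mathbb{Z})$ and $t\in\mathbb{Z}^2$. Dual graph and skeleton. The dual graph $\Gamma=\Gamma(\Delta)$ has the triangles of $\Delta$ as nodes; two triangles form an edge of $\Gamma$ if they share an edge in $\Delta$. The skeleton $G=G(\Delta)$ is obtained from $\Gamma$ by first repeatedly deleting nodes of degree one together with the unique incident edge until none are left, and then repeatedly removing a node of degree two and joining its two neighbors by an edge until no nodes of degree two are left. The result is a connected trivalent planar graph (loops and multiple edges allowed), of genus $g$, where the genus of a connected graph is its number of edges minus number of nodes plus one. An edge of a connected graph is a cut edge if deleting it creates two connected components. Sprawling triangle. A connected trivalent planar graph $G$ has a sprawling triangle if it consists of a triangle (3-cycle) with vertices $v_1,v_2,v_3$, three cut edges $e_1,e_2,e_3$ of $G$, and three pairwise disjoint subgraphs $G_1,G_2,G_3$ of positive genus disjoint from the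 triangle, where $e_i$ connects $v_i$ with $G_i$ for $i=1,2,3$. The anti-honeycomb triangle of genus 4 is \[ A_{(-2,0;-2,0;-2,0)}=\operatorname{conv}\{(2,2),(-2,0),(0,-2)\}. \] Its lattice points are the three vertices, the boundary points $a=(1,0)$, $b=(0,1)$, $c=(-1,-1)$, and the interior points $(0,0),(1,1),(-1,0),(0,-1)$. Its anti-honeycomb triangulation $\Delta_{(-2,0;-2,0;-2,0)}$ is the unimodular triangulation with 12 triangles obtained by first subdividing the polygon into the four triangles $\operatorname{conv}\{a,b,c\}$, $\operatorname{conv}\{(2,2),a,b\}$, $\operatorname{conv}\{(-2,0),b,c\}$, $\operatorname{conv}\{(0,-2),a,c\}$, and then subdividing each of these into three triangles by coning from its unique interior lattice point, namely $(0,0)$, $(1,1)$, $(-1,0)$, $(0,-1)$, respectively. *)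

theory Defs
  imports "HOL-Analysis.Analysis" "HOL-Library.Multiset"
begin

section \<open>Multigraphs\<close>

text \<open>
  Undirected multigraphs, loops and parallel edges allowed.  An edge is the multiset of its
  two end points, so a loop at \<open>v\<close> is \<open>{#v, v#}\<close> and contributes two to the degree of \<open>v\<close>.
\<close>

record 'v multigraph =
  nodes :: "'v set"
  edges :: "'v multiset multiset"

definition wf_multigraph :: "'v multigraph \<Rightarrow> bool" where
  "wf_multigraph G \<longleftrightarrow>
     finite (nodes G) \<and> (\<forall>e \<in># edges G. size e = 2 \<and> set_mset e \<subseteq> nodes G)"

definition degree :: "'v multigraph \<Rightarrow> 'v \<Rightarrow> nat" where
  "degree G v = (\<Sum>e \<in># edges G. count e v)"

definition adjacent :: "'v multigraph \<Rightarrow> 'v \<Rightarrow> 'v \<Rightarrow> bool" where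
  "adjacent G u v \<longleftrightarrow> {#u, v#} \<in># edges G"

definition graph_components :: "'v multigraph \<Rightarrow> 'v set set" where
  "graph_components G =
     nodes G // {(u, v). u \<in> nodes G \<and> v \<in> nodes G \<and> (adjacent G)\<^sup>*\<^sup>* u v}"

definition connected_graph :: "'v multigraph \<Rightarrow> bool" where
  "connected_graph G \<longleftrightarrow> card (graph_components G) = 1"

definition genus :: "'v multigraph \<Rightarrow> int" where
  "genus G = int (size (edges G)) - int (card (nodes G)) + 1"

definition delete_edge :: "'v multigraph \<Rightarrow> 'v multiset \<Rightarrow> 'v multigraph" where
  "delete_edge G e = \<lparr>nodes = nodes G, edges = edges G - {#e#}\<rparr>"

definition cut_edge :: "'v multigraph \<Rightarrow> 'v multiset \<Rightarrow> bool" where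
  "cut_edge G e \<longleftrightarrow> connected_graph G \<and> e \<in># edges G \<and> card (graph_components (delete_edge G e)) = 2"

definition subgraph :: "'v multigraph \<Rightarrow> 'v multigraph \<Rightarrow> bool" where
  "subgraph H G \<longleftrightarrow> wf_multigraph H \<and> nodes H \<subseteq> nodes G \<and> edges H \<subseteq># edges G"


section \<open>Pruning and smoothing\<close>

inductive prune_step :: "'v multigraph \<Rightarrow> 'v multigraph \<Rightarrow> bool" where
  "\<lbrakk>v \<in> nodes G; degree G v = 1; e \<in># edges G; v \<in># e\<rbrakk>
   \<Longrightarrow> prune_step G \<lparr>nodes = nodes G - {v}, edges = edges G - {#e#}\<rparr>"

text \<open>
  The two neighbours \<open>a\<close> and \<open>b\<close> may coincide, in which case smoothing creates a loop.
  They must differ from \<open>v\<close>: a node whose only incident edge is a loop cannot be smoothed.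
\<close>

inductive smooth_step :: "'v multigraph \<Rightarrow> 'v multigraph \<Rightarrow> bool" where
  "\<lbrakk>v \<in> nodes G; degree G v = 2; a \<noteq> v; b \<noteq> v; edges G = E + {#{#v, a#}, {#v, b#}#}\<rbrakk>
   \<Longrightarrow> smooth_step G \<lparr>nodes = nodes G - {v}, edges = E + {#{#a, b#}#}\<rparr>"

definition pruning_of :: "'v multigraph \<Rightarrow> 'v multigraph \<Rightarrow> bool" where
  "pruning_of G H \<longleftrightarrow> prune_step\<^sup>*\<^sup>* G H \<and> (\<forall>v \<in> nodes H. degree H v \<noteq> 1)"

definition smoothing_of :: "'v multigraph \<Rightarrow> 'v multigraph \<Rightarrow> bool" where
  "smoothing_of G H \<longleftrightarrow> smooth_step\<^sup>*\<^sup>* G H \<and> (\<forall>v \<in> nodes H. degree H v \<noteq> 2)"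


section \<open>Sprawling triangles\<close>

text \<open>
  The graphs of interest are connected, trivalent and planar.  Connectedness is part of
  \<open>cut_edge\<close>; trivalence and planarity are not imposed, as every skeleton of genus at least
  two has them.
\<close>

definition has_sprawling_triangle :: "'v multigraph \<Rightarrow> bool" where
  "has_sprawling_triangle G \<longleftrightarrow>
     (\<exists>v1 v2 v3 w1 w2 w3 G1 G2 G3.
        v1 \<noteq> v2 \<and> v2 \<noteq> v3 \<and> v1 \<noteq> v3 \<and>
        (\<forall>H \<in> {G1, G2, G3}.
           subgraph H G \<and> connected_graph H \<and> genus H > 0 \<and> nodes H \<inter> {v1, v2, v3} = {}) \<and>
        nodes G1 \<inter> nodes G2 = {} \<and> nodes G2 \<inter> nodes G3 = {} \<and> nodes G1 \<inter> nodes G3 = {} \<and>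
        w1 \<in> nodes G1 \<and> w2 \<in> nodes G2 \<and> w3 \<in> nodes G3 \<and>
        (\<forall>e \<in> {{#v1, w1#}, {#v2, w2#}, {#v3, w3#}}. cut_edge G e) \<and>
        nodes G = {v1, v2, v3} \<union> nodes G1 \<union> nodes G2 \<union> nodes G3 \<and>
        edges G = {#{#v1, v2#}, {#v2, v3#}, {#v1, v3#}#}
                + {#{#v1, w1#}, {#v2, w2#}, {#v3, w3#}#}
                + edges G1 + edges G2 + edges G3)"


section \<open>Lattice polygons and unimodular triangulations\<close>

definition integer_lattice :: "(real^2) set" where
  "integer_lattice = {x. \<forall>i. x $ i \<in> \<int>}"

definition lattice_polygon :: "(real^2) set \<Rightarrow> bool" where
  "lattice_polygon P \<longleftrightarrow>
     (\<exists>S. finite S \<and> S \<subseteq> integer_lattice \<and> P = convex hull S) \<and> aff_dim P = 2"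

text \<open>
  Only the two-dimensional cells are recorded in a triangulation; the library predicate
  \<open>triangulation\<close> expresses that finitely many simplices meet face to face.
\<close>

definition unimodular_triangulation :: "(real^2) set \<Rightarrow> (real^2) set set \<Rightarrow> bool" where
  "unimodular_triangulation P \<Delta> \<longleftrightarrow>
     triangulation \<Delta> \<and> \<Union>\<Delta> = P \<and>
     (\<forall>T \<in> \<Delta>. 2 simplex T \<and> {v. v extreme_point_of T} \<subseteq> P \<inter> integer_lattice
              \<and> measure lebesgue T = 1 / 2)"

definition unimodular_map :: "(real^2 \<Rightarrow> real^2) \<Rightarrow> bool" where
  "unimodular_map f \<longleftrightarrow>
     (\<exists>(M :: int^2^2) (t :: int^2). invertible M \<and>
        f = (\<lambda>x. (\<chi> i j. real_of_int (M $ i $ j)) *v x + (\<chi> i. real_of_int (t $ i))))"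

definition dual_graph :: "(real^2) set set \<Rightarrow> (real^2) set multigraph" where
  "dual_graph \<Delta> =
     \<lparr>nodes = \<Delta>,
      edges = mset_set {{#T, T'#} | T T'. T \<in> \<Delta> \<and> T' \<in> \<Delta> \<and>
                          (T \<inter> T') edge_of T \<and> (T \<inter> T') edge_of T'}\<rparr>"

text \<open>
  The node set of the skeleton is the set of those triangles that survive pruning and smoothing.
\<close>

definition skeleton_of :: "(real^2) set set \<Rightarrow> (real^2) set multigraph \<Rightarrow> bool" where
  "skeleton_of \<Delta> G \<longleftrightarrow> (\<exists>H. pruning_of (dual_graph \<Delta>) H \<and> smoothing_of H G)"


section \<open>The anti-honeycomb triangle of genus 4\<close>

definition antihoneycomb_triangle4 :: "(real^2) set" where
  "antihoneycomb_triangle4 = convex hull {vector [2, 2], vector [-2, 0], vector [0, -2]}"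

definition cone_triangles :: "real^2 \<Rightarrow> real^2 \<Rightarrow> real^2 \<Rightarrow> real^2 \<Rightarrow> (real^2) set set" where
  "cone_triangles m p q r =
     {convex hull {m, p, q}, convex hull {m, q, r}, convex hull {m, p, r}}"

definition antihoneycomb_triangulation4 :: "(real^2) set set" where
  "antihoneycomb_triangulation4 =
     (let a = vector [1, 0]; b = vector [0, 1]; c = vector [-1, -1] in
        cone_triangles (vector [0, 0]) a b c \<union>
        cone_triangles (vector [1, 1]) (vector [2, 2]) a b \<union>
        cone_triangles (vector [-1, 0]) (vector [-2, 0]) b c \<union>
        cone_triangles (vector [0, -1]) (vector [0, -2]) a c)"

end

theory Submission
  imports Defs
begin

text \<open>
  The triangle of the skeleton comes from a cycle \<open>Z\<close> of the dual graph.  Call the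
  three nodes of the triangle loaded: beyond each of them hangs a part of the skeleton of
  positive genus, attached by a cut edge.  A graph in which every node off \<open>Z\<close> hangs from one
  node of \<open>Z\<close> keeps this form when a degree-two node is put back on an edge or a leaf is put back, and
  a part with at least as many edges as nodes survives as well.  Hence the dual graph itself
  consists of a cycle with parts hanging from its nodes, three of the nodes being loaded
  (\<open>hung_cycle_of_dual_graph\<close>).

  A cycle crosses every cut of a graph an even number of times.  Two kinds of
  cycles and cuts are played off against each other.  The triangles around an interior lattice
  point form a cycle, so the single edge to a hanging part never
  passes through the star of an interior lattice point: it crosses a side with both ends on the
  boundary of \<open>P\<close> (\<open>pendant_edge_on_boundary\<close>).  Conversely such a side is a chord of \<open>P\<close>; it splits
  the triangles into two classes joined by one edge only, so it is not crossed by \<open>Z\<close>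
  (\<open>cycle_edge_has_interior_vertex\<close>).  Thus \<open>Z\<close> runs around one interior lattice point \<open>p\<close>
  (\<open>cycle_is_star\<close>).  A loaded triangle is \<open>p, a, b\<close> with \<open>a\<close> and \<open>b\<close> on the boundary, and some
  interior lattice point lies beyond the chord \<open>a b\<close>, as otherwise all shared sides beyond it would
  be chords and the hanging part would be a forest (\<open>loaded_node\<close>).

  Write a loaded triangle as \<open>p, p + A, p + B\<close>; \<open>A\<close> and \<open>B\<close> are a basis of the
  lattice.  Convexity makes \<open>p + A + B\<close> an interior point (\<open>corner_sum_interior\<close>), and it forces the
  corresponding vector of any other loaded triangle into the cone opposite to that of \<open>A\<close> and \<open>B\<close>
  (\<open>corner_opposite\<close>).  For three loaded triangles with sums \<open>Q1, Q2, Q3\<close> the vector \<open>- Q1\<close> then lies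
  in two cones with disjoint interiors, hence spans a common ray of both.  So the edge vectors are
  \<open>- Q1, - Q2, - Q3\<close>, and they add up to zero (\<open>three_corners\<close>).  Supporting lines at the three
  boundary points now leave no freedom: they determine \<open>P\<close> (\<open>fan_polygon\<close>), then its interior lattice
  points, then the triangles, each of which is barred from crossing the three known ones
  (\<open>fan_far\<close>, \<open>fan_cells_eq\<close>).
\<close>

section \<open>Cycles with hanging parts\<close>

definition inner_edges :: "'v multigraph \<Rightarrow> 'v set \<Rightarrow> 'v multiset multiset" where
  "inner_edges G X = filter_mset (\<lambda>e. set_mset e \<subseteq> X) (edges G)"

text \<open>
  Loops are counted twice, as in the degree of the whole graph.
\<close>

definition inner_degree :: "'v multigraph \<Rightarrow> 'v set \<Rightarrow> 'v \<Rightarrow> nat" where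
  "inner_degree G X v = (\<Sum>e \<in># inner_edges G X. count e v)"

text \<open>
  Connectedness of the subgraph induced on \<open>X\<close>, phrased by cuts instead of paths.  In this form it is
  easily carried from a graph to a subdivision of it.
\<close>

definition linked :: "'v multigraph \<Rightarrow> 'v set \<Rightarrow> bool" where
  "linked G X \<longleftrightarrow>
     (\<forall>Y \<subseteq> X. Y \<noteq> {} \<and> (\<forall>x \<in> Y. \<forall>y \<in> X. adjacent G x y \<longrightarrow> y \<in> Y) \<longrightarrow> Y = X)"

text \<open>
  The map \<open>r\<close> sends a node to the node of \<open>Z\<close> from which it hangs, so its fibres are the
  hanging parts together with the nodes that carry them.
\<close>

definition hung_cycle :: "'v multigraph \<Rightarrow> 'v set \<Rightarrow> ('v \<Rightarrow> 'v) \<Rightarrow> bool" where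
  "hung_cycle G Z r \<longleftrightarrow>
     Z \<subseteq> nodes G \<and> (\<forall>z \<in> Z. r z = z \<and> inner_degree G Z z = 2) \<and> r ` nodes G \<subseteq> Z \<and>
     linked G Z \<and> linked G (nodes G) \<and>
     (\<forall>x y. adjacent G x y \<longrightarrow> x \<in> Z \<and> y \<in> Z \<or> r x = r y)"

text \<open>
  A nonempty finite graph with at least as many edges as nodes contains a cycle.  Counting, rather than
  connectedness or genus of the whole hanging part, is what survives the insertion of leaves: the
  witness \<open>S\<close> need not change.
\<close>

definition loaded :: "'v multigraph \<Rightarrow> 'v set \<Rightarrow> ('v \<Rightarrow> 'v) \<Rightarrow> 'v \<Rightarrow> bool" where
  "loaded G Z r z \<longleftrightarrow>
     (\<exists>S \<subseteq> nodes G - Z. S \<noteq> {} \<and> r ` S \<subseteq> {z} \<and> card S \<le> size (inner_edges G S))"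

lemma linkedD:
  assumes "linked G X" "Y \<subseteq> X" "Y \<noteq> {}" "\<And>x y. x \<in> Y \<Longrightarrow> y \<in> X \<Longrightarrow> adjacent G x y \<Longrightarrow> y \<in> Y"
  shows "Y = X"
  using assms unfolding linked_def by blast

lemma size_2_multiset: "size e = 2 \<Longrightarrow> v \<in># e \<Longrightarrow> \<exists>x. e = {#v, x#}"
  by (metis One_nat_def add_mset_remove_trivial_If numeral_2_eq_2 size_1_singleton_mset size_Suc_Diff1 diff_Suc_1)

lemma adjacent_in_nodes:
  assumes "wf_multigraph G" "adjacent G x y" shows "x \<in> nodes G" "y \<in> nodes G"
  using assms unfolding wf_multigraph_def adjacent_def by fastforce+

lemma linked_if_connected_graph:
  assumes wf: "wf_multigraph G" and "connected_graph G"
  shows "linked G (nodes G)"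
  unfolding linked_def
proof (intro allI impI)
  fix Y assume Y: "Y \<subseteq> nodes G" "Y \<noteq> {} \<and> (\<forall>x\<in>Y. \<forall>y\<in>nodes G. adjacent G x y \<longrightarrow> y \<in> Y)"
  let ?R = "{(u, v). u \<in> nodes G \<and> v \<in> nodes G \<and> (adjacent G)\<^sup>*\<^sup>* u v}"
  obtain x where x: "x \<in> Y" using Y by blast
  obtain C where C: "nodes G // ?R = {C}"
    using assms(2) unfolding connected_graph_def graph_components_def by (meson card_1_singletonE)
  have all: "?R `` {u} = C" if "u \<in> nodes G" for u
    using quotientI[OF that, of ?R] unfolding C by simp
  have reach: "v \<in> Y" if "(adjacent G)\<^sup>*\<^sup>* x v" for v
    using that
  proof induction
    case (step y z)
    then show ?case using Y adjacent_in_nodes[OF wf] by blast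
  qed (use x in simp)
  have "u \<in> Y" if "u \<in> nodes G" for u
  proof -
    have "u \<in> ?R `` {u}" using that by simp
    then have "u \<in> C" by (simp only: all[OF that])
    moreover have "x \<in> nodes G" using x Y by blast
    ultimately have "u \<in> ?R `` {x}" by (simp only: all)
    then show ?thesis using reach by simp
  qed
  then show "Y = nodes G" using Y by blast
qed

lemma wf_prune_step:
  assumes "prune_step G H" "wf_multigraph G" shows "wf_multigraph H"
  using assms
proof cases
  case (1 v e)
  have "v \<notin># f" if "f \<in># edges G - {#e#}" for f
  proof
    assume "v \<in># f"
    have "edges G = add_mset e (add_mset f (edges G - {#e#} - {#f#}))"
      using insert_DiffM[OF 1(4)] insert_DiffM[OF that] by simp
    then have "degree G v = count e v + (count f v + (\<Sum>e\<in>#edges G - {#e#} - {#f#}. count e v))"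
      unfolding degree_def by (metis image_mset_add_mset sum_mset.add_mset)
    moreover have "count e v \<ge> 1" "count f v \<ge> 1" using 1 \<open>v \<in># f\<close> by (auto simp: Suc_le_eq)
    ultimately show False using 1 by linarith
  qed
  then show ?thesis
    using assms(2) 1(1) unfolding wf_multigraph_def by (fastforce dest: in_diffD)
qed

lemma wf_smooth_step:
  assumes "smooth_step G H" "wf_multigraph G" shows "wf_multigraph H"
  using assms
proof cases
  case (1 v a b E)
  have "v \<notin># f" if "f \<in># E" for f
  proof -
    have "degree G v = (\<Sum>e\<in>#E. count e v) + 2"
      unfolding degree_def 1(6) using 1 by simp
    then have "(\<Sum>e\<in>#E. count e v) = 0" using 1 by simp
    then have "count f v = 0" using that by simp
    then show ?thesis by (simp add: not_in_iff)
  qed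
  then show ?thesis
    using assms(2) 1 unfolding wf_multigraph_def by fastforce
qed

lemma inner_edges_mono:
  assumes "edges G \<subseteq># edges H" "X \<subseteq> Y"
  shows "inner_edges G X \<subseteq># inner_edges H Y"
  using assms unfolding inner_edges_def subseteq_mset_def by auto

section \<open>Undoing a smoothing or pruning step\<close>

text \<open>
  A degree-two node \<open>v\<close> put back on an edge \<open>a b\<close> joins the cycle if the edge lies on it, and otherwise
  the hanging part that contains the edge.  If both ends lie in a witness of a loaded node, \<open>v\<close> joins
  the witness too, which then gains one node and one edge.
\<close>

lemma hung_cycle_smooth_step:
  assumes step: "smooth_step G H" and wf: "wf_multigraph G" and hung: "hung_cycle H Z r"
  obtains Z' r' where "hung_cycle G Z' r'" "Z \<subseteq> Z'" "\<And>z. z \<in> Z \<Longrightarrow> loaded H Z r z \<Longrightarrow> loaded G Z' r' z"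
  using step
proof cases
  case (1 v a b E)
  have wfH: "wf_multigraph H" using wf_smooth_step[OF step wf] .
  have E: "edges H = add_mset {#a, b#} E" "edges G = add_mset {#v, a#} (add_mset {#v, b#} E)"
    and N: "nodes H = nodes G - {v}" using 1 by auto
  have ab: "a \<in> nodes H" "b \<in> nodes H"
    using wfH E unfolding wf_multigraph_def by auto
  have vE: "v \<notin># f" if "f \<in># E" for f
    using wfH that unfolding wf_multigraph_def E N by auto
  have vE2: "{#v, y#} \<notin># E" "{#y, v#} \<notin># E" for y using vE by fastforce+
  have fin: "finite (nodes G)" using wf by (simp add: wf_multigraph_def)
  note H = hung[unfolded hung_cycle_def]
  have vZ: "v \<notin> Z" using H N by auto
  have adjH: "adjacent H x y \<longleftrightarrow> {#x, y#} = {#a, b#} \<or> {#x, y#} \<in># E" for x y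
    by (auto simp: adjacent_def E)
  have adjG: "adjacent G x y \<longleftrightarrow> {#x, y#} = {#v, a#} \<or> {#x, y#} = {#v, b#} \<or> {#x, y#} \<in># E" for x y
    by (auto simp: adjacent_def E)
  have adj_v: "adjacent G v a" "adjacent G v b" "adjacent G a v" "adjacent G b v"
    by (auto simp: adjG add_mset_commute)
  have adj_old: "adjacent H x y \<Longrightarrow> x \<noteq> a \<or> y \<noteq> b \<Longrightarrow> x \<noteq> b \<or> y \<noteq> a \<Longrightarrow> adjacent G x y" for x y
    unfolding adjH adjG by (auto simp: add_eq_conv_ex)
  have link: "linked G (insert v X)" if "linked H X" "a \<in> X" "b \<in> X" "v \<notin> X" for X
    unfolding linked_def
  proof (intro allI impI, elim conjE)
    fix Y assume Y: "Y \<subseteq> insert v X" "Y \<noteq> {}" and cl: "\<forall>x\<in>Y. \<forall>y\<in>insert v X. adjacent G x y \<longrightarrow> y \<in> Y"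
    have va: "v \<in> Y \<longleftrightarrow> a \<in> Y" "v \<in> Y \<longleftrightarrow> b \<in> Y"
      using cl adj_v that Y by blast+
    have "Y - {v} = X"
    proof (rule linkedD[OF that(1)])
      show "Y - {v} \<noteq> {}" using va Y that by blast
      show "Y - {v} \<subseteq> X" using Y by blast
      show "y \<in> Y - {v}" if "x \<in> Y - {v}" "y \<in> X" "adjacent H x y" for x y
        using cl adj_old va that \<open>v \<notin> X\<close> by blast
    qed
    then have "a \<in> Y" using that by auto
    then show "Y = insert v X" using va \<open>Y - {v} = X\<close> by auto
  qed
  have nodes_eq: "insert v (nodes H) = nodes G" using N 1 by auto
  have linkG: "linked G (nodes G)"
    using link[of "nodes H"] H ab nodes_eq N by auto
  show thesis
  proof (cases "a \<in> Z \<and> b \<in> Z")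
    case True
    define r' where "r' = r(v := v)"
    have inner: "inner_edges H Z = add_mset {#a, b#} (filter_mset (\<lambda>e. set_mset e \<subseteq> Z) E)"
      "inner_edges G (insert v Z) = add_mset {#v, a#} (add_mset {#v, b#} (filter_mset (\<lambda>e. set_mset e \<subseteq> Z) E))"
      using True vE by (auto simp: inner_edges_def E intro!: filter_mset_cong)
    have degv: "(\<Sum>e\<in>#filter_mset (\<lambda>e. set_mset e \<subseteq> Z) E. count e v) = 0"
      using vE by (simp add: not_in_iff)
    have "hung_cycle G (insert v Z) r'"
      unfolding hung_cycle_def
    proof (intro conjI allI ballI impI)
      show "insert v Z \<subseteq> nodes G" using H nodes_eq by blast
      show "r' z = z" if "z \<in> insert v Z" for z using that H by (auto simp: r'_def)
      show "inner_degree G (insert v Z) z = 2" if "z \<in> insert v Z" for z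
      proof (cases "z = v")
        case True
        then show ?thesis using degv 1 by (simp add: inner_degree_def inner)
      next
        case False
        then have "inner_degree H Z z = 2" using H that by blast
        then show ?thesis using False by (auto simp: inner_degree_def inner split: if_splits)
      qed
      show "r' ` nodes G \<subseteq> insert v Z" using H unfolding nodes_eq[symmetric] by (auto simp: r'_def)
      show "linked G (insert v Z)" using link H True vZ by blast
      show "linked G (nodes G)" by fact
      show "x \<in> insert v Z \<and> y \<in> insert v Z \<or> r' x = r' y" if "adjacent G x y" for x y
      proof (cases "x = v \<or> y = v")
        case True
        then show ?thesis using that \<open>a \<in> Z \<and> b \<in> Z\<close> vE2 by (auto simp: adjG add_eq_conv_ex)
      next
        case False
        then have "adjacent H x y" using that by (auto simp: adjG adjH add_eq_conv_ex)
        then show ?thesis using H False by (auto simp: r'_def)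
      qed
    qed
    moreover have "loaded G (insert v Z) r' z" if "loaded H Z r z" for z
    proof -
      obtain S where S: "S \<subseteq> nodes H - Z" "S \<noteq> {}" "r ` S \<subseteq> {z}" "card S \<le> size (inner_edges H S)"
        using \<open>loaded H Z r z\<close> unfolding loaded_def by blast
      have "v \<notin> S" using S N by auto
      have "inner_edges H S \<subseteq># inner_edges G S"
        using True S by (auto simp: inner_edges_def E)
      then have "card S \<le> size (inner_edges G S)" using S by (meson le_trans size_mset_mono)
      moreover have "r' ` S \<subseteq> {z}" using S \<open>v \<notin> S\<close> by (auto simp: r'_def)
      ultimately show ?thesis using S \<open>v \<notin> S\<close> N unfolding loaded_def
        by (intro exI[of _ S]) auto
    qed
    ultimately show thesis using that by blast
  next
    case False
    have rab: "r a = r b" using H adjH[of a b] False by blast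
    define r' where "r' = r(v := r a)"
    have inner: "inner_edges G Z = inner_edges H Z"
      using False vZ by (auto simp: inner_edges_def E)
    have "hung_cycle G Z r'"
      unfolding hung_cycle_def
    proof (intro conjI allI ballI impI)
      show "Z \<subseteq> nodes G" using H nodes_eq by blast
      show "r' z = z" if "z \<in> Z" for z using that H vZ by (auto simp: r'_def)
      show "inner_degree G Z z = 2" if "z \<in> Z" for z
        using H that by (simp add: inner_degree_def inner)
      show "r' ` nodes G \<subseteq> Z" using H ab unfolding nodes_eq[symmetric] by (auto simp: r'_def)
      have "adjacent H x y \<Longrightarrow> x \<in> Z \<Longrightarrow> y \<in> Z \<Longrightarrow> adjacent G x y" for x y
        using adj_old False by blast
      moreover have "linked H Z" using H by blast
      ultimately show "linked G Z" unfolding linked_def by (metis subsetD)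
      show "linked G (nodes G)" by fact
      show "x \<in> Z \<and> y \<in> Z \<or> r' x = r' y" if "adjacent G x y" for x y
      proof (cases "x = v \<or> y = v")
        case True
        then show ?thesis using that rab vE2 1 by (auto simp: adjG add_eq_conv_ex r'_def)
      next
        case False
        then have "adjacent H x y" using that by (auto simp: adjG adjH add_eq_conv_ex)
        then show ?thesis using H False by (auto simp: r'_def)
      qed
    qed
    moreover have "loaded G Z r' z" if "loaded H Z r z" for z
    proof -
      obtain S where S: "S \<subseteq> nodes H - Z" "S \<noteq> {}" "r ` S \<subseteq> {z}" "card S \<le> size (inner_edges H S)"
        using \<open>loaded H Z r z\<close> unfolding loaded_def by blast
      have "v \<notin> S" using S N by auto
      have finS: "finite S" using S N by (auto intro: finite_subset[OF _ fin])
      show ?thesis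
      proof (cases "a \<in> S \<and> b \<in> S")
        case True
        let ?E = "filter_mset (\<lambda>e. set_mset e \<subseteq> S) E"
        have "inner_edges H S = add_mset {#a, b#} ?E"
             "inner_edges G (insert v S) = add_mset {#v, a#} (add_mset {#v, b#} ?E)"
          using True vE by (auto simp: inner_edges_def E intro!: filter_mset_cong)
        then have "card (insert v S) \<le> size (inner_edges G (insert v S))"
          using S \<open>v \<notin> S\<close> finS by simp
        moreover have "r' ` insert v S \<subseteq> {z}" using S True by (auto simp: r'_def)
        ultimately show ?thesis using S vZ nodes_eq unfolding loaded_def
          by (intro exI[of _ "insert v S"]) auto
      next
        case False
        then have "inner_edges G S = inner_edges H S"
          using \<open>v \<notin> S\<close> by (auto simp: inner_edges_def E)
        moreover have "r' ` S \<subseteq> {z}" using S \<open>v \<notin> S\<close> by (auto simp: r'_def)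
        ultimately show ?thesis using S N unfolding loaded_def by (intro exI[of _ S]) auto
      qed
    qed
    ultimately show thesis using that by blast
  qed
qed

text \<open>
  A leaf that is put back hangs from the same node of the cycle as its neighbour.
\<close>

lemma hung_cycle_prune_step:
  assumes step: "prune_step G H" and wf: "wf_multigraph G" and hung: "hung_cycle H Z r"
  obtains r' where "hung_cycle G Z r'" "\<And>z. loaded H Z r z \<Longrightarrow> loaded G Z r' z"
  using step
proof cases
  case (1 v e)
  have wfH: "wf_multigraph H" using wf_prune_step[OF step wf] .
  have E: "edges G = add_mset e (edges H)" and N: "nodes H = nodes G - {v}" using 1 by auto
  have ve: "count e v \<le> 1" using 1(3) unfolding degree_def E by simp
  obtain x where e: "e = {#v, x#}"
    using size_2_multiset[of e v] 1 wf unfolding wf_multigraph_def by blast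
  have xv: "x \<noteq> v" using ve e by auto
  have x: "x \<in> nodes H" using wf xv N unfolding wf_multigraph_def E e by auto
  have vH: "v \<notin># f" if "f \<in># edges H" for f
    using wfH that unfolding wf_multigraph_def N by auto
  note H = hung[unfolded hung_cycle_def]
  have vZ: "v \<notin> Z" using H N by auto
  have nodes_eq: "insert v (nodes H) = nodes G" using N 1 by auto
  have adjG: "adjacent G y z \<longleftrightarrow> {#y, z#} = {#v, x#} \<or> adjacent H y z" for y z
    by (auto simp: adjacent_def E e)
  have vadj: "\<not> adjacent H v y" "\<not> adjacent H y v" for y
    using vH unfolding adjacent_def by fastforce+
  have adj_v: "adjacent G v x" "adjacent G x v"
    by (auto simp: adjG add_mset_commute)
  have linkG: "linked G (nodes G)"
    unfolding linked_def
  proof (intro allI impI, elim conjE)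
    fix Y assume Y: "Y \<subseteq> nodes G" "Y \<noteq> {}" and cl: "\<forall>x\<in>Y. \<forall>y\<in>nodes G. adjacent G x y \<longrightarrow> y \<in> Y"
    have vx: "v \<in> Y \<longleftrightarrow> x \<in> Y" using cl adj_v nodes_eq x by blast
    have "linked H (nodes H)" using H by blast
    then have "Y - {v} = nodes H"
    proof (rule linkedD)
      show "Y - {v} \<noteq> {}" using vx Y xv by blast
      show "Y - {v} \<subseteq> nodes H" using Y nodes_eq by blast
      show "y \<in> Y - {v}" if "x \<in> Y - {v}" "y \<in> nodes H" "adjacent H x y" for x y
        using cl adjG vadj nodes_eq that by blast
    qed
    then have "x \<in> Y" using x by auto
    then show "Y = nodes G" using vx nodes_eq \<open>Y - {v} = nodes H\<close> by auto
  qed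
  define r' where "r' = r(v := r x)"
  have inner: "inner_edges G X = inner_edges H X" if "v \<notin> X" for X
    using that by (auto simp: inner_edges_def E e)
  have "hung_cycle G Z r'"
    unfolding hung_cycle_def
  proof (intro conjI allI ballI impI)
    show "Z \<subseteq> nodes G" using H nodes_eq by blast
    show "r' z = z" if "z \<in> Z" for z using that H vZ by (auto simp: r'_def)
    show "inner_degree G Z z = 2" if "z \<in> Z" for z
      using H that by (simp add: inner_degree_def inner vZ)
    show "r' ` nodes G \<subseteq> Z" using H x unfolding nodes_eq[symmetric] by (auto simp: r'_def)
    show "linked G Z"
      unfolding linked_def
    proof (intro allI impI, elim conjE)
      fix Y assume "Y \<subseteq> Z" "Y \<noteq> {}" "\<forall>x\<in>Y. \<forall>y\<in>Z. adjacent G x y \<longrightarrow> y \<in> Y"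
      then show "Y = Z" using H adjG by (intro linkedD[of H Z Y]) blast+
    qed
    show "linked G (nodes G)" by fact
    show "y \<in> Z \<and> z \<in> Z \<or> r' y = r' z" if "adjacent G y z" for y z
      using that H vadj xv by (auto simp: adjG add_eq_conv_ex r'_def)
  qed
  moreover have "loaded G Z r' z" if "loaded H Z r z" for z
  proof -
    obtain S where S: "S \<subseteq> nodes H - Z" "S \<noteq> {}" "r ` S \<subseteq> {z}" "card S \<le> size (inner_edges H S)"
      using \<open>loaded H Z r z\<close> unfolding loaded_def by blast
    have "v \<notin> S" using S N by auto
    moreover have "r' ` S \<subseteq> {z}" using S \<open>v \<notin> S\<close> by (auto simp: r'_def)
    ultimately show ?thesis using S N inner[of S] unfolding loaded_def by (intro exI[of _ S]) auto
  qed
  ultimately show thesis using that by blast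
qed

lemma hung_cycle_smooth_steps:
  assumes "smooth_step\<^sup>*\<^sup>* G H" "wf_multigraph G"
  shows "wf_multigraph H \<and> (\<forall>Z r. hung_cycle H Z r \<longrightarrow>
     (\<exists>Z' r'. hung_cycle G Z' r' \<and> Z \<subseteq> Z' \<and> (\<forall>z \<in> Z. loaded H Z r z \<longrightarrow> loaded G Z' r' z)))"
  using assms
proof induction
  case base
  then show ?case by blast
next
  case (step H K)
  have wfH: "wf_multigraph H" using step by blast
  show ?case
  proof (intro conjI allI impI)
    show "wf_multigraph K" using wf_smooth_step step by blast
    fix Z r assume "hung_cycle K Z r"
    from hung_cycle_smooth_step[OF step(2) wfH this]
    obtain Z1 r1 where 1: "hung_cycle H Z1 r1" "Z \<subseteq> Z1" "\<And>z. z \<in> Z \<Longrightarrow> loaded K Z r z \<Longrightarrow> loaded H Z1 r1 z"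
      by metis
    then obtain Z2 r2 where "hung_cycle G Z2 r2" "Z1 \<subseteq> Z2" "\<forall>z \<in> Z1. loaded H Z1 r1 z \<longrightarrow> loaded G Z2 r2 z"
      using step by metis
    then show "\<exists>Z' r'. hung_cycle G Z' r' \<and> Z \<subseteq> Z' \<and> (\<forall>z\<in>Z. loaded K Z r z \<longrightarrow> loaded G Z' r' z)"
      using 1 by blast
  qed
qed

lemma hung_cycle_prune_steps:
  assumes "prune_step\<^sup>*\<^sup>* G H" "wf_multigraph G"
  shows "wf_multigraph H \<and> (\<forall>Z r. hung_cycle H Z r \<longrightarrow>
     (\<exists>r'. hung_cycle G Z r' \<and> (\<forall>z. loaded H Z r z \<longrightarrow> loaded G Z r' z)))"
  using assms
proof induction
  case base
  then show ?case by blast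
next
  case (step H K)
  have wfH: "wf_multigraph H" using step by blast
  show ?case
  proof (intro conjI allI impI)
    show "wf_multigraph K" using wf_prune_step step by blast
    fix Z r assume "hung_cycle K Z r"
    from hung_cycle_prune_step[OF step(2) wfH this]
    obtain r1 where 1: "hung_cycle H Z r1" "\<And>z. loaded K Z r z \<Longrightarrow> loaded H Z r1 z"
      by metis
    then obtain r2 where "hung_cycle G Z r2" "\<forall>z. loaded H Z r1 z \<longrightarrow> loaded G Z r2 z"
      using step by metis
    then show "\<exists>r'. hung_cycle G Z r' \<and> (\<forall>z. loaded K Z r z \<longrightarrow> loaded G Z r' z)"
      using 1 by blast
  qed
qed

section \<open>From a sprawling triangle to a cycle with three loaded nodes\<close>

text \<open>
  The retraction collapses each of the three attached subgraphs to its node of the triangle; a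
  connected graph of positive genus has at least as many edges as nodes.
\<close>

lemma hung_cycle_of_sprawling_triangle:
  assumes sprawling: "has_sprawling_triangle G" and wf: "wf_multigraph G"
  obtains Z r v1 v2 v3 where "hung_cycle G Z r" "{v1, v2, v3} \<subseteq> Z" "card {v1, v2, v3} = 3"
    "\<forall>z \<in> {v1, v2, v3}. loaded G Z r z"
proof -
  obtain v1 v2 v3 w1 w2 w3 G1 G2 G3 where
      v: "v1 \<noteq> v2" "v2 \<noteq> v3" "v1 \<noteq> v3"
    and sub: "\<forall>H \<in> {G1, G2, G3}.
           subgraph H G \<and> connected_graph H \<and> genus H > 0 \<and> nodes H \<inter> {v1, v2, v3} = {}"
    and dj: "nodes G1 \<inter> nodes G2 = {}" "nodes G2 \<inter> nodes G3 = {}" "nodes G1 \<inter> nodes G3 = {}"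
    and w: "w1 \<in> nodes G1" "w2 \<in> nodes G2" "w3 \<in> nodes G3"
    and cut: "\<forall>e \<in> {{#v1, w1#}, {#v2, w2#}, {#v3, w3#}}. cut_edge G e"
    and N: "nodes G = {v1, v2, v3} \<union> nodes G1 \<union> nodes G2 \<union> nodes G3"
    and E: "edges G = {#{#v1, v2#}, {#v2, v3#}, {#v1, v3#}#}
                + {#{#v1, w1#}, {#v2, w2#}, {#v3, w3#}#}
                + edges G1 + edges G2 + edges G3"
    using sprawling unfolding has_sprawling_triangle_def
    by (elim exE conjE) (rule that; assumption)
  define Z where "Z = {v1, v2, v3}"
  define r where "r x = (if x \<in> nodes G1 then v1 else if x \<in> nodes G2 then v2
                         else if x \<in> nodes G3 then v3 else x)" for x
  have NZ: "nodes H \<inter> Z = {}" if "H \<in> {G1, G2, G3}" for H using sub that Z_def by blast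
  have wfH: "wf_multigraph H" if "H \<in> {G1, G2, G3}" for H
    using sub that unfolding subgraph_def by blast
  have rG: "r x = v1" if "x \<in> nodes G1" for x using that by (simp add: r_def)
  have rG2: "r x = v2" if "x \<in> nodes G2" for x using that dj by (auto simp: r_def)
  have rG3: "r x = v3" if "x \<in> nodes G3" for x using that dj by (auto simp: r_def)
  have rZ: "r z = z" if "z \<in> Z" for z using that NZ by (auto simp: r_def)
  have none: "filter_mset (\<lambda>e. set_mset e \<subseteq> Z) (edges H) = {#}" if "H \<in> {G1, G2, G3}" for H
  proof -
    have "\<not> set_mset e \<subseteq> Z" if "e \<in># edges H" for e
    proof -
      have "size e = 2" "set_mset e \<subseteq> nodes H"
        using wfH[OF \<open>H \<in> {G1, G2, G3}\<close>] that unfolding wf_multigraph_def by blast+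
      moreover obtain x where "x \<in># e" using \<open>size e = 2\<close> by (cases e) auto
      ultimately show ?thesis using NZ[OF \<open>H \<in> {G1, G2, G3}\<close>] by blast
    qed
    then show ?thesis by simp
  qed
  have wZ: "w1 \<notin> Z" "w2 \<notin> Z" "w3 \<notin> Z" using NZ w by auto
  have inner: "inner_edges G Z = {#{#v1, v2#}, {#v2, v3#}, {#v1, v3#}#}"
    using none[of G1] none[of G2] none[of G3] wZ v unfolding inner_edges_def E filter_union_mset
    by (auto simp: Z_def)
  have conn: "linked G (nodes G)"
    using linked_if_connected_graph[OF wf] cut unfolding cut_edge_def by blast
  have adjZ: "adjacent G x y" if "x \<in> Z" "y \<in> Z" "x \<noteq> y" for x y
    using that unfolding Z_def adjacent_def E by (auto simp: add_mset_commute)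
  have "hung_cycle G Z r"
    unfolding hung_cycle_def
  proof (intro conjI allI ballI impI)
    show "Z \<subseteq> nodes G" using N Z_def by blast
    show "r z = z" if "z \<in> Z" for z using rZ that .
    show "inner_degree G Z z = 2" if "z \<in> Z" for z
      using that v unfolding inner_degree_def inner by (auto simp: Z_def)
    show "r ` nodes G \<subseteq> Z" unfolding N by (auto simp: r_def Z_def)
    show "linked G Z"
      unfolding linked_def
    proof (intro allI impI, elim conjE)
      fix Y assume Y: "Y \<subseteq> Z" "Y \<noteq> {}" and cl: "\<forall>x\<in>Y. \<forall>y\<in>Z. adjacent G x y \<longrightarrow> y \<in> Y"
      obtain x where x: "x \<in> Y" using Y by blast
      have "y \<in> Y" if "y \<in> Z" for y
      proof (cases "x = y")
        case False
        then have "adjacent G x y" using adjZ x Y that by blast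
        then show ?thesis using cl x that by blast
      qed (use x in simp)
      then show "Y = Z" using Y by blast
    qed
    show "linked G (nodes G)" by fact
    show "x \<in> Z \<and> y \<in> Z \<or> r x = r y" if adj: "adjacent G x y" for x y
    proof -
      have inG: "x \<in> nodes H \<and> y \<in> nodes H" if "{#x, y#} \<in># edges H" "H \<in> {G1, G2, G3}" for H
        using wfH[OF that(2)] that(1) unfolding wf_multigraph_def by fastforce
      consider "{#x, y#} \<in># {#{#v1, v2#}, {#v2, v3#}, {#v1, v3#}#}"
        | "{#x, y#} = {#v1, w1#}" | "{#x, y#} = {#v2, w2#}" | "{#x, y#} = {#v3, w3#}"
        | "{#x, y#} \<in># edges G1" | "{#x, y#} \<in># edges G2" | "{#x, y#} \<in># edges G3"
        using adj unfolding adjacent_def E by auto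
      then show ?thesis
      proof cases
        case 1
        then show ?thesis by (auto simp: Z_def add_eq_conv_ex)
      next
        case 2
        then show ?thesis using rZ[of v1] w rG by (auto simp: add_eq_conv_ex Z_def)
      next
        case 3
        then show ?thesis using rZ[of v2] w rG2 by (auto simp: add_eq_conv_ex Z_def)
      next
        case 4
        then show ?thesis using rZ[of v3] w rG3 by (auto simp: add_eq_conv_ex Z_def)
      next
        case 5
        then show ?thesis using inG rG by simp
      next
        case 6
        then show ?thesis using inG rG2 by simp
      next
        case 7
        then show ?thesis using inG rG3 by simp
      qed
    qed
  qed
  moreover have load: "loaded G Z r z" if "H \<in> {G1, G2, G3}" "nodes H \<noteq> {}" "\<forall>x \<in> nodes H. r x = z" for H z
    unfolding loaded_def
  proof (intro exI[of _ "nodes H"] conjI)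
    show "nodes H \<subseteq> nodes G - Z" using NZ[OF that(1)] N that(1) by auto
    show "nodes H \<noteq> {}" "r ` nodes H \<subseteq> {z}" using that by auto
    have "inner_edges H (nodes H) = edges H"
      using wfH[OF that(1)] unfolding inner_edges_def wf_multigraph_def
      by (simp add: filter_mset_eq_conv)
    moreover have "inner_edges H (nodes H) \<subseteq># inner_edges G (nodes H)"
      using sub that(1) by (intro inner_edges_mono) (auto simp: subgraph_def)
    moreover have "card (nodes H) \<le> size (edges H)"
      using sub that(1) unfolding genus_def by fastforce
    ultimately show "card (nodes H) \<le> size (inner_edges G (nodes H))"
      using size_mset_mono by fastforce
  qed
  have "\<forall>z \<in> {v1, v2, v3}. loaded G Z r z"
    using load[of G1 v1] load[of G2 v2] load[of G3 v3] w rG rG2 rG3 by auto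
  moreover have "card {v1, v2, v3} = 3" using v by simp
  ultimately show thesis using that[of Z r v1 v2 v3] Z_def by blast
qed

lemma hung_cycle_of_dual_graph:
  assumes wf: "wf_multigraph (dual_graph \<Delta>)" and skel: "skeleton_of \<Delta> G" and "has_sprawling_triangle G"
  obtains Z r v1 v2 v3 where "hung_cycle (dual_graph \<Delta>) Z r" "{v1, v2, v3} \<subseteq> Z" "card {v1, v2, v3} = 3"
    "\<forall>z \<in> {v1, v2, v3}. loaded (dual_graph \<Delta>) Z r z"
proof -
  obtain H where H: "prune_step\<^sup>*\<^sup>* (dual_graph \<Delta>) H" "smooth_step\<^sup>*\<^sup>* H G"
    using skel unfolding skeleton_of_def pruning_of_def smoothing_of_def by blast
  note P = hung_cycle_prune_steps[OF H(1) wf]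
  then have S: "wf_multigraph G \<and> (\<forall>Z r. hung_cycle G Z r \<longrightarrow>
     (\<exists>Z' r'. hung_cycle H Z' r' \<and> Z \<subseteq> Z' \<and> (\<forall>z \<in> Z. loaded G Z r z \<longrightarrow> loaded H Z' r' z)))"
    using hung_cycle_smooth_steps[OF H(2)] by blast
  obtain Z r v1 v2 v3 where Z: "hung_cycle G Z r" "{v1, v2, v3} \<subseteq> Z" "card {v1, v2, v3} = 3"
    "\<forall>z \<in> {v1, v2, v3}. loaded G Z r z"
    using hung_cycle_of_sprawling_triangle[of G] S assms by metis
  obtain Z' r' where Z': "hung_cycle H Z' r'" "Z \<subseteq> Z'" "\<forall>z \<in> Z. loaded G Z r z \<longrightarrow> loaded H Z' r' z"
    using S Z by metis
  obtain r'' where "hung_cycle (dual_graph \<Delta>) Z' r''" "\<forall>z. loaded H Z' r' z \<longrightarrow> loaded (dual_graph \<Delta>) Z' r'' z"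
    using P Z' by metis
  moreover have "{v1, v2, v3} \<subseteq> Z'" using Z(2) Z'(2) by (rule subset_trans)
  moreover have "\<forall>z \<in> {v1, v2, v3}. loaded (dual_graph \<Delta>) Z' r'' z"
  proof
    fix z assume "z \<in> {v1, v2, v3}"
    then have "loaded G Z r z" "z \<in> Z" using Z by (auto simp del: insert_iff)
    then show "loaded (dual_graph \<Delta>) Z' r'' z" using Z' calculation(2) by simp
  qed
  ultimately show thesis using Z(3) by (intro that)
qed

section \<open>Parity of cuts, and lattice triangles of area one half\<close>

lemma even_card_symmetric_pairs:
  assumes "finite A" "\<And>x y. R x y \<Longrightarrow> R y x" "\<And>x. \<not> R x x"
  shows "even (card {(x, y). x \<in> A \<and> y \<in> A \<and> R x y})"
  using assms(1)
proof induction
  case (insert a A)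
  let ?N = "{y \<in> A. R a y}"
  have "{(x, y). x \<in> insert a A \<and> y \<in> insert a A \<and> R x y} =
      {(x, y). x \<in> A \<and> y \<in> A \<and> R x y} \<union> (Pair a ` ?N \<union> (\<lambda>y. (y, a)) ` ?N)"
    using assms(2,3) by auto
  moreover have "card (Pair a ` ?N \<union> (\<lambda>y. (y, a)) ` ?N) = card ?N + card ?N"
    using insert by (subst card_Un_disjoint) (auto simp: card_image inj_on_def)
  moreover have "finite {(x, y). x \<in> A \<and> y \<in> A \<and> R x y}"
    by (rule finite_subset[of _ "A \<times> A"]) (use insert in auto)
  ultimately have "card {(x, y). x \<in> insert a A \<and> y \<in> insert a A \<and> R x y} =
      card {(x, y). x \<in> A \<and> y \<in> A \<and> R x y} + (card ?N + card ?N)"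
    using insert by (subst \<open>_ = _ \<union> _\<close>, subst card_Un_disjoint) auto
  then show ?case using insert by simp
qed simp

text \<open>
  Counting the ends of the edges of a two-regular graph that lie in \<open>A\<close>: twice the size of \<open>A\<close> is an even
  number, for the edges inside \<open>A\<close>, plus the number of edges that leave \<open>A\<close>.
\<close>

lemma no_single_crossing:
  assumes fin: "finite X" and sym: "\<And>x y. R x y \<Longrightarrow> R y x" and irr: "\<And>x. \<not> R x x"
    and two: "\<And>x. x \<in> X \<Longrightarrow> card {y \<in> X. R x y} = 2"
    and A: "A \<subseteq> X" "a \<in> A" "b \<in> X - A" "R a b"
    and only: "\<And>x y. x \<in> A \<Longrightarrow> y \<in> X - A \<Longrightarrow> R x y \<Longrightarrow> x = a \<and> y = b"
  shows False
proof -
  have finA: "finite A" using A fin finite_subset by blast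
  have "(SIGMA x:A. {y \<in> X. R x y}) = insert (a, b) {(x, y). x \<in> A \<and> y \<in> A \<and> R x y}"
  proof (intro equalityI subsetI)
    fix p assume "p \<in> (SIGMA x:A. {y \<in> X. R x y})"
    then obtain x y where "p = (x, y)" "x \<in> A" "y \<in> X" "R x y" by auto
    then show "p \<in> insert (a, b) {(x, y). x \<in> A \<and> y \<in> A \<and> R x y}"
      using only[of x y] by (cases "y \<in> A") auto
  qed (use A in auto)
  moreover have "card (SIGMA x:A. {y \<in> X. R x y}) = card A * 2"
    using two A fin finA by (subst card_SigmaI) (auto simp: subset_iff)
  moreover have "finite {(x, y). x \<in> A \<and> y \<in> A \<and> R x y}"
    by (rule finite_subset[of _ "A \<times> A"]) (use finA in auto)
  ultimately have "card A * 2 = Suc (card {(x, y). x \<in> A \<and> y \<in> A \<and> R x y})"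
    using A by simp
  moreover have "even (card {(x, y). x \<in> A \<and> y \<in> A \<and> R x y})"
    using even_card_symmetric_pairs[of A R] finA sym irr by blast
  ultimately show False by (metis dvd_triv_right even_Suc)
qed

text \<open>
  Twice the signed area of the triangle spanned by two vectors.
\<close>

definition cross2 :: "real^2 \<Rightarrow> real^2 \<Rightarrow> real" where
  "cross2 u v = u $ 1 * v $ 2 - u $ 2 * v $ 1"

lemma cross2_simps [simp]:
  "cross2 u u = 0" "cross2 0 u = 0" "cross2 u 0 = 0"
  "cross2 (c *\<^sub>R u) v = c * cross2 u v" "cross2 u (c *\<^sub>R v) = c * cross2 u v"
  by (simp_all add: cross2_def algebra_simps)

lemma cross2_add:
  "cross2 (u + w) v = cross2 u v + cross2 w v" "cross2 u (v + w) = cross2 u v + cross2 u w"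
  "cross2 (u - w) v = cross2 u v - cross2 w v" "cross2 u (v - w) = cross2 u v - cross2 u w"
  by (simp_all add: cross2_def algebra_simps)

lemma cross2_cramer: "cross2 u v *\<^sub>R w = cross2 w v *\<^sub>R u + cross2 u w *\<^sub>R v"
  by (simp add: cross2_def vec_eq_iff forall_2 algebra_simps)

lemma lattice_simps:
  "u \<in> integer_lattice \<Longrightarrow> v \<in> integer_lattice \<Longrightarrow> u + v \<in> integer_lattice"
  "u \<in> integer_lattice \<Longrightarrow> v \<in> integer_lattice \<Longrightarrow> u - v \<in> integer_lattice"
  "u \<in> integer_lattice \<Longrightarrow> v \<in> integer_lattice \<Longrightarrow> cross2 u v \<in> \<int>"
  "u \<in> integer_lattice \<Longrightarrow> c \<in> \<int> \<Longrightarrow> c *\<^sub>R u \<in> integer_lattice"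
  by (auto simp: integer_lattice_def cross2_def)

lemma unit_square: "c * c = 1" if "\<bar>c :: real\<bar> = 1"
  using that by (metis abs_mult_self_eq mult_1)

text \<open>
  A unimodular determinant is its own inverse, so Cramer's rule needs no division.
\<close>

lemma scaleR_unit_swap:
  fixes X Y :: "'a::real_vector"
  assumes "\<bar>c\<bar> = 1" "c *\<^sub>R X = Y"
  shows "X = c *\<^sub>R Y"
proof -
  have "c *\<^sub>R Y = (c * c) *\<^sub>R X" by (simp flip: assms(2))
  then show ?thesis by (simp only: unit_square[OF assms(1)] scaleR_one)
qed

lemma affine_coords:
  assumes "\<bar>cross2 (q - p) (w - p)\<bar> = 1"
  shows "z = p + (cross2 (q - p) (w - p) * cross2 (z - p) (w - p)) *\<^sub>R (q - p)
              + (cross2 (q - p) (w - p) * cross2 (q - p) (z - p)) *\<^sub>R (w - p)"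
proof -
  let ?c = "cross2 (q - p) (w - p)"
  have "z - p = ?c *\<^sub>R (cross2 (z - p) (w - p) *\<^sub>R (q - p) + cross2 (q - p) (z - p) *\<^sub>R (w - p))"
    by (rule scaleR_unit_swap[OF assms cross2_cramer])
  then have "z - p = (?c * cross2 (z - p) (w - p)) *\<^sub>R (q - p) + (?c * cross2 (q - p) (z - p)) *\<^sub>R (w - p)"
    by (simp only: scaleR_add_right scaleR_scaleR)
  note arg_cong[OF this, of "(+) p"]
  moreover have "p + (z - p) = z" by simp
  ultimately show ?thesis by (simp only: add.assoc)
qed

lemma affine_coords_unique:
  assumes "cross2 u v \<noteq> 0" "s *\<^sub>R u + t *\<^sub>R v = s' *\<^sub>R u + t' *\<^sub>R v"
  shows "s = s'" "t = t'"
proof -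
  have "cross2 (s *\<^sub>R u + t *\<^sub>R v) v = cross2 (s' *\<^sub>R u + t' *\<^sub>R v) v"
       "cross2 u (s *\<^sub>R u + t *\<^sub>R v) = cross2 u (s' *\<^sub>R u + t' *\<^sub>R v)"
    using assms(2) by simp_all
  then show "s = s'" "t = t'" using assms(1) by (simp_all add: cross2_add)
qed

lemma cross2_triangle_perms:
  "cross2 (w - p) (q - p) = - cross2 (q - p) (w - p)"
  "cross2 (p - q) (w - q) = - cross2 (q - p) (w - p)"
  "cross2 (w - q) (p - q) = cross2 (q - p) (w - p)"
  "cross2 (p - w) (q - w) = cross2 (q - p) (w - p)"
  "cross2 (q - w) (p - w) = - cross2 (q - p) (w - p)"
  by (simp_all add: cross2_def algebra_simps)

lemma lattice_points_of_unimodular_triangle: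
  assumes "p \<in> integer_lattice" "q \<in> integer_lattice" "w \<in> integer_lattice"
    and unit: "\<bar>cross2 (q - p) (w - p)\<bar> = 1"
  shows "(convex hull {p, q, w}) \<inter> integer_lattice = {p, q, w}"
proof
  show "{p, q, w} \<subseteq> convex hull {p, q, w} \<inter> integer_lattice"
    using assms hull_subset[of "{p, q, w}" convex] by auto
  show "convex hull {p, q, w} \<inter> integer_lattice \<subseteq> {p, q, w}"
  proof
    fix z assume z: "z \<in> convex hull {p, q, w} \<inter> integer_lattice"
    let ?c = "cross2 (q - p) (w - p)"
    obtain s t where st: "0 \<le> s" "0 \<le> t" "s + t \<le> 1" and zst: "z = p + s *\<^sub>R (q - p) + t *\<^sub>R (w - p)"
      using z unfolding convex_hull_3_alt by blast
    have c0: "?c \<noteq> 0" using unit by auto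
    have "s *\<^sub>R (q - p) + t *\<^sub>R (w - p) =
        (?c * cross2 (z - p) (w - p)) *\<^sub>R (q - p) + (?c * cross2 (q - p) (z - p)) *\<^sub>R (w - p)"
      using trans[OF zst[symmetric] affine_coords[OF unit]] by (simp only: add.assoc add_left_cancel)
    note st_eq = affine_coords_unique[OF c0 this]
    have "s \<in> \<int>" "t \<in> \<int>"
      unfolding st_eq using assms z by (auto intro!: Ints_mult lattice_simps)
    then obtain i j :: int where ij: "s = of_int i" "t = of_int j" by (auto elim!: Ints_cases)
    have "(i = 0 \<and> j = 0) \<or> (i = 1 \<and> j = 0) \<or> (i = 0 \<and> j = 1)"
      using st unfolding ij by linarith
    then show "z \<in> {p, q, w}" unfolding zst ij by auto
  qed
qed

text \<open>
  The signed distance from a side of a triangle, up to the factor \<open>x\<close>, is read off from the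
  coefficient of the vector that leads away from this side.
\<close>

lemma cross2_comb:
  "x * cross2 v (s *\<^sub>R v + t *\<^sub>R w) = t * (x * cross2 v w)"
  by (simp add: cross2_add)

lemma orthogonal_to_basis:
  assumes "cross2 u v \<noteq> 0" "a \<bullet> u = 0" "a \<bullet> v = 0"
  shows "a = 0"
  using arg_cong[OF cross2_cramer[of u v a], of "inner a"] assms by (simp add: inner_add_right)

text \<open>
  A functional that vanishes along a side takes opposite values on the apexes of the two unimodular
  triangles on this side.
\<close>

lemma inner_reflected:
  fixes a :: "'x::real_inner"
  assumes "a \<bullet> Y = 0" "c * c = 1"
  shows "a \<bullet> (c *\<^sub>R (k *\<^sub>R Y + (- c) *\<^sub>R W)) = - (a \<bullet> W)"
proof -
  have "a \<bullet> (c *\<^sub>R (k *\<^sub>R Y + (- c) *\<^sub>R W)) = c * k * (a \<bullet> Y) - (c * c) * (a \<bullet> W)"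
    by (simp add: inner_add_right inner_diff_right algebra_simps)
  then show ?thesis using assms by simp
qed

lemma scale_zero_comb: "X = c *\<^sub>R (a *\<^sub>R Y + 0 *\<^sub>R W) \<Longrightarrow> X = (c * a) *\<^sub>R Y" for X :: "'x::real_vector"
  by simp

lemma measure_hull_triangle:
  fixes x y z :: "real^2"
  shows "convex hull {x, y, z} \<in> lmeasurable" "measure lebesgue (convex hull {x, y, z}) = \<bar>cross2 (y - x) (z - x)\<bar> / 2"
proof -
  have "compact (convex hull {x, y, z})" by (simp add: finite_imp_compact_convex_hull)
  then show "convex hull {x, y, z} \<in> lmeasurable" by (rule lmeasurable_compact)
  have "measure lebesgue (convex hull {x, y, z}) = measure lborel (convex hull {x, y, z})"
    using \<open>compact (convex hull {x, y, z})\<close> by (intro measure_completion) (simp add: borel_compact)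
  then show "measure lebesgue (convex hull {x, y, z}) = \<bar>cross2 (y - x) (z - x)\<bar> / 2"
    unfolding content_triangle cross2_def by (simp add: abs_minus_commute algebra_simps)
qed

text \<open>
  The ten lattice points of the polygon that will emerge, for a basis \<open>A, B\<close> of the plane.
\<close>

lemma distinct_hexagon_points:
  assumes "cross2 A B \<noteq> 0" "C = - (A + B)"
  shows "distinct [p, p + A, p + B, p + C, p - A, p - B, p - C, p - 2 *\<^sub>R A, p - 2 *\<^sub>R B, p - 2 *\<^sub>R C]"
proof -
  have rep: "p = p + (0 *\<^sub>R A + 0 *\<^sub>R B)" "p + A = p + (1 *\<^sub>R A + 0 *\<^sub>R B)" "p + B = p + (0 *\<^sub>R A + 1 *\<^sub>R B)"
    "p + C = p + ((-1) *\<^sub>R A + (-1) *\<^sub>R B)" "p - A = p + ((-1) *\<^sub>R A + 0 *\<^sub>R B)"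
    "p - B = p + (0 *\<^sub>R A + (-1) *\<^sub>R B)" "p - C = p + (1 *\<^sub>R A + 1 *\<^sub>R B)"
    "p - 2 *\<^sub>R A = p + ((-2) *\<^sub>R A + 0 *\<^sub>R B)" "p - 2 *\<^sub>R B = p + (0 *\<^sub>R A + (-2) *\<^sub>R B)"
    "p - 2 *\<^sub>R C = p + (2 *\<^sub>R A + 2 *\<^sub>R B)"
    unfolding assms(2) by (simp_all add: algebra_simps)
  have inj: "inj (\<lambda>(x, y). p + (x *\<^sub>R A + y *\<^sub>R B))"
    by (rule injI) (use affine_coords_unique[OF assms(1)] in auto)
  let ?L = "[(0, 0), (1, 0), (0, 1), (-1, -1), (-1, 0), (0, -1), (1, 1), (-2, 0), (0, -2), (2, 2)] :: (real \<times> real) list"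
  have "distinct ?L" by simp
  moreover have "inj_on (\<lambda>(x, y). p + (x *\<^sub>R A + y *\<^sub>R B)) (set ?L)" by (rule inj_on_subset[OF inj subset_UNIV])
  ultimately have "distinct (map (\<lambda>(x, y). p + (x *\<^sub>R A + y *\<^sub>R B)) ?L)" by (simp only: distinct_map)
  then show ?thesis by (simp only: list.map prod.case rep[symmetric])
qed

text \<open>
  For a triangle of area one half these are exactly its vertices.
\<close>

definition verts :: "(real^2) set \<Rightarrow> (real^2) set" where
  "verts T = T \<inter> integer_lattice"

section \<open>Cells of a unimodular triangulation\<close>

locale unimodular_complex =
  fixes P :: "(real^2) set" and \<Delta> :: "(real^2) set set"
  assumes polygon: "lattice_polygon P" and unimodular: "unimodular_triangulation P \<Delta>"
begin

lemma convex_P: "convex P"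
  using polygon unfolding lattice_polygon_def by (auto intro: convex_convex_hull)

lemma finite_cells: "finite \<Delta>" and Union_cells: "\<Union>\<Delta> = P"
  using unimodular unfolding unimodular_triangulation_def triangulation_def by auto

lemma cell_subset: "T \<in> \<Delta> \<Longrightarrow> T \<subseteq> P"
  using Union_cells by blast

lemma cell_triangle:
  assumes "T \<in> \<Delta>"
  obtains p q w where "T = convex hull {p, q, w}" "verts T = {p, q, w}" "\<bar>cross2 (q - p) (w - p)\<bar> = 1"
    "{v. v extreme_point_of T} = {p, q, w}"
proof -
  have T: "2 simplex T" "{v. v extreme_point_of T} \<subseteq> P \<inter> integer_lattice" "measure lebesgue T = 1 / 2"
    using unimodular assms unfolding unimodular_triangulation_def by blast+
  then obtain C where C: "\<not> affine_dependent C" "int (card C) = 2 + 1" "T = convex hull C"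
    unfolding simplex_def by blast
  then have "card C = 3" by simp
  then obtain p q w where Ceq: "C = {p, q, w}" by (auto simp: card_3_iff)
  have ext: "{v. v extreme_point_of T} = {p, q, w}"
    using extreme_point_of_convex_hull_affine_independent[OF C(1)] C(3) Ceq by auto
  have Teq: "T = convex hull {p, q, w}" using C Ceq by simp
  have lat: "p \<in> integer_lattice" "q \<in> integer_lattice" "w \<in> integer_lattice" using T ext by auto
  have "\<bar>cross2 (q - p) (w - p)\<bar> = 1"
    using T(3) unfolding Teq measure_hull_triangle(2) by simp
  with that Teq ext lattice_points_of_unimodular_triangle[OF lat] show thesis
    unfolding verts_def by blast
qed

lemma card_verts: "T \<in> \<Delta> \<Longrightarrow> card (verts T) = 3"
proof -
  assume "T \<in> \<Delta>"
  then obtain p q w where "verts T = {p, q, w}" "\<bar>cross2 (q - p) (w - p)\<bar> = 1"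
    by (rule cell_triangle)
  moreover from this have "p \<noteq> q" "p \<noteq> w" "q \<noteq> w" by auto
  ultimately show ?thesis by simp
qed

lemma finite_verts: "T \<in> \<Delta> \<Longrightarrow> finite (verts T)"
  using card_verts card.infinite by fastforce

lemma cell_eq_hull: "T \<in> \<Delta> \<Longrightarrow> T = convex hull (verts T)"
  by (metis cell_triangle)

lemma vert_lattice: "v \<in> verts T \<Longrightarrow> v \<in> integer_lattice" and vert_in: "v \<in> verts T \<Longrightarrow> v \<in> T"
  by (auto simp: verts_def)

lemma cell_unit:
  assumes "T \<in> \<Delta>" "verts T = {x, y, w}" shows "\<bar>cross2 (y - x) (w - x)\<bar> = 1"
proof -
  obtain p q r where pqr: "verts T = {p, q, r}" "\<bar>cross2 (q - p) (r - p)\<bar> = 1"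
    using assms(1) by (rule cell_triangle)
  have d: "x \<noteq> y" "x \<noteq> w" "y \<noteq> w"
    using card_verts[OF assms(1)] unfolding assms(2) by (auto simp: card_insert_if split: if_splits)
  have "(x = p \<and> y = q \<and> w = r) \<or> (x = p \<and> y = r \<and> w = q) \<or> (x = q \<and> y = p \<and> w = r) \<or>
        (x = q \<and> y = r \<and> w = p) \<or> (x = r \<and> y = p \<and> w = q) \<or> (x = r \<and> y = q \<and> w = p)"
    using d pqr(1) assms(2) by (metis insert_iff singletonD)
  then show ?thesis using pqr(2) cross2_triangle_perms[of r p q] by auto
qed

lemma cell_third_vertex:
  assumes "T \<in> \<Delta>" "x \<in> verts T" "y \<in> verts T" "x \<noteq> y"
  obtains w where "verts T = {x, y, w}" "w \<noteq> x" "w \<noteq> y"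
proof -
  have "card (verts T - {x, y}) = 1"
    using card_verts[OF assms(1)] assms finite_verts[OF assms(1)] by (simp add: card_Diff_subset)
  then obtain w where "verts T - {x, y} = {w}" by (meson card_1_singletonE)
  then show thesis using that[of w] assms by blast
qed

lemma cell_two_more_vertices:
  assumes "T \<in> \<Delta>" "x \<in> verts T"
  obtains y w where "verts T = {x, y, w}" "y \<noteq> x" "w \<noteq> x" "w \<noteq> y"
proof -
  have "verts T \<noteq> {x}" using card_verts[OF assms(1)] by auto
  then obtain y where "y \<in> verts T" "x \<noteq> y" using assms by blast
  then show thesis using cell_third_vertex[OF assms(1,2), of y] that by metis
qed

text \<open>
  Two triangles meet in a common face, so a triangle that contains a point from the interior of a segment in
  another triangle contains the whole segment.
\<close>

lemma face_of_common:
  assumes "T \<in> \<Delta>" "T' \<in> \<Delta>" "(1 - u) *\<^sub>R x + u *\<^sub>R y \<in> T'" "x \<in> T" "y \<in> T" "0 < u" "u < 1"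
  shows "x \<in> T'" "y \<in> T'"
proof -
  let ?m = "(1 - u) *\<^sub>R x + u *\<^sub>R y"
  have conv: "convex T" by (metis cell_eq_hull[OF assms(1)] convex_convex_hull)
  have mT: "?m \<in> T" using convexD[OF conv, of x y "1 - u" u] assms by simp
  have face: "(T \<inter> T') face_of T"
    using unimodular assms unfolding unimodular_triangulation_def triangulation_def by blast
  have "x \<in> T' \<and> y \<in> T'"
  proof (cases "x = y")
    case True
    then have "?m = x" by (simp flip: scaleR_left_distrib)
    then show ?thesis using assms True by simp
  next
    case False
    then have "?m \<in> open_segment x y" using assms by (auto simp: in_segment)
    then show ?thesis using face_ofD[OF face _ assms(4,5)] mT assms(3) by blast
  qed
  then show "x \<in> T'" "y \<in> T'" by auto
qed

lemma vert_not_between: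
  assumes "T \<in> \<Delta>" "(1 - u) *\<^sub>R x + u *\<^sub>R y \<in> integer_lattice" "x \<in> T" "y \<in> T" "0 < u" "u < 1"
  shows "x = y"
proof (rule ccontr)
  assume "x \<noteq> y"
  let ?m = "(1 - u) *\<^sub>R x + u *\<^sub>R y"
  have conv: "convex T" by (metis cell_eq_hull[OF assms(1)] convex_convex_hull)
  have "?m \<in> T" using convexD[OF conv, of x y "1 - u" u] assms by simp
  then have "?m \<in> verts T" using assms by (simp add: verts_def)
  moreover obtain p q w where "verts T = {p, q, w}" "{v. v extreme_point_of T} = {p, q, w}"
    using assms(1) by (rule cell_triangle)
  ultimately have "?m extreme_point_of T" by blast
  moreover have "?m \<in> open_segment x y" using assms \<open>x \<noteq> y\<close> by (auto simp: in_segment)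
  ultimately show False using assms unfolding extreme_point_of_def by blast
qed

lemma cell_eqI:
  assumes "T \<in> \<Delta>" "T' \<in> \<Delta>" "verts T \<subseteq> verts T'" shows "T = T'"
proof -
  have "verts T = verts T'"
    using assms card_verts finite_verts by (metis card_subset_eq)
  then show ?thesis using cell_eq_hull assms by metis
qed

text \<open>
  The apexes of two unimodular triangles on the same side of \<open>x y\<close> have the same distance from it, so
  they differ by a multiple of \<open>y - x\<close>.  Just above the midpoint of \<open>x y\<close> the two triangles then
  overlap, which is impossible for different cells.
\<close>

lemma same_side_eq:
  assumes "T \<in> \<Delta>" "T' \<in> \<Delta>" and T: "verts T = {x, y, w}" and T': "verts T' = {x, y, w'}"
    and same: "cross2 (y - x) (w - x) = cross2 (y - x) (w' - x)"
  shows "T = T'"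
proof -
  let ?d = "cross2 (y - x) (w - x)"
  have unit: "\<bar>?d\<bar> = 1" using cell_unit[OF assms(1) T] .
  have zero: "cross2 (y - x) (w' - w) = 0" using same by (simp add: cross2_add)
  have "?d *\<^sub>R (w' - w) = cross2 (w' - w) (w - x) *\<^sub>R (y - x) + 0 *\<^sub>R (w - x)"
    using cross2_cramer[of "y - x" "w - x" "w' - w"] unfolding zero .
  then have "?d *\<^sub>R (w' - w) = cross2 (w' - w) (w - x) *\<^sub>R (y - x)"
    by (simp only: scaleR_zero_left add_0_right)
  from scaleR_unit_swap[OF unit this]
  obtain k where k: "w' - w = k *\<^sub>R (y - x)" by (metis scaleR_scaleR)
  \<comment> \<open>so small that shifting the apex by \<open>k\<close> moves the point \<open>z\<close> below by at most half a side\<close>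
  define e where "e = 1 / (2 * (2 + \<bar>k\<bar>))"
  have e: "0 < e" "e < 1" "e * k \<le> 1/2" "e - e * k \<le> 1/2"
    by (simp_all add: e_def field_split_simps) (use abs_ge_self[of k] abs_ge_minus_self[of k] in linarith)+
  define z where "z = x + (1/2) *\<^sub>R (y - x) + e *\<^sub>R (w - x)"
  have hull: "T = convex hull {x, y, w}" "T' = convex hull {x, y, w'}"
    using cell_eq_hull assms by metis+
  have "w = w' - k *\<^sub>R (y - x)" using k by (simp add: algebra_simps)
  then have "z = x + (1/2 - e * k) *\<^sub>R (y - x) + e *\<^sub>R (w' - x)"
    unfolding z_def by (subst \<open>w = _\<close>) (simp add: algebra_simps)
  then have "z \<in> T'" unfolding hull convex_hull_3_alt using e by (intro CollectI exI conjI) auto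
  define u where "u = (1/2) / (1 - e)"
  have eh: "e \<le> 1/4" by (simp add: e_def field_split_simps)
  have u: "0 \<le> u" "u \<le> 1" using e eh by (auto simp: u_def field_simps)
  have "(1 - e) * u = 1/2" using e by (simp add: u_def)
  then have "(1 - e) *\<^sub>R (x + u *\<^sub>R (y - x)) = (1 - e) *\<^sub>R x + (1/2) *\<^sub>R (y - x)"
    by (simp only: scaleR_add_right scaleR_scaleR)
  then have "z = (1 - e) *\<^sub>R (x + u *\<^sub>R (y - x)) + e *\<^sub>R w"
    unfolding z_def by (simp add: algebra_simps)
  moreover have "x + u *\<^sub>R (y - x) \<in> T"
    unfolding hull convex_hull_3_alt using u by (intro CollectI exI[of _ u] exI[of _ 0]) auto
  moreover have "w \<in> T" using T vert_in by blast
  ultimately have "w \<in> T'" using face_of_common(2)[OF assms(1,2), of e "x + u *\<^sub>R (y - x)" w] e \<open>z \<in> T'\<close> by simp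
  then have "w \<in> verts T'" using T vert_lattice by (auto simp: verts_def)
  then show ?thesis using cell_eqI[OF assms(1,2)] T T' by auto
qed

lemma cells_on_edge:
  assumes "T \<in> \<Delta>" "T' \<in> \<Delta>" "T'' \<in> \<Delta>" "x \<noteq> y"
    and "{x, y} \<subseteq> verts T" "{x, y} \<subseteq> verts T'" "{x, y} \<subseteq> verts T''" "T' \<noteq> T" "T'' \<noteq> T"
  shows "T' = T''"
proof -
  obtain w w' w'' where w: "verts T = {x, y, w}" "verts T' = {x, y, w'}" "verts T'' = {x, y, w''}"
    using assms by (metis cell_third_vertex insert_subset)
  have "\<bar>cross2 (y - x) (w - x)\<bar> = 1" "\<bar>cross2 (y - x) (w' - x)\<bar> = 1" "\<bar>cross2 (y - x) (w'' - x)\<bar> = 1"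
    using cell_unit[OF assms(1) w(1)] cell_unit[OF assms(2) w(2)] cell_unit[OF assms(3) w(3)] by auto
  moreover have "cross2 (y - x) (w - x) \<noteq> cross2 (y - x) (w' - x)" "cross2 (y - x) (w - x) \<noteq> cross2 (y - x) (w'' - x)"
    using same_side_eq[OF assms(1,2) w(1,2)] same_side_eq[OF assms(1,3) w(1,3)] assms by auto
  ultimately have "cross2 (y - x) (w' - x) = cross2 (y - x) (w'' - x)" by linarith
  then show ?thesis using same_side_eq[OF assms(2,3) w(2,3)] by simp
qed

section \<open>The dual graph\<close>

abbreviation adj :: "(real^2) set \<Rightarrow> (real^2) set \<Rightarrow> bool" where
  "adj \<equiv> adjacent (dual_graph \<Delta>)"

text \<open>
  The common face of two cells is spanned by their common vertices.
\<close>

lemma edge_iff: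
  assumes "T \<in> \<Delta>" "T' \<in> \<Delta>"
  shows "(T \<inter> T') edge_of T \<and> (T \<inter> T') edge_of T' \<longleftrightarrow>
         T \<noteq> T' \<and> (\<exists>x y. x \<noteq> y \<and> {x, y} \<subseteq> verts T \<inter> verts T')"
proof
  have hull: "T = convex hull (verts T)" using cell_eq_hull[OF assms(1)] .
  have comp: "compact (verts T)" by (simp add: finite_imp_compact finite_verts[OF assms(1)])
  have face: "(T \<inter> T') face_of T" "(T \<inter> T') face_of T'"
    using unimodular assms unfolding unimodular_triangulation_def triangulation_def by (metis Int_commute)+
  then obtain c where c: "c \<subseteq> verts T" "T \<inter> T' = convex hull c"
    using face_of_convex_hull_subset[OF comp] hull by metis
  have fin: "finite c" using c finite_verts[OF assms(1)] finite_subset by blast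
  have sub: "c \<subseteq> verts T'" using c hull_subset[of c convex] by (auto simp: verts_def)
  {
    assume E: "(T \<inter> T') edge_of T \<and> (T \<inter> T') edge_of T'"
    then have dim: "aff_dim c = 1" using c by (simp add: edge_of_def aff_dim_convex_hull)
    have "2 simplex T"
      using unimodular assms unfolding unimodular_triangulation_def by blast
    then have "aff_dim T = 2" by (simp add: aff_dim_simplex)
    then have "T \<noteq> T'" using E by (auto simp: edge_of_def)
    moreover have "\<not> card c \<le> 1" using aff_dim_le_card[OF fin] dim by linarith
    then have "\<not> is_singleton c" "c \<noteq> {}" by (auto simp: is_singleton_altdef)
    then obtain x y where "x \<in> c" "y \<in> c" "x \<noteq> y" by (metis all_not_in_conv is_singletonI')
    ultimately show "T \<noteq> T' \<and> (\<exists>x y. x \<noteq> y \<and> {x, y} \<subseteq> verts T \<inter> verts T')"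
      using c sub by blast
  }
  {
    assume "T \<noteq> T' \<and> (\<exists>x y. x \<noteq> y \<and> {x, y} \<subseteq> verts T \<inter> verts T')"
    then obtain x y where xy: "T \<noteq> T'" "x \<noteq> y" "{x, y} \<subseteq> verts T \<inter> verts T'" by blast
    have "c \<noteq> verts T" using cell_eqI[OF assms] sub xy by blast
    then have "card c < 3"
      using c card_verts[OF assms(1)] finite_verts[OF assms(1)] by (metis psubsetI psubset_card_mono)
    then have "aff_dim c \<le> 1" using aff_dim_le_card[OF fin] by linarith
    moreover have "{x, y} \<subseteq> T \<inter> T'" using xy vert_in by blast
    then have "aff_dim {x, y} \<le> aff_dim (convex hull c)" unfolding c(2)[symmetric] by (rule aff_dim_subset)
    then have "1 \<le> aff_dim c" using xy by (simp add: aff_dim_2 aff_dim_convex_hull)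
    ultimately have "aff_dim (T \<inter> T') = 1" using c by (simp add: aff_dim_convex_hull)
    then show "(T \<inter> T') edge_of T \<and> (T \<inter> T') edge_of T'"
      using face by (simp add: edge_of_def)
  }
qed

lemma finite_dual_edges:
  "finite {{#T, T'#} | T T'. T \<in> \<Delta> \<and> T' \<in> \<Delta> \<and> (T \<inter> T') edge_of T \<and> (T \<inter> T') edge_of T'}"
  by (rule finite_subset[of _ "(\<lambda>(T, T'). {#T, T'#}) ` (\<Delta> \<times> \<Delta>)"]) (use finite_cells in auto)

lemma dual_edges: "edges (dual_graph \<Delta>) = mset_set {{#T, T'#} | T T'. adj T T'}"
  and adj_iff: "adj T T' \<longleftrightarrow> T \<in> \<Delta> \<and> T' \<in> \<Delta> \<and> T \<noteq> T' \<and> (\<exists>x y. x \<noteq> y \<and> {x, y} \<subseteq> verts T \<inter> verts T')"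
proof -
  let ?E = "{{#T, T'#} | T T'. T \<in> \<Delta> \<and> T' \<in> \<Delta> \<and> (T \<inter> T') edge_of T \<and> (T \<inter> T') edge_of T'}"
  have E: "edges (dual_graph \<Delta>) = mset_set ?E" by (simp add: dual_graph_def)
  have adj: "adj T T' \<longleftrightarrow> T \<in> \<Delta> \<and> T' \<in> \<Delta> \<and> (T \<inter> T') edge_of T \<and> (T \<inter> T') edge_of T'" for T T'
    unfolding adjacent_def E using finite_dual_edges by (auto simp: add_eq_conv_ex Int_commute)
  show "edges (dual_graph \<Delta>) = mset_set {{#T, T'#} | T T'. adj T T'}" unfolding E adj ..
  show "adj T T' \<longleftrightarrow> T \<in> \<Delta> \<and> T' \<in> \<Delta> \<and> T \<noteq> T' \<and> (\<exists>x y. x \<noteq> y \<and> {x, y} \<subseteq> verts T \<inter> verts T')"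
    unfolding adj using edge_iff[of T T'] by blast
qed

lemma adj_sym: "adj T T' \<Longrightarrow> adj T' T" and adj_irrefl: "\<not> adj T T"
  and adj_cells: "adj T T' \<Longrightarrow> T \<in> \<Delta>" "adj T T' \<Longrightarrow> T' \<in> \<Delta>"
  by (auto simp: adj_iff)

lemma finite_adj_edges: "finite {{#T, T'#} | T T'. adj T T'}"
  by (rule finite_subset[of _ "(\<lambda>(T, T'). {#T, T'#}) ` (\<Delta> \<times> \<Delta>)"]) (use finite_cells adj_cells in auto)

lemma wf_dual_graph: "wf_multigraph (dual_graph \<Delta>)"
  unfolding wf_multigraph_def dual_edges
proof (intro conjI ballI)
  show "finite (nodes (dual_graph \<Delta>))" using finite_cells by (simp add: dual_graph_def)
  fix e assume "e \<in># mset_set {{#T, T'#} | T T'. adj T T'}"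
  then obtain T T' where "e = {#T, T'#}" "adj T T'" using finite_adj_edges by auto
  then show "size e = 2" "set_mset e \<subseteq> nodes (dual_graph \<Delta>)"
    using adj_cells[OF \<open>adj T T'\<close>] by (simp_all add: dual_graph_def)
qed

lemma adj_common:
  assumes "adj T T'"
  obtains x y where "x \<noteq> y" "verts T \<inter> verts T' = {x, y}"
proof -
  obtain x y where xy: "x \<noteq> y" "{x, y} \<subseteq> verts T \<inter> verts T'" and T: "T \<in> \<Delta>" "T' \<in> \<Delta>" "T \<noteq> T'"
    using assms by (auto simp: adj_iff)
  then obtain w where w: "verts T = {x, y, w}" using cell_third_vertex[of T x y] by blast
  have "w \<notin> verts T'" using cell_eqI[OF T(1,2)] T(3) w xy by auto
  then have "verts T \<inter> verts T' = {x, y}" using w xy by auto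
  then show thesis using that xy by blast
qed

text \<open>
  A neighbour is determined by the two vertices shared with it.
\<close>

lemma card_adj_le: "T \<in> \<Delta> \<Longrightarrow> finite {T'. adj T T'} \<and> card {T'. adj T T'} \<le> 3"
proof -
  assume T: "T \<in> \<Delta>"
  let ?N = "{T'. adj T T'}" and ?c = "\<lambda>T'. verts T \<inter> verts T'"
  let ?K = "{c. c \<subseteq> verts T \<and> card c = 2}"
  have fin: "finite ?N" by (rule finite_subset[OF _ finite_cells]) (use adj_cells in blast)
  have "inj_on ?c ?N"
  proof (rule inj_onI)
    fix T1 T2 assume 1: "T1 \<in> ?N" "T2 \<in> ?N" "?c T1 = ?c T2"
    then obtain x y where "x \<noteq> y" "?c T1 = {x, y}" using adj_common by (metis mem_Collect_eq)
    then show "T1 = T2" using cells_on_edge[of T T1 T2 x y] 1 T by (auto simp: adj_iff)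
  qed
  moreover have "?c ` ?N \<subseteq> ?K"
  proof
    fix c assume "c \<in> ?c ` ?N"
    then obtain T' where "adj T T'" "c = ?c T'" by blast
    then show "c \<in> ?K" using adj_common[of T T'] by (metis (mono_tags, lifting) Int_lower1 card_2_iff mem_Collect_eq)
  qed
  moreover have "finite ?K" using finite_verts[OF T] by simp
  moreover have "card ?K = 3" using n_subsets[OF finite_verts[OF T], of 2] card_verts[OF T]
    by (simp add: numeral_3_eq_3 numeral_2_eq_2)
  ultimately show ?thesis using fin card_inj_on_le[of ?c ?N ?K] by linarith
qed

text \<open>
  Points of \<open>P\<close> that approach an interior point of a side from the far side fill finitely many closed
  cells, so one of these cells contains the limit point.
\<close>

lemma cell_across:
  assumes T: "T \<in> \<Delta>" "verts T = {x, y, w}" and m: "(1 - u) *\<^sub>R x + u *\<^sub>R y \<in> interior P" "0 < u" "u < 1"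
  obtains T' where "T' \<in> \<Delta>" "T' \<noteq> T" "{x, y} \<subseteq> verts T'"
proof -
  define m where "m = (1 - u) *\<^sub>R x + u *\<^sub>R y"
  define h where "h z = cross2 (y - x) (w - x) * cross2 (y - x) (z - x)" for z
  define Q where "Q = {z. h z < 0}"
  have unit: "cross2 (y - x) (w - x) * cross2 (y - x) (w - x) = 1" using cell_unit[OF T] by (rule unit_square)
  have "m - x = u *\<^sub>R (y - x)" by (simp add: m_def algebra_simps)
  then have hm: "h (m - e *\<^sub>R (w - x)) = - e" for e
  proof -
    have "m - e *\<^sub>R (w - x) - x = u *\<^sub>R (y - x) + (- e) *\<^sub>R (w - x)" using \<open>m - x = _\<close> by (simp add: algebra_simps)
    then have "h (m - e *\<^sub>R (w - x)) = - e * (cross2 (y - x) (w - x) * cross2 (y - x) (w - x))"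
      unfolding h_def by (simp only: cross2_comb)
    then show ?thesis using unit by simp
  qed
  have xw: "w \<noteq> x" using unit by auto
  have clos: "m \<in> closure (Q \<inter> P)"
    unfolding closure_approachable
  proof (intro allI impI)
    fix e :: real assume "0 < e"
    obtain d where d: "0 < d" "ball m d \<subseteq> P" using m(1) unfolding m_def[symmetric] mem_interior by blast
    define k where "k = min d e / (2 * norm (w - x))"
    have nz: "norm (w - x) > 0" using xw by simp
    have k: "k > 0" using d \<open>0 < e\<close> nz by (simp add: k_def)
    have "dist (m - k *\<^sub>R (w - x)) m = k * norm (w - x)" using k by (simp add: dist_norm)
    also have "\<dots> = min d e / 2" using nz by (simp add: k_def)
    finally have "dist (m - k *\<^sub>R (w - x)) m < d" "dist (m - k *\<^sub>R (w - x)) m < e" using d \<open>0 < e\<close> by auto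
    moreover from this have "m - k *\<^sub>R (w - x) \<in> P" using d by (auto simp: dist_commute)
    moreover have "m - k *\<^sub>R (w - x) \<in> Q" using hm k by (simp add: Q_def)
    ultimately show "\<exists>z\<in>Q \<inter> P. dist z m < e" by blast
  qed
  have "closure (Q \<inter> P) \<subseteq> (\<Union>S\<in>\<Delta>. closure (Q \<inter> S))"
  proof (rule closure_minimal)
    show "Q \<inter> P \<subseteq> (\<Union>S\<in>\<Delta>. closure (Q \<inter> S))" using Union_cells closure_subset by fast
    show "closed (\<Union>S\<in>\<Delta>. closure (Q \<inter> S))" using finite_cells by (intro closed_UN) auto
  qed
  then have "m \<in> (\<Union>S\<in>\<Delta>. closure (Q \<inter> S))" using clos by blast
  then obtain T' where T': "T' \<in> \<Delta>" "m \<in> closure (Q \<inter> T')" by auto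
  have "compact T'" by (metis cell_triangle[OF T'(1)] finite_imp_compact_convex_hull finite.emptyI finite.insertI)
  then have "closed T'" by (rule compact_imp_closed)
  then have mT': "m \<in> T'" using T'(2) closure_minimal[of "Q \<inter> T'" T'] by blast
  obtain z where z: "z \<in> Q" "z \<in> T'" using T'(2) by (metis Int_iff all_not_in_conv closure_empty)
  have "0 \<le> h z" if zT: "z \<in> T" for z
  proof -
    have "T = convex hull {x, y, w}" using cell_eq_hull[OF T(1)] T(2) by simp
    then obtain s t where "0 \<le> t" and "z = x + s *\<^sub>R (y - x) + t *\<^sub>R (w - x)"
      using zT unfolding convex_hull_3_alt by blast
    then have "z - x = s *\<^sub>R (y - x) + t *\<^sub>R (w - x)" by simp
    then have "h z = t * (cross2 (y - x) (w - x) * cross2 (y - x) (w - x))"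
      unfolding h_def by (simp only: cross2_comb)
    then show ?thesis using unit \<open>0 \<le> t\<close> by simp
  qed
  then have "T' \<noteq> T" using z by (force simp: Q_def)
  moreover have "x \<in> T" "y \<in> T" using T vert_in by blast+
  then have "x \<in> T'" "y \<in> T'"
    using face_of_common[OF T(1) T'(1), of u x y] mT' m unfolding m_def by blast+
  then have "{x, y} \<subseteq> verts T'" using T vert_lattice[of _ T] by (auto simp: verts_def)
  ultimately show thesis using that T' by blast
qed

text \<open>
  The triangles around an interior lattice point form a two-regular graph.
\<close>

lemma star_two_neighbours:
  assumes T: "T \<in> \<Delta>" and p: "p \<in> verts T" "p \<in> interior P"
  shows "card {T'. adj T T' \<and> p \<in> T'} = 2"
proof -
  obtain x y where xy: "verts T = {p, x, y}" "x \<noteq> p" "y \<noteq> p" "y \<noteq> x"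
    using cell_two_more_vertices[OF T p(1)] by metis
  have mid: "(1 - 1/2) *\<^sub>R p + (1/2) *\<^sub>R v \<in> interior P" if "v \<in> verts T" "v \<noteq> p" for v
  proof -
    have "v \<in> closure P" using that vert_in cell_subset[OF T] closure_subset by blast
    then have "open_segment p v \<subseteq> interior P"
      using in_interior_closure_convex_segment[OF convex_P p(2)] by blast
    moreover have "(1 - 1/2) *\<^sub>R p + (1/2) *\<^sub>R v \<in> open_segment p v"
      using that unfolding in_segment by (intro conjI exI[of _ "1/2"]) auto
    ultimately show ?thesis by blast
  qed
  obtain T1 where T1: "T1 \<in> \<Delta>" "T1 \<noteq> T" "{p, x} \<subseteq> verts T1"
    using cell_across[OF T xy(1) mid[of x]] xy by auto
  have pyx: "verts T = {p, y, x}" using xy by auto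
  obtain T2 where T2: "T2 \<in> \<Delta>" "T2 \<noteq> T" "{p, y} \<subseteq> verts T2"
    using cell_across[OF T pyx mid[of y]] xy by auto
  have "T1 \<noteq> T2"
  proof
    assume "T1 = T2"
    then have "verts T \<subseteq> verts T1" using T1 T2 xy by auto
    then show False using cell_eqI[OF T T1(1)] T1(2) by simp
  qed
  moreover have "{T'. adj T T' \<and> p \<in> T'} = {T1, T2}"
  proof (intro equalityI subsetI)
    fix S assume "S \<in> {T'. adj T T' \<and> p \<in> T'}"
    then have S: "adj T S" "p \<in> S" "S \<in> \<Delta>" "S \<noteq> T" by (auto simp: adj_iff)
    have pS: "p \<in> verts S" using S p by (simp add: verts_def)
    obtain a b where ab: "a \<noteq> b" "verts T \<inter> verts S = {a, b}" using S(1) by (rule adj_common)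
    then have "x \<in> verts S \<or> y \<in> verts S" using xy by (metis Int_iff insertE insertI1 insertI2 singletonD)
    then show "S \<in> {T1, T2}"
    proof
      assume "x \<in> verts S"
      then have "S = T1" using cells_on_edge[of T S T1 p x] T T1 S xy pS by auto
      then show ?thesis by simp
    next
      assume "y \<in> verts S"
      then have "S = T2" using cells_on_edge[of T S T2 p y] T T2 S xy pS by auto
      then show ?thesis by simp
    qed
  next
    fix S assume S: "S \<in> {T1, T2}"
    have "adj T T1" unfolding adj_iff using T T1 xy by blast
    moreover have "adj T T2" unfolding adj_iff using T T2 xy by blast
    moreover have "p \<in> T1" "p \<in> T2" using T1 T2 vert_in by blast+
    ultimately show "S \<in> {T'. adj T T' \<and> p \<in> T'}" using S by auto
  qed
  ultimately show ?thesis by simp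
qed

section \<open>Chords of the polygon\<close>

lemma supporting_functional:
  assumes "x \<in> P" "x \<notin> interior P"
  obtains a where "a \<noteq> 0" "\<And>z. z \<in> P \<Longrightarrow> a \<bullet> z \<le> a \<bullet> x" "\<And>z. z \<in> interior P \<Longrightarrow> a \<bullet> z < a \<bullet> x"
proof -
  have "aff_dim P = 2" using polygon unfolding lattice_polygon_def by blast
  then have "affine hull P = UNIV" by (simp add: aff_dim_eq_full[symmetric])
  then have rel: "rel_interior P = interior P" by (rule rel_interior_interior)
  have "x \<in> closure P" using assms closure_subset by blast
  moreover have "x \<notin> rel_interior P" using rel assms by simp
  ultimately obtain a where a: "a \<noteq> 0" "\<And>y. y \<in> closure P \<Longrightarrow> a \<bullet> x \<le> a \<bullet> y"
      "\<And>y. y \<in> rel_interior P \<Longrightarrow> a \<bullet> x < a \<bullet> y"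
    using supporting_hyperplane_relative_frontier[OF convex_P] by metis
  show thesis
  proof (rule that[of "- a"])
    show "- a \<bullet> z \<le> - a \<bullet> x" if "z \<in> P" for z
      using a(2)[of z] that closure_subset[of P] by (auto simp: subset_iff)
    show "- a \<bullet> z < - a \<bullet> x" if "z \<in> interior P" for z
      using a(3)[of z] that rel by simp
  qed (use a in simp)
qed

lemma opposite_vertices:
  assumes "T \<in> \<Delta>" "T' \<in> \<Delta>" "T \<noteq> T'" "verts T = {x, y, w}" "verts T' = {x, y, w'}"
  shows "cross2 (y - x) (w' - x) = - cross2 (y - x) (w - x)"
  using same_side_eq[OF assms(1,2,4,5)] cell_unit[OF assms(1,4)] cell_unit[OF assms(2,5)] assms(3)
  by linarith

text \<open>
  Suppose that \<open>P\<close> extends the side beyond its end \<open>x\<close>.  A line that supports \<open>P\<close> at \<open>x\<close> must contain the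
  side, but there are cells on both of its sides.
\<close>

lemma chord_line_aux:
  assumes "T \<in> \<Delta>" "T' \<in> \<Delta>" "T \<noteq> T'" "verts T = {x, y, w}" "verts T' = {x, y, w'}"
    and x: "x \<notin> interior P" and s: "x + s *\<^sub>R (y - x) \<in> P"
  shows "0 \<le> s"
proof (rule ccontr)
  assume "\<not> 0 \<le> s"
  have in_P: "v \<in> P" if "v \<in> {x, y, w, w'}" for v
    using that assms vert_in cell_subset by (metis insertE insertI1 insertI2 singletonD subsetD)
  have "x \<in> P" using in_P by simp
  obtain a where a: "a \<noteq> 0" "\<And>z. z \<in> P \<Longrightarrow> a \<bullet> z \<le> a \<bullet> x"
      "\<And>z. z \<in> interior P \<Longrightarrow> a \<bullet> z < a \<bullet> x"
    using supporting_functional[OF \<open>x \<in> P\<close> x] by metis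
  have in_P': "y \<in> P" "w \<in> P" "w' \<in> P" using in_P by simp_all
  have "s * (a \<bullet> (y - x)) \<le> 0" using a(2)[OF s] by (simp add: inner_add_right)
  then have "0 \<le> a \<bullet> (y - x)" using \<open>\<not> 0 \<le> s\<close> by (simp add: mult_le_0_iff)
  then have ay: "a \<bullet> (y - x) = 0" using a(2)[OF in_P'(1)] by (simp add: inner_diff_right)
  have unit: "\<bar>cross2 (y - x) (w - x)\<bar> = 1" using cell_unit assms by blast
  have "w' - x = cross2 (y - x) (w - x) *\<^sub>R (cross2 (w' - x) (w - x) *\<^sub>R (y - x) + cross2 (y - x) (w' - x) *\<^sub>R (w - x))"
    by (rule scaleR_unit_swap[OF unit cross2_cramer])
  moreover have "a \<bullet> \<dots> = - (a \<bullet> (w - x))"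
    unfolding opposite_vertices[OF assms(1-5)] by (rule inner_reflected[OF ay unit_square[OF unit]])
  ultimately have "a \<bullet> (w' - x) = - (a \<bullet> (w - x))" by metis
  then have aw: "a \<bullet> (w - x) = 0" using a(2)[OF in_P'(2)] a(2)[OF in_P'(3)] by (simp add: inner_diff_right)
  have "cross2 (y - x) (w - x) \<noteq> 0" using unit by auto
  then show False using orthogonal_to_basis[OF _ ay aw] a(1) by blast
qed

lemma chord_line:
  assumes T: "T \<in> \<Delta>" "T' \<in> \<Delta>" "T \<noteq> T'" "verts T = {x, y, w}" "verts T' = {x, y, w'}"
    and xy: "x \<notin> interior P" "y \<notin> interior P" and z: "z \<in> P" "cross2 (y - x) (z - x) = 0"
  obtains u where "0 \<le> u" "u \<le> 1" "z = (1 - u) *\<^sub>R x + u *\<^sub>R y"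
proof -
  have unit: "\<bar>cross2 (y - x) (w - x)\<bar> = 1" using cell_unit T by blast
  define u where "u = cross2 (y - x) (w - x) * cross2 (z - x) (w - x)"
  have "z - x = cross2 (y - x) (w - x) *\<^sub>R (cross2 (z - x) (w - x) *\<^sub>R (y - x) + cross2 (y - x) (z - x) *\<^sub>R (w - x))"
    by (rule scaleR_unit_swap[OF unit cross2_cramer])
  then have "z - x = cross2 (y - x) (w - x) *\<^sub>R (cross2 (z - x) (w - x) *\<^sub>R (y - x) + 0 *\<^sub>R (w - x))"
    unfolding z(2) .
  then have "z - x = u *\<^sub>R (y - x)"
    unfolding u_def by (rule scale_zero_comb)
  then have z1: "z = x + u *\<^sub>R (y - x)" by (metis add.commute diff_add_cancel)
  then have z2: "z = y + (1 - u) *\<^sub>R (x - y)" by (simp add: algebra_simps)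
  have "0 \<le> u" using chord_line_aux[OF T xy(1)] z(1) z1 by metis
  moreover have "0 \<le> 1 - u"
    using chord_line_aux[OF T(1-3) _ _ xy(2), of x w w'] T z(1) z2 by (metis insert_commute)
  moreover have "z = (1 - u) *\<^sub>R x + u *\<^sub>R y" using z1 by (simp add: algebra_simps)
  ultimately show thesis using that by simp
qed

lemma side_in_cell:
  assumes "S \<in> \<Delta>" "verts S = {x, y, w}" "z \<in> S"
  shows "0 \<le> cross2 (y - x) (w - x) * cross2 (y - x) (z - x)"
proof -
  have "S = convex hull {x, y, w}" using cell_eq_hull[OF assms(1)] assms(2) by simp
  then obtain s t where "0 \<le> t" and "z = x + s *\<^sub>R (y - x) + t *\<^sub>R (w - x)"
    using assms(3) unfolding convex_hull_3_alt by blast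
  then have "z - x = s *\<^sub>R (y - x) + t *\<^sub>R (w - x)" by simp
  then have "cross2 (y - x) (w - x) * cross2 (y - x) (z - x) = t * (cross2 (y - x) (w - x) * cross2 (y - x) (w - x))"
    by (simp only: cross2_comb)
  then show ?thesis using \<open>0 \<le> t\<close> by (metis mult_nonneg_nonneg zero_le_square)
qed

text \<open>
  A cell with points on both sides of the chord crosses it, either at an end, which is then a lattice point
  between two points of the cell, or in its interior, so that the cell has the chord as a side.
\<close>

lemma chord_sides:
  assumes T: "T \<in> \<Delta>" "T' \<in> \<Delta>" "T \<noteq> T'" "verts T = {x, y, w}" "verts T' = {x, y, w'}"
    and xy: "x \<notin> interior P" "y \<notin> interior P" and S: "S \<in> \<Delta>"
    and h: "\<And>z. h z = cross2 (y - x) (w - x) * cross2 (y - x) (z - x)"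
  shows "(\<forall>z \<in> S. 0 \<le> h z) \<or> (\<forall>z \<in> S. h z \<le> 0)"
proof (rule ccontr)
  assume "\<not> ?thesis"
  then obtain z1 z2 where z: "z1 \<in> S" "z2 \<in> S" "h z1 < 0" "0 < h z2" by (auto simp: not_le)
  define c where "c = h z1 / (h z1 - h z2)"
  have c: "0 < c" "c < 1" using z by (auto simp: c_def field_simps)
  define m where "m = (1 - c) *\<^sub>R z1 + c *\<^sub>R z2"
  have hm: "h m = (1 - c) * h z1 + c * h z2"
    unfolding h m_def cross2_def by (simp add: algebra_simps)
  have "\<dots> = 0" using z by (simp add: c_def field_simps)
  moreover have "cross2 (y - x) (w - x) \<noteq> 0" using cell_unit[OF T(1,4)] by auto
  ultimately have m0: "cross2 (y - x) (m - x) = 0" using hm h by simp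
  have conv: "convex S" using cell_eq_hull[OF S] convex_convex_hull by metis
  have mS: "m \<in> S" using convexD[OF conv z(1,2), of "1 - c" c] c by (simp add: m_def)
  obtain u where u: "0 \<le> u" "u \<le> 1" "m = (1 - u) *\<^sub>R x + u *\<^sub>R y"
    using chord_line[OF T xy _ m0] mS cell_subset[OF S] by blast
  have xyT: "x \<in> T" "y \<in> T" "x \<in> integer_lattice" "y \<in> integer_lattice"
    using T vert_in vert_lattice by blast+
  have "z1 \<noteq> z2" using z by auto
  then have notlat: "m \<notin> integer_lattice" using vert_not_between[OF S _ z(1,2) c] unfolding m_def by blast
  have "u \<noteq> 0" "u \<noteq> 1" using notlat xyT u by auto
  then have "x \<in> S" "y \<in> S" using face_of_common[OF T(1) S, of u x y] u mS xyT by auto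
  then have "x \<in> verts S" "y \<in> verts S" using xyT by (auto simp: verts_def)
  moreover have "x \<noteq> y" using cell_unit[OF T(1,4)] by auto
  ultimately obtain v where v: "verts S = {x, y, v}" using cell_third_vertex[OF S] by metis
  have "0 \<le> cross2 (y - x) (v - x) * cross2 (y - x) (z1 - x)"
       "0 \<le> cross2 (y - x) (v - x) * cross2 (y - x) (z2 - x)"
    using side_in_cell[OF S v] z by auto
  moreover have "\<bar>cross2 (y - x) (w - x)\<bar> = 1" "\<bar>cross2 (y - x) (v - x)\<bar> = 1"
    using cell_unit[OF T(1,4)] cell_unit[OF S v] by auto
  ultimately show False using z unfolding h by (auto simp: abs_if zero_le_mult_iff split: if_splits)
qed

text \<open>
  Two neighbouring cells on different sides of the chord share two lattice points on it, and these can
  only be its ends.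
\<close>

lemma chord_separates:
  assumes T: "T \<in> \<Delta>" "T' \<in> \<Delta>" "T \<noteq> T'" "verts T = {x, y, w}" "verts T' = {x, y, w'}"
    and xy: "x \<notin> interior P" "y \<notin> interior P"
    and h: "\<And>z. h z = cross2 (y - x) (w - x) * cross2 (y - x) (z - x)"
    and A: "A = {S \<in> \<Delta>. \<forall>z \<in> S. 0 \<le> h z}"
  shows "T \<in> A" "T' \<in> \<Delta> - A" "S \<in> A \<Longrightarrow> S' \<in> \<Delta> - A \<Longrightarrow> adj S S' \<Longrightarrow> S = T \<and> S' = T'"
proof -
  show "T \<in> A" using T side_in_cell[OF T(1,4)] unfolding A h by blast
  have "w' \<in> T'" using T vert_in by blast
  moreover have "h w' < 0" unfolding h opposite_vertices[OF T] using unit_square[OF cell_unit[OF T(1,4)]] by simp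
  ultimately show T'A: "T' \<in> \<Delta> - A" using T unfolding A by (auto simp: not_le)
  assume S: "S \<in> A" "S' \<in> \<Delta> - A" "adj S S'"
  have SD: "S \<in> \<Delta>" "S' \<in> \<Delta>" using S A by auto
  obtain a b where ab: "a \<noteq> b" "verts S \<inter> verts S' = {a, b}" using S(3) by (rule adj_common)
  have neg: "\<forall>z \<in> S'. h z \<le> 0" using chord_sides[OF T xy SD(2) h] S(2) unfolding A by blast
  have pos: "\<forall>z \<in> S. 0 \<le> h z" using S(1) unfolding A by blast
  have on: "v \<in> {x, y}" if "v \<in> {a, b}" for v
  proof -
    have v: "v \<in> verts S" "v \<in> verts S'" using ab that by auto
    then have "h v = 0" using pos neg vert_in by (metis order_antisym)
    moreover have "cross2 (y - x) (w - x) \<noteq> 0" using cell_unit[OF T(1,4)] by auto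
    ultimately have v0: "cross2 (y - x) (v - x) = 0" using h by simp
    obtain u where u: "0 \<le> u" "u \<le> 1" "v = (1 - u) *\<^sub>R x + u *\<^sub>R y"
      using chord_line[OF T xy _ v0] vert_in[OF v(1)] cell_subset[OF SD(1)] by blast
    show ?thesis
    proof (cases "u = 0 \<or> u = 1")
      case False
      then have "x = y" using vert_not_between[OF T(1), of u x y] u T(4) vert_in vert_lattice[OF v(1)] by auto
      then show ?thesis using cell_unit[OF T(1,4)] by simp
    qed (use u in auto)
  qed
  then have sub: "{x, y} \<subseteq> verts S" "{x, y} \<subseteq> verts S'" and "x \<noteq> y" using ab by auto
  have "S \<noteq> T'" "S' \<noteq> T" using S T'A \<open>T \<in> A\<close> by auto
  then have "S = T" "S' = T'"
    using cells_on_edge[OF T(2) SD(1) T(1) \<open>x \<noteq> y\<close>] cells_on_edge[OF T(1) SD(2) T(2) \<open>x \<noteq> y\<close>] sub T by auto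
  then show "S = T \<and> S' = T'" by simp
qed

section \<open>The cycle is the star of an interior lattice point\<close>

lemma nodes_dual [simp]: "nodes (dual_graph \<Delta>) = \<Delta>"
  by (simp add: dual_graph_def)

abbreviation inner_pairs :: "(real^2) set set \<Rightarrow> (real^2) set multiset set" where
  "inner_pairs S \<equiv> {{#T, T'#} | T T'. adj T T' \<and> T \<in> S \<and> T' \<in> S}"

lemma finite_inner_pairs: "finite (inner_pairs S)"
  by (rule finite_subset[OF _ finite_adj_edges]) blast

lemma inner_edges_dual: "inner_edges (dual_graph \<Delta>) S = mset_set (inner_pairs S)"
proof -
  have "{e \<in> {{#T, T'#} | T T'. adj T T'}. set_mset e \<subseteq> S} = inner_pairs S"
  proof (intro equalityI subsetI)
    fix e assume "e \<in> {e \<in> {{#T, T'#} | T T'. adj T T'}. set_mset e \<subseteq> S}"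
    then obtain T T' where "e = {#T, T'#}" "adj T T'" "set_mset e \<subseteq> S" by blast
    then show "e \<in> inner_pairs S" by auto
  next
    fix e assume "e \<in> inner_pairs S"
    then obtain T T' where "e = {#T, T'#}" "adj T T'" "T \<in> S" "T' \<in> S" by blast
    then show "e \<in> {e \<in> {{#T, T'#} | T T'. adj T T'}. set_mset e \<subseteq> S}" by auto
  qed
  then show ?thesis unfolding inner_edges_def dual_edges
    using filter_mset_mset_set[OF finite_adj_edges, of "\<lambda>e. set_mset e \<subseteq> S"] by simp
qed

text \<open>
  A shared side with both ends on the boundary of \<open>P\<close> is a chord, and the only edge between the two
  classes that it creates.  Split \<open>S\<close> along it and use induction on both classes.
\<close>

lemma forest_without_interior_vertices:
  assumes "finite S" "S \<noteq> {}" "S \<subseteq> \<Delta>"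
    and "\<And>T T'. T \<in> S \<Longrightarrow> T' \<in> S \<Longrightarrow> adj T T' \<Longrightarrow> verts T \<inter> verts T' \<inter> interior P = {}"
  shows "card (inner_pairs S) < card S"
  using assms
proof (induction S rule: finite_psubset_induct)
  case (psubset S)
  show ?case
  proof (cases "\<exists>T T'. T \<in> S \<and> T' \<in> S \<and> adj T T'")
    case False
    then have "inner_pairs S = {}" by blast
    then show ?thesis using psubset(1,3) by (simp only: card.empty card_gt_0_iff) simp
  next
    case True
    then obtain T T' where T: "T \<in> S" "T' \<in> S" "adj T T'" by blast
    obtain x y where xy: "x \<noteq> y" "verts T \<inter> verts T' = {x, y}" using T(3) by (rule adj_common)
    have TD: "T \<in> \<Delta>" "T' \<in> \<Delta>" "T \<noteq> T'" using T(3) by (auto simp: adj_iff)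
    obtain w where w: "verts T = {x, y, w}" using cell_third_vertex[OF TD(1), of x y] xy by blast
    obtain w' where w': "verts T' = {x, y, w'}" using cell_third_vertex[OF TD(2), of x y] xy by blast
    have bd: "x \<notin> interior P" "y \<notin> interior P" using psubset(5)[OF T] xy by auto
    define h where "h z = cross2 (y - x) (w - x) * cross2 (y - x) (z - x)" for z
    define A where "A = {S \<in> \<Delta>. \<forall>z \<in> S. 0 \<le> h z}"
    note sep = chord_separates[OF TD w w' bd h_def A_def]
    have TA: "T \<in> A" "T' \<notin> A" using sep(1,2) by auto
    have small: "card (inner_pairs (S \<inter> A)) < card (S \<inter> A)" "card (inner_pairs (S - A)) < card (S - A)"
      by (rule psubset.IH; use TA T psubset(4,5) in auto)+
    have "inner_pairs S \<subseteq> insert {#T, T'#} (inner_pairs (S \<inter> A) \<union> inner_pairs (S - A))"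
    proof
      fix e assume "e \<in> inner_pairs S"
      then obtain U U' where U: "e = {#U, U'#}" "adj U U'" "U \<in> S" "U' \<in> S" by blast
      consider "U \<in> A" "U' \<in> A" | "U \<notin> A" "U' \<notin> A" | "U \<in> A" "U' \<notin> A" | "U \<notin> A" "U' \<in> A" by blast
      then show "e \<in> insert {#T, T'#} (inner_pairs (S \<inter> A) \<union> inner_pairs (S - A))"
      proof cases
        case 3
        then have "U = T \<and> U' = T'" using sep(3)[of U U'] U psubset(4) by blast
        then show ?thesis using U by simp
      next
        case 4
        then have "U' = T \<and> U = T'" using sep(3)[of U' U] U psubset(4) adj_sym by blast
        then show ?thesis using U by (simp add: add_mset_commute)
      qed (use U in blast)+
    qed
    then have "card (inner_pairs S) \<le> card (insert {#T, T'#} (inner_pairs (S \<inter> A) \<union> inner_pairs (S - A)))"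
      by (rule card_mono[rotated]) (use finite_inner_pairs in blast)
    also have "\<dots> \<le> Suc (card (inner_pairs (S \<inter> A) \<union> inner_pairs (S - A)))" by (rule card_insert_le_m1) auto
    also have "\<dots> \<le> Suc (card (inner_pairs (S \<inter> A)) + card (inner_pairs (S - A)))"
      using card_Un_le by blast
    also have "\<dots> < card (S \<inter> A) + card (S - A)" using small by linarith
    also have "\<dots> = card S"
      using card_Un_disjoint[of "S \<inter> A" "S - A"] psubset(1) by (simp add: Int_Diff_Un Int_Diff_disjoint)
    finally show ?thesis .
  qed
qed

lemma cycle_degree:
  assumes "inner_degree (dual_graph \<Delta>) Z z = 2" "z \<in> Z"
  shows "card {z' \<in> Z. adj z z'} = 2"
proof -
  have "2 = (\<Sum>e\<in>inner_pairs Z. count e z)"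
    using assms(1) unfolding inner_degree_def inner_edges_dual by (simp add: sum_unfold_sum_mset)
  also have "\<dots> = (\<Sum>e\<in>inner_pairs Z. if z \<in># e then 1 else 0)"
  proof (rule sum.cong)
    fix e assume "e \<in> inner_pairs Z"
    then obtain T T' where "e = {#T, T'#}" "adj T T'" by blast
    moreover from this have "T \<noteq> T'" using adj_irrefl by blast
    ultimately show "count e z = (if z \<in># e then 1 else 0)" by auto
  qed simp
  also have "\<dots> = card {e \<in> inner_pairs Z. z \<in># e}"
    using finite_inner_pairs by (simp add: sum.If_cases Collect_conj_eq Int_commute)
  also have "{e \<in> inner_pairs Z. z \<in># e} = (\<lambda>z'. {#z, z'#}) ` {z' \<in> Z. adj z z'}"
  proof (intro equalityI subsetI)
    fix e assume "e \<in> {e \<in> inner_pairs Z. z \<in># e}"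
    then obtain T T' where e: "e = {#T, T'#}" "adj T T'" "T \<in> Z" "T' \<in> Z" "z = T \<or> z = T'" by auto
    have "adj T' T" using e(2) by (rule adj_sym)
    then show "e \<in> (\<lambda>z'. {#z, z'#}) ` {z' \<in> Z. adj z z'}" using e by (auto simp: add_mset_commute)
  next
    fix e assume "e \<in> (\<lambda>z'. {#z, z'#}) ` {z' \<in> Z. adj z z'}"
    then show "e \<in> {e \<in> inner_pairs Z. z \<in># e}" using assms(2) by auto
  qed
  also have "card \<dots> = card {z' \<in> Z. adj z z'}"
    by (rule card_image) (auto simp: inj_on_def)
  finally show ?thesis by simp
qed

context
  fixes Z r
  assumes hung: "hung_cycle (dual_graph \<Delta>) Z r"
begin

lemma hung_facts:
  "Z \<subseteq> \<Delta>" "z \<in> Z \<Longrightarrow> r z = z" "z \<in> Z \<Longrightarrow> card {z' \<in> Z. adj z z'} = 2"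
  "linked (dual_graph \<Delta>) Z" "linked (dual_graph \<Delta>) \<Delta>"
  "adj x y \<Longrightarrow> \<not> (x \<in> Z \<and> y \<in> Z) \<Longrightarrow> r x = r y"
proof -
  have "Z \<subseteq> \<Delta>" and rz: "\<forall>z \<in> Z. r z = z \<and> inner_degree (dual_graph \<Delta>) Z z = 2"
    and "linked (dual_graph \<Delta>) Z" "linked (dual_graph \<Delta>) \<Delta>"
    and rx: "\<forall>x y. adj x y \<longrightarrow> x \<in> Z \<and> y \<in> Z \<or> r x = r y"
    using hung unfolding hung_cycle_def nodes_dual by simp_all
  then show "Z \<subseteq> \<Delta>" "linked (dual_graph \<Delta>) Z" "linked (dual_graph \<Delta>) \<Delta>" by simp_all
  show "r z = z" if "z \<in> Z" using rz that by simp
  show "card {z' \<in> Z. adj z z'} = 2" if "z \<in> Z" using rz that by (intro cycle_degree) simp_all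
  show "r x = r y" if "adj x y" "\<not> (x \<in> Z \<and> y \<in> Z)" using rx that by metis
qed

lemma finite_Z: "finite Z"
  using hung_facts(1) finite_cells finite_subset by blast

text \<open>
  A triangle has three sides, and two of them are used by the cycle.
\<close>

lemma unique_pendant:
  assumes "z \<in> Z" "x \<notin> Z" "y \<notin> Z" "adj z x" "adj z y" shows "x = y"
proof (rule ccontr)
  assume "x \<noteq> y"
  let ?N = "{z' \<in> Z. adj z z'}"
  have fin: "finite ?N" using finite_Z by simp
  have "card (insert x (insert y ?N)) = 4" using hung_facts(3)[OF assms(1)] assms \<open>x \<noteq> y\<close> fin by simp
  moreover have "insert x (insert y ?N) \<subseteq> {T'. adj z T'}" using assms by auto
  moreover have "finite {T'. adj z T'} \<and> card {T'. adj z T'} \<le> 3"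
    using card_adj_le hung_facts(1) assms(1) by blast
  ultimately have "4 \<le> (3::nat)" using card_mono[of "{T'. adj z T'}" "insert x (insert y ?N)"] by linarith
  then show False by simp
qed

text \<open>
  Consider the star of an interior lattice point \<open>p\<close> on the side shared by \<open>z\<close> and \<open>y\<close>.  It is two-regular,
  but only one of its edges, the one from \<open>y\<close> to \<open>z\<close>, leaves the part that hangs from \<open>z\<close>.
\<close>

lemma pendant_edge_on_boundary:
  assumes z: "z \<in> Z" "y \<notin> Z" "adj z y" and p: "p \<in> verts z \<inter> verts y"
  shows "p \<notin> interior P"
proof
  assume int: "p \<in> interior P"
  have lat: "p \<in> integer_lattice" using p vert_lattice by blast
  define X where "X = {T \<in> \<Delta>. p \<in> T}"
  define A where "A = {x \<in> X - Z. r x = z}"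
  have "r z = r y" using hung_facts(6)[OF z(3)] z by blast
  then have ry: "r y = z" using hung_facts(2) z by simp
  have zy: "z \<in> X" "y \<in> X" using z p vert_in adj_cells unfolding X_def by blast+
  show False
  proof (rule no_single_crossing[of X adj A y z])
    show "finite X" using finite_cells by (simp add: X_def)
    show "card {T' \<in> X. adj T T'} = 2" if "T \<in> X" for T
    proof -
      have "{T' \<in> X. adj T T'} = {T'. adj T T' \<and> p \<in> T'}" unfolding X_def using adj_cells by blast
      moreover have "T \<in> \<Delta>" "p \<in> verts T" using that lat by (auto simp: X_def verts_def)
      ultimately show ?thesis using star_two_neighbours int by simp
    qed
    show "A \<subseteq> X" "y \<in> A" "z \<in> X - A" "adj y z"
      using zy z ry adj_sym[OF z(3)] by (auto simp: A_def)
    show "s = y \<and> t = z" if st: "s \<in> A" "t \<in> X - A" "adj s t" for s t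
    proof -
      have "r s = r t" using hung_facts(6)[OF st(3)] st(1) by (auto simp: A_def)
      then have "t \<in> Z" "r t = z" using st by (auto simp: A_def)
      then have tz: "t = z" using hung_facts(2) by simp
      have "s \<notin> Z" using st by (simp add: A_def)
      then have "s = y" using unique_pendant[OF z(1) _ z(2) _ z(3)] adj_sym[OF st(3)] tz by blast
      then show ?thesis using tz by simp
    qed
  qed (use adj_sym adj_irrefl in blast)+
qed

text \<open>
  Otherwise the side is a chord, and the cycle would cross the cut given by it exactly once.
\<close>

lemma cycle_edge_has_interior_vertex:
  assumes z: "z \<in> Z" "z' \<in> Z" "adj z z'"
  shows "verts z \<inter> verts z' \<inter> interior P \<noteq> {}"
proof
  assume none: "verts z \<inter> verts z' \<inter> interior P = {}"
  obtain x y where xy: "x \<noteq> y" "verts z \<inter> verts z' = {x, y}" using z(3) by (rule adj_common)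
  have zD: "z \<in> \<Delta>" "z' \<in> \<Delta>" "z \<noteq> z'" using z(3) by (auto simp: adj_iff)
  obtain w where w: "verts z = {x, y, w}" using cell_third_vertex[OF zD(1), of x y] xy by blast
  obtain w' where w': "verts z' = {x, y, w'}" using cell_third_vertex[OF zD(2), of x y] xy by blast
  have bd: "x \<notin> interior P" "y \<notin> interior P" using none xy by auto
  define h where "h u = cross2 (y - x) (w - x) * cross2 (y - x) (u - x)" for u
  define A where "A = {S \<in> \<Delta>. \<forall>u \<in> S. 0 \<le> h u}"
  note sep = chord_separates[OF zD w w' bd h_def A_def]
  show False
  proof (rule no_single_crossing[of Z adj "Z \<inter> A" z z'])
    show "finite Z" by (rule finite_Z)
    show "card {y \<in> Z. adj x y} = 2" if "x \<in> Z" for x using hung_facts(3)[OF that] .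
    show "Z \<inter> A \<subseteq> Z" "z \<in> Z \<inter> A" "z' \<in> Z - Z \<inter> A" "adj z z'" using z sep(1,2) by auto
    show "s = z \<and> t = z'" if "s \<in> Z \<inter> A" "t \<in> Z - Z \<inter> A" "adj s t" for s t
      using sep(3)[of s t] that hung_facts(1) by blast
  qed (use adj_sym adj_irrefl in blast)+
qed

text \<open>
  At each node of the cycle that contains \<open>p\<close>, both edges of the star of \<open>p\<close> belong to the cycle, because
  the other edge belongs to a hanging part and has its vertices on the boundary.  So the next nodes of
  the cycle contain \<open>p\<close> as well.
\<close>

lemma cycle_is_star:
  assumes "Z \<noteq> {}"
  obtains p where "p \<in> integer_lattice" "p \<in> interior P" "\<And>z. z \<in> Z \<Longrightarrow> p \<in> z"
proof -
  obtain z0 where z0: "z0 \<in> Z" using assms by blast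
  then have "{z' \<in> Z. adj z0 z'} \<noteq> {}" using hung_facts(3)[OF z0] by (metis card.empty zero_neq_numeral)
  then obtain z1 where z1: "z1 \<in> Z" "adj z0 z1" by blast
  obtain p where p: "p \<in> verts z0" "p \<in> interior P" using cycle_edge_has_interior_vertex[OF z0 z1] by blast
  have lat: "p \<in> integer_lattice" using p vert_lattice by blast
  have "{z \<in> Z. p \<in> z} = Z"
  proof (rule linkedD[OF hung_facts(4)])
    show "{z \<in> Z. p \<in> z} \<subseteq> Z" by blast
    show "{z \<in> Z. p \<in> z} \<noteq> {}" using z0 p vert_in by blast
    fix x y assume xy: "x \<in> {z \<in> Z. p \<in> z}" "y \<in> Z" "adj x y"
    have px: "p \<in> verts x" using xy lat by (simp add: verts_def)
    have "x \<in> \<Delta>" using xy hung_facts(1) by blast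
    have "{T'. adj x T' \<and> p \<in> T'} \<subseteq> {z' \<in> Z. adj x z'}"
    proof
      fix T assume "T \<in> {T'. adj x T' \<and> p \<in> T'}"
      then have T: "adj x T" "p \<in> verts T" using lat by (auto simp: verts_def)
      then have "T \<in> Z" using pendant_edge_on_boundary[of x T p] xy px p by blast
      then show "T \<in> {z' \<in> Z. adj x z'}" using T by simp
    qed
    moreover have "card {T'. adj x T' \<and> p \<in> T'} = card {z' \<in> Z. adj x z'}"
      using star_two_neighbours[OF \<open>x \<in> \<Delta>\<close> px p(2)] hung_facts(3) xy by simp
    ultimately have "{T'. adj x T' \<and> p \<in> T'} = {z' \<in> Z. adj x z'}"
      using finite_Z by (intro card_subset_eq) auto
    then show "y \<in> {z \<in> Z. p \<in> z}" using xy by blast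
  qed
  then show thesis using that[OF lat p(2)] by blast
qed

text \<open>
  The part that hangs from \<open>z\<close> is attached across the side \<open>a b\<close> opposite to \<open>p\<close>, a chord.  All of its
  triangles lie beyond this chord, since the dual graph is connected.  Not all sides shared by
  triangles of the witness can be chords, so one of them has an interior vertex.
\<close>

lemma loaded_node:
  assumes z: "z \<in> Z" "loaded (dual_graph \<Delta>) Z r z" and p: "p \<in> verts z" "p \<in> interior P"
  obtains a b q where "verts z = {p, a, b}" "a \<notin> interior P" "b \<notin> interior P"
    "q \<in> integer_lattice" "q \<in> interior P" "cross2 (b - a) (p - a) * cross2 (b - a) (q - a) < 0"
proof -
  define A where "A = {x \<in> \<Delta> - Z. r x = z}"
  obtain S where S: "S \<subseteq> \<Delta> - Z" "S \<noteq> {}" "r ` S \<subseteq> {z}"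
      "card S \<le> size (inner_edges (dual_graph \<Delta>) S)"
    using z(2) unfolding loaded_def nodes_dual by blast
  have SA: "S \<subseteq> A" using S by (auto simp: A_def)
  have zD: "z \<in> \<Delta>" using z hung_facts(1) by blast
  have zA: "z \<notin> A" using z by (simp add: A_def)
  have leave: "t = z" if "s \<in> A" "t \<in> \<Delta>" "t \<notin> A" "adj s t" for s t
  proof -
    have "r s = r t" using hung_facts(6)[OF that(4)] that(1) by (auto simp: A_def)
    then have "r t = z" "t \<in> Z" using that by (auto simp: A_def)
    then show ?thesis using hung_facts(2) by simp
  qed
  obtain x where x: "x \<in> A" "adj z x"
  proof -
    have "\<exists>s t. s \<in> A \<and> t \<in> \<Delta> \<and> adj s t \<and> t \<notin> A"
    proof (rule ccontr)
      assume "\<not> ?thesis"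
      then have "A = \<Delta>" using S SA by (intro linkedD[OF hung_facts(5)]) (auto simp: A_def)
      then show False using zA zD by simp
    qed
    then show thesis using leave that adj_sym by blast
  qed
  have xZ: "x \<notin> Z" using x by (simp add: A_def)
  obtain a b where ab: "a \<noteq> b" "verts z \<inter> verts x = {a, b}" using x(2) by (rule adj_common)
  have bd: "a \<notin> interior P" "b \<notin> interior P" using pendant_edge_on_boundary[OF z(1) xZ x(2)] ab by auto
  have xD: "x \<in> \<Delta>" "z \<noteq> x" using x xZ z by (auto simp: A_def)
  obtain c where c: "verts z = {a, b, c}" using cell_third_vertex[OF zD, of a b] ab by blast
  have "p = c" using c p bd by auto
  then have vz: "verts z = {a, b, p}" using c by simp
  obtain w' where w': "verts x = {a, b, w'}" using cell_third_vertex[OF xD(1), of a b] ab by blast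
  define h where "h u = cross2 (b - a) (p - a) * cross2 (b - a) (u - a)" for u
  define H where "H = {S \<in> \<Delta>. \<forall>u \<in> S. 0 \<le> h u}"
  note sep = chord_separates[OF zD xD vz w' bd h_def H_def]
  \<comment> \<open>the hanging triangles on the near side would be closed under adjacency\<close>
  have far: "A \<inter> H = {}"
  proof (rule ccontr)
    assume ne: "A \<inter> H \<noteq> {}"
    have "A \<inter> H = \<Delta>"
    proof (rule linkedD[OF hung_facts(5) _ ne])
      show "A \<inter> H \<subseteq> \<Delta>" by (auto simp: A_def)
      fix s t assume st: "s \<in> A \<inter> H" "t \<in> \<Delta>" "adj s t"
      have sZ: "s \<notin> Z" using st by (simp add: A_def)
      have "t \<in> A"
      proof (rule ccontr)
        assume "t \<notin> A"
        then have "t = z" using leave st by blast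
        then have "s = x" using unique_pendant[OF z(1) sZ xZ _ x(2)] adj_sym[OF st(3)] by simp
        then show False using st sep(2) by blast
      qed
      moreover have "t \<in> H"
      proof (rule ccontr)
        assume "t \<notin> H"
        then have "s = z" using sep(3)[of s t] st by blast
        then show False using sZ z by simp
      qed
      ultimately show "t \<in> A \<inter> H" by blast
    qed
    then show False using zA zD by blast
  qed
  have finS: "finite S" using S(1) finite_cells finite_subset by blast
  have "\<not> card (inner_pairs S) < card S"
    using S(4) unfolding inner_edges_dual by simp
  then obtain T T' where T: "T \<in> S" "T' \<in> S" "adj T T'" "verts T \<inter> verts T' \<inter> interior P \<noteq> {}"
    using forest_without_interior_vertices[OF finS S(2)] S(1) by blast
  then obtain q where q: "q \<in> verts T" "q \<in> interior P" by blast
  have TD: "T \<in> \<Delta>" "T \<in> A" using T S SA by auto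
  then have "T \<notin> H" using far by blast
  then have "\<forall>u \<in> T. h u \<le> 0" using chord_sides[OF zD xD vz w' bd TD(1) h_def] TD by (auto simp: H_def)
  then have "h q \<le> 0" using q vert_in by blast
  moreover have "h q \<noteq> 0"
  proof
    assume "h q = 0"
    moreover have "cross2 (b - a) (p - a) \<noteq> 0" using cell_unit[OF zD vz] by auto
    ultimately have q0: "cross2 (b - a) (q - a) = 0" by (simp add: h_def)
    have "q \<in> P" using q interior_subset by blast
    obtain u where u: "0 \<le> u" "u \<le> 1" "q = (1 - u) *\<^sub>R a + u *\<^sub>R b"
      using chord_line[OF zD xD vz w' bd \<open>q \<in> P\<close> q0] by blast
    show False
    proof (cases "u = 0 \<or> u = 1")
      case True
      then show ?thesis using u q bd by auto
    next
      case False
      then have "a = b" using vert_not_between[OF zD, of u a b] u vz vert_in vert_lattice[OF q(1)] by auto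
      then show ?thesis using ab by simp
    qed
  qed
  ultimately have "h q < 0" by simp
  moreover have "verts z = {p, a, b}" using vz by auto
  ultimately show thesis using that[of a b q] bd q vert_lattice unfolding h_def by blast
qed

end

section \<open>Corners at the common vertex\<close>

lemma interior_combination:
  assumes "u \<in> interior P" "v \<in> P" "w \<in> P" "0 < \<alpha>" "0 \<le> \<beta>" "\<alpha> + \<beta> \<le> 1"
  shows "\<alpha> *\<^sub>R u + \<beta> *\<^sub>R v + (1 - \<alpha> - \<beta>) *\<^sub>R w \<in> interior P"
proof (rule ccontr)
  let ?z = "\<alpha> *\<^sub>R u + \<beta> *\<^sub>R v + (1 - \<alpha> - \<beta>) *\<^sub>R w"
  assume out: "?z \<notin> interior P"
  have "u \<in> P" using assms(1) interior_subset by blast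
  then have zP: "?z \<in> P"
  proof -
    have "?z \<in> convex hull {u, v, w}"
      unfolding convex_hull_3 using assms
      by (intro CollectI exI[of _ \<alpha>] exI[of _ \<beta>] exI[of _ "1 - \<alpha> - \<beta>"]) auto
    moreover have "convex hull {u, v, w} \<subseteq> P"
      by (rule hull_minimal) (use assms(2,3) \<open>u \<in> P\<close> convex_P in auto)
    ultimately show ?thesis by blast
  qed
  obtain a where a: "a \<noteq> 0" "\<And>z. z \<in> P \<Longrightarrow> a \<bullet> z \<le> a \<bullet> ?z" "\<And>z. z \<in> interior P \<Longrightarrow> a \<bullet> z < a \<bullet> ?z"
    using supporting_functional[OF zP out] by metis
  define t where "t = a \<bullet> ?z"
  have t: "t = \<alpha> * (a \<bullet> u) + \<beta> * (a \<bullet> v) + (1 - \<alpha> - \<beta>) * (a \<bullet> w)"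
    by (simp add: t_def inner_add_right)
  have "\<alpha> * (a \<bullet> u) < \<alpha> * t" using a(3)[OF assms(1)] assms(4) by (simp add: t_def)
  moreover have "\<beta> * (a \<bullet> v) \<le> \<beta> * t" using a(2)[OF assms(2)] assms(5) by (simp add: t_def mult_left_mono)
  moreover have "(1 - \<alpha> - \<beta>) * (a \<bullet> w) \<le> (1 - \<alpha> - \<beta>) * t"
    using a(2)[OF assms(3)] assms(6) by (simp add: t_def mult_left_mono)
  ultimately have "t < \<alpha> * t + \<beta> * t + (1 - \<alpha> - \<beta>) * t" using t by linarith
  then show False by (simp add: algebra_simps)
qed

lemma interior_from_origin:
  assumes "p + u \<in> interior P" "p + v \<in> P" "p \<in> P" "0 < \<alpha>" "0 \<le> \<beta>" "\<alpha> + \<beta> \<le> 1"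
  shows "p + (\<alpha> *\<^sub>R u + \<beta> *\<^sub>R v) \<in> interior P"
  using interior_combination[OF assms] by (simp add: algebra_simps)

text \<open>
  The point \<open>p + B\<close> lies in the triangle of \<open>p\<close>, \<open>p + A\<close> and the given interior point.
\<close>

lemma far_point_forces_vertex_inside:
  assumes "p \<in> P" "p + A \<in> P" "p + (x *\<^sub>R A + y *\<^sub>R B) \<in> interior P" "x \<le> 0" "1 \<le> x + y"
  shows "p + B \<in> interior P"
proof -
  have y: "0 < y" using assms by linarith
  have "p + ((1 / y) *\<^sub>R (x *\<^sub>R A + y *\<^sub>R B) + (- x / y) *\<^sub>R A) \<in> interior P"
    by (rule interior_from_origin) (use assms y in \<open>auto simp: field_simps\<close>)
  moreover have "(1 / y) *\<^sub>R (x *\<^sub>R A + y *\<^sub>R B) + (- x / y) *\<^sub>R A = B"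
    using y by (simp add: scaleR_add_right)
  ultimately show ?thesis by simp
qed

text \<open>
  Both coordinates of the given point are positive, hence at least one, by the previous lemma.
  If, say, \<open>y \<le> x\<close>, then \<open>p + A + B\<close> lies in the triangle of \<open>p\<close>, \<open>p + B\<close> and the given point.
\<close>

lemma corner_sum_interior:
  assumes "p \<in> P" "p + A \<in> P" "p + B \<in> P" "p + A \<notin> interior P" "p + B \<notin> interior P"
    and q: "p + (x *\<^sub>R A + y *\<^sub>R B) \<in> interior P" "x \<in> \<int>" "y \<in> \<int>" "1 < x + y"
  shows "p + (A + B) \<in> interior P"
proof -
  have "0 < x" using far_point_forces_vertex_inside[OF assms(1,2) q(1)] assms(5) q(4) by linarith
  moreover have "p + (y *\<^sub>R B + x *\<^sub>R A) \<in> interior P" using q(1) by (simp add: add.commute)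
  then have "0 < y" using far_point_forces_vertex_inside[OF assms(1,3)] assms(4) q(4) by fastforce
  moreover obtain i j where "x = of_int i" "y = of_int j" using q by (auto elim!: Ints_cases)
  ultimately have xy: "1 \<le> x" "1 \<le> y" by auto
  have wlog: "p + (A + B) \<in> interior P"
    if "p + (x *\<^sub>R A + y *\<^sub>R B) \<in> interior P" "p + B \<in> P" "1 \<le> y" "y \<le> x" for x y A B
  proof -
    have "p + ((1 / x) *\<^sub>R (x *\<^sub>R A + y *\<^sub>R B) + (1 - y / x) *\<^sub>R B) \<in> interior P"
      by (rule interior_from_origin) (use assms(1) that in \<open>auto simp: field_simps\<close>)
    moreover have "(1 / x) *\<^sub>R (x *\<^sub>R A + y *\<^sub>R B) + (1 - y / x) *\<^sub>R B = A + B"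
      using that by (simp add: scaleR_add_right algebra_simps)
    ultimately show ?thesis by simp
  qed
  show ?thesis
  proof (cases "y \<le> x")
    case True
    then show ?thesis using wlog[OF q(1) assms(3)] xy by simp
  next
    case False
    then have "p + (B + A) \<in> interior P"
      using wlog[of y B x A] q(1) assms(2) xy by (simp add: add.commute)
    then show ?thesis by (simp add: add.commute)
  qed
qed

text \<open>
  A loaded triangle seen from the centre \<open>p\<close> of the cycle: its other two vertices lie on the boundary, yet
  \<open>P\<close> extends beyond the opposite side far enough to have \<open>p + A + B\<close> in its interior.
\<close>

definition corner :: "real^2 \<Rightarrow> (real^2) set \<Rightarrow> real^2 \<Rightarrow> real^2 \<Rightarrow> bool" where
  "corner p T A B \<longleftrightarrow> T \<in> \<Delta> \<and> verts T = {p, p + A, p + B} \<and> p \<in> interior P \<and>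
     p + A \<notin> interior P \<and> p + B \<notin> interior P \<and> p + (A + B) \<in> interior P"

lemma corner_swap: "corner p T A B \<Longrightarrow> corner p T B A"
  unfolding corner_def by (auto simp: add.commute insert_commute)

lemma corner_facts:
  assumes "corner p T A B"
  shows "T \<in> \<Delta>" "p \<in> T" "p + A \<in> T" "p + B \<in> T" "p \<in> P" "p + A \<in> P" "p + B \<in> P" "p \<in> integer_lattice"
    "A \<in> integer_lattice" "B \<in> integer_lattice" "\<bar>cross2 A B\<bar> = 1"
proof -
  show T: "T \<in> \<Delta>" using assms by (simp add: corner_def)
  have v: "verts T = {p, p + A, p + B}" using assms by (simp add: corner_def)
  then show pT: "p \<in> T" "p + A \<in> T" "p + B \<in> T" using vert_in[of _ T] by auto
  then show "p \<in> P" "p + A \<in> P" "p + B \<in> P" using cell_subset[OF T] by auto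
  have "p \<in> integer_lattice" "p + A \<in> integer_lattice" "p + B \<in> integer_lattice"
    using vert_lattice[of _ T] v by auto
  then show "p \<in> integer_lattice" "A \<in> integer_lattice" "B \<in> integer_lattice"
    using lattice_simps(2)[of "p + A" p] lattice_simps(2)[of "p + B" p] by auto
  show "\<bar>cross2 A B\<bar> = 1" using cell_unit[OF T v] by simp
qed

lemma corner_of_loaded_node:
  assumes T: "T \<in> \<Delta>" "verts T = {p, a, b}" and p: "p \<in> interior P"
    and ab: "a \<notin> interior P" "b \<notin> interior P"
    and q: "q \<in> integer_lattice" "q \<in> interior P" "cross2 (b - a) (p - a) * cross2 (b - a) (q - a) < 0"
  shows "corner p T (a - p) (b - p)"
proof -
  have inP: "p \<in> P" "a \<in> P" "b \<in> P" using T vert_in cell_subset by blast+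
  have lat: "p \<in> integer_lattice" "a \<in> integer_lattice" "b \<in> integer_lattice" using T vert_lattice by blast+
  have unit: "\<bar>cross2 (a - p) (b - p)\<bar> = 1" using cell_unit[OF T] .
  let ?c = "cross2 (a - p) (b - p)"
  define x where "x = ?c * cross2 (q - p) (b - p)"
  define y where "y = ?c * cross2 (a - p) (q - p)"
  have qxy: "q = p + (x *\<^sub>R (a - p) + y *\<^sub>R (b - p))"
    using affine_coords[OF unit, of q] unfolding x_def y_def by (simp only: add.assoc)
  have 1: "cross2 (b - a) (p - a) = ?c" by (simp add: cross2_def algebra_simps)
  have 2: "cross2 (b - a) (q - a) = ?c - (cross2 (q - p) (b - p) + cross2 (a - p) (q - p))"
    by (simp add: cross2_def algebra_simps)
  have "?c * (?c - (cross2 (q - p) (b - p) + cross2 (a - p) (q - p))) < 0"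
    using q(3) unfolding 1 2 .
  then have "?c * ?c - (x + y) < 0" unfolding x_def y_def by (simp only: ring_distribs)
  then have "1 < x + y" using unit_square[OF unit] by simp
  moreover have "x \<in> \<int>" "y \<in> \<int>" unfolding x_def y_def using lat q(1) by (auto intro!: Ints_mult lattice_simps)
  ultimately have "p + ((a - p) + (b - p)) \<in> interior P"
    using corner_sum_interior[of p "a - p" "b - p" x y] inP ab q(2) qxy by simp
  then show ?thesis unfolding corner_def using T p ab by simp
qed

text \<open>
  Scaling a common vector down moves it into both triangles, and into the interior of the first one.
\<close>

lemma corner_cones_disjoint:
  assumes T: "corner p T A B" and T': "corner p T' A' B'" and "T \<noteq> T'"
    and pos: "0 < s" "0 < t" "0 \<le> s'" "0 \<le> t'"
  shows "s *\<^sub>R A + t *\<^sub>R B \<noteq> s' *\<^sub>R A' + t' *\<^sub>R B'"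
proof
  assume eq: "s *\<^sub>R A + t *\<^sub>R B = s' *\<^sub>R A' + t' *\<^sub>R B'"
  note f = corner_facts[OF T] and f' = corner_facts[OF T']
  have v: "verts T = {p, p + A, p + B}" "verts T' = {p, p + A', p + B'}"
    using T T' by (simp_all add: corner_def)
  have hull: "T = convex hull {p, p + A, p + B}" "T' = convex hull {p, p + A', p + B'}"
    using cell_eq_hull[OF f(1)] cell_eq_hull[OF f'(1)] v by auto
  define e where "e = 1 / (1 + s + t + s' + t')"
  have e: "0 < e" "e * s + e * t < 1" "e * s' + e * t' \<le> 1"
  proof -
    have "0 < 1 + s + t + s' + t'" using pos by linarith
    then have "0 < e" "e * (1 + s + t + s' + t') = 1" by (simp_all add: e_def)
    moreover from this have "e + e * s + e * t + e * s' + e * t' = 1" by (simp only: ring_distribs mult_1_right)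
    moreover have "0 \<le> e * s" "0 \<le> e * t" "0 \<le> e * s'" "0 \<le> e * t'" using pos \<open>0 < e\<close> by simp_all
    ultimately show "0 < e" "e * s + e * t < 1" "e * s' + e * t' \<le> 1" by linarith+
  qed
  have sc: "e *\<^sub>R (s *\<^sub>R A + t *\<^sub>R B) = (e * s) *\<^sub>R A + (e * t) *\<^sub>R B" for s t and A B :: "real^2"
    by (simp add: scaleR_add_right)
  have eq': "(e * s) *\<^sub>R A + (e * t) *\<^sub>R B = (e * s') *\<^sub>R A' + (e * t') *\<^sub>R B'"
    using eq by (metis sc)
  define z where "z = p + (e * s) *\<^sub>R A + (e * t) *\<^sub>R B"
  have zT': "z \<in> T'" unfolding z_def hull convex_hull_3_alt
    using eq' e pos by (intro CollectI exI[of _ "e * s'"] exI[of _ "e * t'"]) (auto simp: add.assoc)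
  have half: "p + B \<in> T'"
    if "z = p + (x *\<^sub>R A + y *\<^sub>R B)" "0 < x" "0 < y" "x + y < 1" "p + A \<in> T" "p + B \<in> T" for x y A B
  proof -
    define u where "u = x / (1 - y)"
    have u: "0 < u" "u < 1" using that by (auto simp: u_def field_simps)
    have "p + u *\<^sub>R A = (1 - u) *\<^sub>R p + u *\<^sub>R (p + A)" by (simp add: algebra_simps)
    moreover have "convex T" using hull convex_convex_hull by metis
    ultimately have "p + u *\<^sub>R A \<in> T" using convexD[of T p "p + A" "1 - u" u] u f(2) that by simp
    moreover have "(1 - y) * u = x" using that by (simp add: u_def)
    then have eqA: "(1 - y) *\<^sub>R (p + u *\<^sub>R A) = (1 - y) *\<^sub>R p + x *\<^sub>R A"
      by (simp only: scaleR_add_right scaleR_scaleR)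
    have "(1 - y) *\<^sub>R (p + u *\<^sub>R A) + y *\<^sub>R (p + B) = z"
      unfolding that(1) eqA by (simp add: algebra_simps)
    ultimately show ?thesis using face_of_common(2)[OF f(1) f'(1), of y "p + u *\<^sub>R A" "p + B"] zT' that by simp
  qed
  have "0 < e * s" "0 < e * t" using e pos by auto
  then have "p + B \<in> T'" "p + A \<in> T'"
    using half[of "e * s" A "e * t" B] half[of "e * t" B "e * s" A] e f(3,4)
    by (simp_all add: z_def add.assoc add.commute)
  then have "verts T \<subseteq> verts T'" using f'(2) v(1) vert_lattice[of _ T] by (auto simp: verts_def)
  then show False using cell_eqI[OF f(1) f'(1)] \<open>T \<noteq> T'\<close> by simp
qed

text \<open>
  Let \<open>x\<close> and \<open>y\<close> be the coordinates of \<open>A' + B'\<close>.  They are not both positive, as cones of different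
  triangles are disjoint.  If \<open>x \<le> 0\<close> and \<open>1 \<le> y\<close>, then \<open>p + B\<close> lies in the triangle of \<open>p\<close> and the two
  interior points \<open>p + A + B\<close> and \<open>p + A' + B'\<close>, although it is a boundary point.
\<close>

lemma corner_opposite:
  assumes T: "corner p T A B" and T': "corner p T' A' B'" and "T \<noteq> T'"
  obtains u v where "u \<in> \<int>" "v \<in> \<int>" "0 \<le> u" "0 \<le> v" "- (A' + B') = u *\<^sub>R A + v *\<^sub>R B"
proof -
  note f = corner_facts[OF T] and f' = corner_facts[OF T']
  let ?Q = "A' + B'"
  define x where "x = cross2 A B * cross2 ?Q B"
  define y where "y = cross2 A B * cross2 A ?Q"
  have Q: "?Q = x *\<^sub>R A + y *\<^sub>R B"
    using scaleR_unit_swap[OF f(11) cross2_cramer[of A B ?Q]] by (simp add: x_def y_def scaleR_add_right)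
  have "?Q \<in> integer_lattice" using lattice_simps(1) f' by blast
  then have ints: "x \<in> \<int>" "y \<in> \<int>" unfolding x_def y_def using f by (auto intro!: Ints_mult lattice_simps)
  then obtain i j where ij: "x = of_int i" "y = of_int j" by (auto elim!: Ints_cases)
  have int: "p + (A + B) \<in> interior P" "p + (x *\<^sub>R A + y *\<^sub>R B) \<in> interior P"
    and bd: "p + A \<notin> interior P" "p + B \<notin> interior P"
    using T T' Q by (auto simp: corner_def)
  have no: False if "x \<le> 0" "1 \<le> y" "p + (A + B) \<in> interior P" "p + (x *\<^sub>R A + y *\<^sub>R B) \<in> interior P"
      "p + B \<notin> interior P" for x y A B
  proof -
    have "p + ((1 / (y - x)) *\<^sub>R (x *\<^sub>R A + y *\<^sub>R B) + (- x / (y - x)) *\<^sub>R (A + B)) \<in> interior P"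
      by (rule interior_from_origin) (use that f(5) interior_subset in \<open>auto simp: field_simps\<close>)
    moreover have "(1 / (y - x)) *\<^sub>R (x *\<^sub>R A + y *\<^sub>R B) + (- x / (y - x)) *\<^sub>R (A + B) =
        (y / (y - x) + - x / (y - x)) *\<^sub>R B"
      unfolding scaleR_add_left by (simp add: scaleR_add_right)
    moreover have "y / (y - x) + - x / (y - x) = 1"
      using that(1,2) by (simp flip: diff_divide_distrib)
    ultimately show False using that by simp
  qed
  have "\<not> (0 < x \<and> 0 < y)"
    using corner_cones_disjoint[OF T T' \<open>T \<noteq> T'\<close>, of x y 1 1] Q by auto
  moreover have "\<not> (x \<le> 0 \<and> 1 \<le> y)" using no int bd by blast
  moreover have "\<not> (y \<le> 0 \<and> 1 \<le> x)" using no[of y x B A] int bd by (auto simp: add.commute)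
  ultimately have "x \<le> 0" "y \<le> 0" unfolding ij by auto
  then show thesis using that[of "- x" "- y"] ints Q by simp
qed

text \<open>
  The vector \<open>- (A + B)\<close> lies in the cones of the other two corners, so it is a multiple of one edge
  vector.  It is primitive, since it forms a lattice basis together with \<open>A\<close>.
\<close>

lemma corner_ray:
  assumes T: "corner p T A B" and T': "corner p T' A' B'" and T'': "corner p T'' A'' B''"
    and ne: "T \<noteq> T'" "T' \<noteq> T''" "T \<noteq> T''"
  shows "- (A + B) \<in> {A', B'}"
proof -
  note f = corner_facts[OF T] and f' = corner_facts[OF T']
  obtain u v where uv: "u \<in> \<int>" "v \<in> \<int>" "0 \<le> u" "0 \<le> v" "- (A + B) = u *\<^sub>R A' + v *\<^sub>R B'"
    using corner_opposite[OF T' T] ne by metis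
  obtain u' v' where uv': "u' \<in> \<int>" "v' \<in> \<int>" "0 \<le> u'" "0 \<le> v'" "- (A + B) = u' *\<^sub>R A'' + v' *\<^sub>R B''"
    using corner_opposite[OF T'' T] ne by metis
  have "\<not> (0 < u \<and> 0 < v)"
    using corner_cones_disjoint[OF T' T'' ne(2), of u v u' v'] uv uv' by metis
  then have zero: "u = 0 \<or> v = 0" using uv by linarith
  have prim: "k = 1" if "- (A + B) = k *\<^sub>R D" "k \<in> \<int>" "0 \<le> k" "D \<in> integer_lattice" for k D
  proof -
    have "cross2 A (- (A + B)) = - cross2 A B" by (simp add: cross2_def algebra_simps)
    then have "k * cross2 A D = - cross2 A B" unfolding that(1) by simp
    then have kD: "k * \<bar>cross2 A D\<bar> = 1" using f(11) that(3) by (metis abs_minus_cancel abs_mult abs_of_nonneg)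
    obtain i where i: "k = of_int i" using \<open>k \<in> \<int>\<close> by (auto elim: Ints_cases)
    obtain j where j: "cross2 A D = of_int j" using lattice_simps(3)[OF f(9) \<open>D \<in> integer_lattice\<close>] by (auto elim: Ints_cases)
    have "of_int (i * \<bar>j\<bar>) = (1::real)" using kD unfolding i j by simp
    then have "i * \<bar>j\<bar> = 1" by (simp only: of_int_eq_1_iff)
    then have "i = 1" using zmult_eq_1_iff[of i "\<bar>j\<bar>"] that(3) i by auto
    then show ?thesis using i by simp
  qed
  show ?thesis
  proof (cases "v = 0")
    case True
    then have "- (A + B) = u *\<^sub>R A'" using uv(5) by simp
    then show ?thesis using prim[of u A'] uv f' by simp
  next
    case False
    then have "- (A + B) = v *\<^sub>R B'" using uv(5) zero by simp
    then show ?thesis using prim[of v B'] uv f' by simp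
  qed
qed

lemma three_corners:
  assumes T: "corner p T A B" and T': "corner p T' A' B'" and T'': "corner p T'' A'' B''"
    and ne: "T \<noteq> T'" "T' \<noteq> T''" "T \<noteq> T''"
  obtains X Y Z where "X + Y + Z = 0" "corner p T X Y" "corner p T' Y Z" "corner p T'' X Z"
proof -
  have sums: "A + B \<noteq> A' + B'" "A' + B' \<noteq> A'' + B''" "A + B \<noteq> A'' + B''"
    using corner_cones_disjoint[OF T T', of 1 1 1 1] corner_cones_disjoint[OF T' T'', of 1 1 1 1]
      corner_cones_disjoint[OF T T'', of 1 1 1 1] ne by auto
  define X where "X = - (A' + B')"
  define Y where "Y = - (A'' + B'')"
  define Z where "Z = - (A + B)"
  have XYZ: "X \<noteq> Y" "Y \<noteq> Z" "X \<noteq> Z" using sums unfolding X_def Y_def Z_def neg_equal_iff_equal by simp_all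
  have mem: "X \<in> {A, B}" "Y \<in> {A, B}" "Z \<in> {A', B'}" "Y \<in> {A', B'}" "X \<in> {A'', B''}" "Z \<in> {A'', B''}"
    unfolding X_def Y_def Z_def
    using corner_ray[OF T' T T''] corner_ray[OF T'' T T'] corner_ray[OF T T' T'']
      corner_ray[OF T'' T' T] corner_ray[OF T' T'' T] corner_ray[OF T T'' T'] ne by metis+
  have "corner p T X Y" using mem(1,2) XYZ T corner_swap by blast
  moreover have "corner p T' Y Z" using mem(3,4) XYZ T' corner_swap by blast
  moreover have "corner p T'' X Z" using mem(5,6) XYZ T'' corner_swap by blast
  moreover have "A + B = X + Y" using mem(1,2) XYZ by (auto simp: add.commute)
  then have "X + Y + Z = 0" by (simp add: Z_def)
  ultimately show thesis using that by blast
qed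

section \<open>The polygon around a fan of three corners\<close>

text \<open>
  Three corners with edge vectors \<open>A, B, C\<close> fill the whole angle around \<open>p\<close>.  All six orderings of \<open>A, B, C\<close>
  give a fan, and each statement about a fan carries over to all of them by swapping and rotating.
\<close>

definition fan :: "real^2 \<Rightarrow> real^2 \<Rightarrow> real^2 \<Rightarrow> real^2 \<Rightarrow> bool" where
  "fan p A B C \<longleftrightarrow> A + B + C = 0 \<and>
     (\<exists>T. corner p T A B) \<and> (\<exists>T. corner p T B C) \<and> (\<exists>T. corner p T A C)"

lemma fan_swap:
  assumes "fan p A B C" shows "fan p B A C"
proof -
  have "B + A + C = 0" using assms unfolding fan_def by (simp add: add.commute)
  then show ?thesis using assms corner_swap unfolding fan_def by blast
qed

lemma fan_rotate:
  assumes "fan p A B C" shows "fan p C A B"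
proof -
  have "C + A + B = 0" using assms unfolding fan_def by (simp add: ac_simps)
  then show ?thesis using assms corner_swap unfolding fan_def by blast
qed

lemma fan_corner:
  assumes "fan p A B C"
  shows "A \<in> integer_lattice" "B \<in> integer_lattice" "p \<in> integer_lattice" "\<bar>cross2 A B\<bar> = 1"
    "p \<in> P" "p \<in> interior P" "p + A \<in> P" "p + A \<notin> interior P" "p - C \<in> interior P" "C = - (A + B)"
    "convex hull {p, p + A, p + B} \<in> \<Delta>" "verts (convex hull {p, p + A, p + B}) = {p, p + A, p + B}"
proof -
  obtain T where T: "corner p T A B" using assms unfolding fan_def by blast
  note f = corner_facts[OF T]
  show "A \<in> integer_lattice" "B \<in> integer_lattice" "p \<in> integer_lattice" "\<bar>cross2 A B\<bar> = 1"
    "p \<in> P" "p + A \<in> P" using f by simp_all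
  have d: "T \<in> \<Delta>" "verts T = {p, p + A, p + B}" "p \<in> interior P" "p + A \<notin> interior P" "p + (A + B) \<in> interior P"
    using T unfolding corner_def by simp_all
  then show "p \<in> interior P" "p + A \<notin> interior P" by simp_all
  have "A + B + C = 0" using assms unfolding fan_def by blast
  then show C: "C = - (A + B)" by (metis eq_neg_iff_add_eq_0 add.commute)
  have "p - C = p + (A + B)" unfolding C by (simp only: diff_minus_eq_add)
  then show "p - C \<in> interior P" using d(5) by (simp only:)
  have "T = convex hull {p, p + A, p + B}" using cell_eq_hull[OF d(1)] d(2) by simp
  then show "convex hull {p, p + A, p + B} \<in> \<Delta>" "verts (convex hull {p, p + A, p + B}) = {p, p + A, p + B}"
    using d by simp_all
qed

lemma fan_coordinates:
  assumes "fan p A B C"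
  obtains x y where "z = p + (x *\<^sub>R A + y *\<^sub>R B)" "z \<in> integer_lattice \<Longrightarrow> x \<in> \<int> \<and> y \<in> \<int>"
proof -
  note f = fan_corner[OF assms]
  define x where "x = cross2 A B * cross2 (z - p) B"
  define y where "y = cross2 A B * cross2 A (z - p)"
  have "z - p = x *\<^sub>R A + y *\<^sub>R B"
    using scaleR_unit_swap[OF f(4) cross2_cramer[of A B "z - p"]] by (simp add: x_def y_def scaleR_add_right)
  then have "z = p + (x *\<^sub>R A + y *\<^sub>R B)" by (metis add.commute diff_add_cancel)
  moreover have "x \<in> \<int> \<and> y \<in> \<int>" if "z \<in> integer_lattice"
    unfolding x_def y_def using f that by (auto intro!: Ints_mult lattice_simps)
  ultimately show thesis using that by blast
qed

text \<open>
  A supporting line at \<open>p + A\<close> has \<open>p\<close>, \<open>p + A + B\<close> and \<open>p - B\<close> strictly on its inner side; this restricts its slope.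
\<close>

lemma fan_support:
  assumes F: "fan p A B C"
  obtains m n :: real where "0 < m" "n < 0" "0 < m + n"
    "\<And>x y. p + (x *\<^sub>R A + y *\<^sub>R B) \<in> P \<Longrightarrow> m * x + n * y \<le> m"
    "\<And>x y. p + (x *\<^sub>R A + y *\<^sub>R B) \<in> interior P \<Longrightarrow> m * x + n * y < m"
proof -
  note f = fan_corner[OF F]
  obtain a where a: "a \<noteq> 0" "\<And>z. z \<in> P \<Longrightarrow> a \<bullet> z \<le> a \<bullet> (p + A)" "\<And>z. z \<in> interior P \<Longrightarrow> a \<bullet> z < a \<bullet> (p + A)"
    using supporting_functional[OF f(7,8)] by metis
  define m where "m = a \<bullet> A"
  define n where "n = a \<bullet> B"
  have le: "m * x + n * y \<le> m" if "p + (x *\<^sub>R A + y *\<^sub>R B) \<in> P" for x y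
    using a(2)[OF that] by (simp add: inner_add_right m_def n_def mult.commute)
  have less: "m * x + n * y < m" if "p + (x *\<^sub>R A + y *\<^sub>R B) \<in> interior P" for x y
    using a(3)[OF that] by (simp add: inner_add_right m_def n_def mult.commute)
  have "0 < m" using less[of 0 0] f by simp
  moreover have "p + (1 *\<^sub>R A + 1 *\<^sub>R B) \<in> interior P" using f(9) unfolding f(10) by (simp only: diff_minus_eq_add scaleR_one)
  from less[OF this] have "n < 0" by simp
  moreover have "p - B \<in> interior P" using fan_corner(9)[OF fan_rotate[OF F]] .
  then have "0 < m + n" using less[of 0 "-1"] by simp
  ultimately show thesis using that le less by blast
qed

text \<open>
  A point with \<open>y < x\<close> this far out violates every supporting line at \<open>p + A\<close>.
\<close>

lemma fan_tip_diagonal: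
  assumes F: "fan p A B C" and s: "p + (x *\<^sub>R A + y *\<^sub>R B) \<in> P" "x \<in> \<int>" "y \<in> \<int>" "2 < x + y"
  shows "x \<le> y"
proof (rule ccontr)
  assume "\<not> x \<le> y"
  obtain i j where ij: "x = of_int i" "y = of_int j" using s by (auto elim!: Ints_cases)
  then have "j + 1 \<le> i" using \<open>\<not> x \<le> y\<close> by simp
  then have "real_of_int (j + 1) \<le> real_of_int i" by (simp only: of_int_le_iff)
  then have gap: "1 \<le> x - y" unfolding ij by simp
  obtain m n where mn: "0 < m" "n < 0" "0 < m + n" "m * x + n * y \<le> m"
    using fan_support[OF F] s(1) by metis
  show False
  proof (cases "1 \<le> y")
    case True
    have "m \<le> m * (x - y)" using gap mn by simp
    moreover have "0 < (m + n) * y" using True mn by simp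
    ultimately show False using mn(4) by (simp add: algebra_simps)
  next
    case False
    then have "j \<le> 0" using ij by simp
    then have "y \<le> 0" using ij by simp
    then have "0 \<le> n * y" using mn by (simp add: mult_nonpos_nonpos)
    moreover have "2 < x" using \<open>y \<le> 0\<close> s(4) by linarith
    then have "m < m * x" using mn by simp
    ultimately show False using mn(4) by linarith
  qed
qed

text \<open>
  The interior point \<open>p - C\<close> needs a lattice point of \<open>P\<close> strictly further out.  By the previous
  lemma and its mirror image it lies on the ray from \<open>p\<close> through \<open>p - C\<close>, so \<open>p - 2 C\<close> belongs to \<open>P\<close>.
\<close>

lemma fan_tip:
  assumes F: "fan p A B C"
  shows "p - 2 *\<^sub>R C \<in> P"
proof -
  note f = fan_corner[OF F]
  \<comment> \<open>the sum of the two coordinates of \<open>z\<close>\<close>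
  define h where "h z = cross2 A B * (cross2 (z - p) B + cross2 A (z - p))" for z
  have h: "h (p + (x *\<^sub>R A + y *\<^sub>R B)) = x + y" for x y
  proof -
    have "h (p + (x *\<^sub>R A + y *\<^sub>R B)) = cross2 A B * cross2 A B * (x + y)"
      by (simp add: h_def cross2_add algebra_simps)
    then show ?thesis using unit_square[OF f(4)] by simp
  qed
  obtain S where S: "finite S" "S \<subseteq> integer_lattice" "P = convex hull S"
    using polygon unfolding lattice_polygon_def by blast
  have "\<exists>s\<in>S. 2 < h s"
  proof (rule ccontr)
    assume "\<not> ?thesis"
    then have "S \<subseteq> {z. h z \<le> 2}" by (auto simp: not_less)
    moreover have "convex {z. h z \<le> 2}"
    proof (rule convexI)
      fix z z' u v :: real and y y' assume uv: "y \<in> {z. h z \<le> 2}" "y' \<in> {z. h z \<le> 2}" "0 \<le> u" "0 \<le> v" "u + v = 1"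
      obtain a b where y: "y = p + (a *\<^sub>R A + b *\<^sub>R B)" using fan_coordinates[OF F] by metis
      obtain a' b' where y': "y' = p + (a' *\<^sub>R A + b' *\<^sub>R B)" using fan_coordinates[OF F] by metis
      have "u *\<^sub>R p + v *\<^sub>R p = p" using uv by (simp flip: scaleR_add_left)
      then have "u *\<^sub>R y + v *\<^sub>R y' = p + ((u * a + v * a') *\<^sub>R A + (u * b + v * b') *\<^sub>R B)"
        unfolding y y' by (simp add: algebra_simps)
      then have "h (u *\<^sub>R y + v *\<^sub>R y') = (u * a + v * a') + (u * b + v * b')" by (simp only: h)
      then have "h (u *\<^sub>R y + v *\<^sub>R y') = u * (a + b) + v * (a' + b')" by (simp add: algebra_simps)
      moreover have "a + b \<le> 2" "a' + b' \<le> 2" using uv h y y' by auto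
      then have "u * (a + b) + v * (a' + b') \<le> u * 2 + v * 2" using uv by (intro add_mono mult_left_mono) auto
      ultimately show "u *\<^sub>R y + v *\<^sub>R y' \<in> {z. h z \<le> 2}" using uv(5) by simp
    qed
    ultimately have PH: "P \<subseteq> {z. h z \<le> 2}" using S hull_minimal by metis
    obtain d where d: "0 < d" "ball (p - C) d \<subseteq> P" using f(9) unfolding mem_interior by blast
    have nA: "0 < norm A" using f(4) by (auto simp: cross2_def)
    define e where "e = d / (2 * norm A)"
    have e: "0 < e" using d nA by (simp add: e_def)
    have "dist (p - C) (p - C + e *\<^sub>R A) = e * norm A" using e by (simp add: dist_norm)
    also have "\<dots> = d / 2" using nA by (simp add: e_def)
    also have "\<dots> < d" using d by simp
    finally have "p - C + e *\<^sub>R A \<in> P" using d by auto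
    moreover have "p - C + e *\<^sub>R A = p + ((1 + e) *\<^sub>R A + 1 *\<^sub>R B)" unfolding f(10) by (simp add: algebra_simps)
    ultimately have "p + ((1 + e) *\<^sub>R A + 1 *\<^sub>R B) \<in> P" by (simp only:)
    then have "h (p + ((1 + e) *\<^sub>R A + 1 *\<^sub>R B)) \<le> 2" using PH by blast
    then have "(1 + e) + 1 \<le> 2" by (simp only: h)
    then show False using e by simp
  qed
  then obtain s where s: "s \<in> S" "2 < h s" by blast
  obtain x y where xy: "s = p + (x *\<^sub>R A + y *\<^sub>R B)" "x \<in> \<int> \<and> y \<in> \<int>"
    using fan_coordinates[OF F, of s] S s by blast
  have sP: "s \<in> P" using s S hull_inc by metis
  have gt: "2 < x + y" using s(2) h xy(1) by simp
  have "x \<le> y" using fan_tip_diagonal[OF F] sP xy gt by blast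
  moreover have "y \<le> x"
  proof (rule fan_tip_diagonal[OF fan_swap[OF F]])
    show "p + (y *\<^sub>R B + x *\<^sub>R A) \<in> P" using sP xy(1) by (simp add: add.commute)
  qed (use xy gt in auto)
  ultimately have "x = y" by simp
  obtain i where i: "x = of_int i" using xy by (auto elim!: Ints_cases)
  have "1 < x" using gt \<open>x = y\<close> by linarith
  then have "2 \<le> i" unfolding i by simp
  then have x2: "2 \<le> x" unfolding i by simp
  have s': "s = p - x *\<^sub>R C" unfolding xy(1) f(10) using \<open>x = y\<close> by (simp add: algebra_simps)
  have "(1 - 2 / x) *\<^sub>R p + (2 / x) *\<^sub>R s \<in> P"
    using convexD[OF convex_P f(5) sP, of "1 - 2 / x" "2 / x"] x2 by simp
  moreover have "(2 / x) *\<^sub>R s = (2 / x) *\<^sub>R p - 2 *\<^sub>R C"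
    unfolding s' scaleR_diff_right using x2 by simp
  then have "(1 - 2 / x) *\<^sub>R p + (2 / x) *\<^sub>R s = p - 2 *\<^sub>R C"
    by (simp add: scaleR_diff_left)
  ultimately show ?thesis by simp
qed

text \<open>
  Of all lines through \<open>p + A\<close> only the one through the tips \<open>p - 2 B\<close> and \<open>p - 2 C\<close> has both tips on its inner side.
\<close>

lemma fan_bound:
  assumes F: "fan p A B C"
  shows "p + (x *\<^sub>R A + y *\<^sub>R B) \<in> P \<Longrightarrow> 2 * x - y \<le> 2"
    and "p + (x *\<^sub>R A + y *\<^sub>R B) \<in> interior P \<Longrightarrow> 2 * x - y < 2"
proof -
  note f = fan_corner[OF F]
  obtain m n where mn: "0 < m" "n < 0"
    "\<And>x y. p + (x *\<^sub>R A + y *\<^sub>R B) \<in> P \<Longrightarrow> m * x + n * y \<le> m"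
    "\<And>x y. p + (x *\<^sub>R A + y *\<^sub>R B) \<in> interior P \<Longrightarrow> m * x + n * y < m"
    using fan_support[OF F] by metis
  have eq: "p - 2 *\<^sub>R C = p + (2 *\<^sub>R A + 2 *\<^sub>R B)" unfolding f(10) by (simp add: algebra_simps)
  have "p + (2 *\<^sub>R A + 2 *\<^sub>R B) \<in> P" using fan_tip[OF F] by (simp only: eq)
  from mn(3)[OF this] have "m * 2 + n * 2 \<le> m" .
  moreover have "p - 2 *\<^sub>R B \<in> P" using fan_tip[OF fan_rotate[OF F]] .
  then have "n * (- 2) \<le> m" using mn(3)[of 0 "-2"] by simp
  ultimately have m: "m = - 2 * n" by linarith
  show "2 * x - y \<le> 2" if "p + (x *\<^sub>R A + y *\<^sub>R B) \<in> P"
  proof -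
    have "(- n) * (2 * x - y) \<le> (- n) * 2" using mn(3)[OF that] unfolding m by (simp add: algebra_simps)
    then show ?thesis using mn(2) by (simp only: mult_le_cancel_left)
  qed
  show "2 * x - y < 2" if "p + (x *\<^sub>R A + y *\<^sub>R B) \<in> interior P"
  proof -
    have "(- n) * (2 * x - y) < (- n) * 2" using mn(4)[OF that] unfolding m by (simp add: algebra_simps)
    then show ?thesis using mn(2) by (simp only: mult_less_cancel_left)
  qed
qed

lemma fan_bounds:
  assumes F: "fan p A B C"
  shows "p + (x *\<^sub>R A + y *\<^sub>R B) \<in> P \<Longrightarrow> 2 * x - y \<le> 2 \<and> 2 * y - x \<le> 2 \<and> - 2 \<le> x + y"
    and "p + (x *\<^sub>R A + y *\<^sub>R B) \<in> interior P \<Longrightarrow> 2 * x - y < 2 \<and> 2 * y - x < 2 \<and> - 2 < x + y"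
proof -
  have 1: "p + (x *\<^sub>R A + y *\<^sub>R B) = p + (y *\<^sub>R B + x *\<^sub>R A)" by (simp add: add.commute)
  have 2: "p + (x *\<^sub>R A + y *\<^sub>R B) = p + ((- y) *\<^sub>R C + (x - y) *\<^sub>R A)"
    unfolding fan_corner(10)[OF F] by (simp add: algebra_simps)
  show "2 * x - y \<le> 2 \<and> 2 * y - x \<le> 2 \<and> - 2 \<le> x + y" if "p + (x *\<^sub>R A + y *\<^sub>R B) \<in> P"
    using fan_bound(1)[OF F that] fan_bound(1)[OF fan_swap[OF F] that[unfolded 1]]
      fan_bound(1)[OF fan_rotate[OF F] that[unfolded 2]] by linarith
  show "2 * x - y < 2 \<and> 2 * y - x < 2 \<and> - 2 < x + y" if "p + (x *\<^sub>R A + y *\<^sub>R B) \<in> interior P"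
    using fan_bound(2)[OF F that] fan_bound(2)[OF fan_swap[OF F] that[unfolded 1]]
      fan_bound(2)[OF fan_rotate[OF F] that[unfolded 2]] by linarith
qed

lemma fan_polygon:
  assumes F: "fan p A B C"
  shows "P = convex hull {p - 2 *\<^sub>R C, p - 2 *\<^sub>R A, p - 2 *\<^sub>R B}"
proof
  note f = fan_corner[OF F]
  show "convex hull {p - 2 *\<^sub>R C, p - 2 *\<^sub>R A, p - 2 *\<^sub>R B} \<subseteq> P"
    using fan_tip[OF F] fan_tip[OF fan_rotate[OF F]] fan_tip[OF fan_rotate[OF fan_rotate[OF F]]] convex_P
    by (intro hull_minimal) simp_all
  show "P \<subseteq> convex hull {p - 2 *\<^sub>R C, p - 2 *\<^sub>R A, p - 2 *\<^sub>R B}"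
  proof
    fix z assume z: "z \<in> P"
    obtain x y where xy: "z = p + (x *\<^sub>R A + y *\<^sub>R B)" using fan_coordinates[OF F] by metis
    have b: "2 * x - y \<le> 2 \<and> 2 * y - x \<le> 2 \<and> - 2 \<le> x + y" using fan_bounds(1)[OF F] z xy by blast
    \<comment> \<open>barycentric coordinates: the distances from the three sides, normalised to have sum one\<close>
    define u where "u = (x + y + 2) / 6"
    define v where "v = (2 - (2 * x - y)) / 6"
    define w where "w = (2 - (2 * y - x)) / 6"
    have uvw: "0 \<le> u" "0 \<le> v" "0 \<le> w" "u + v + w = 1" using b by (auto simp: u_def v_def w_def field_simps)
    have x: "x = 2 * u - 2 * v" and y: "y = 2 * u - 2 * w" by (simp_all add: u_def v_def w_def field_simps)
    have "p = (u + v + w) *\<^sub>R p" using uvw by simp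
    then have "z = u *\<^sub>R (p - 2 *\<^sub>R C) + v *\<^sub>R (p - 2 *\<^sub>R A) + w *\<^sub>R (p - 2 *\<^sub>R B)"
      unfolding xy x y f(10) by (simp add: algebra_simps)
    then show "z \<in> convex hull {p - 2 *\<^sub>R C, p - 2 *\<^sub>R A, p - 2 *\<^sub>R B}"
      unfolding convex_hull_3 using uvw by blast
  qed
qed

lemma fan_lattice_points:
  assumes F: "fan p A B C" and z: "z \<in> P" "z \<in> integer_lattice"
  shows "z \<in> {p, p + A, p + B, p + C, p - A, p - B, p - C, p - 2 *\<^sub>R A, p - 2 *\<^sub>R B, p - 2 *\<^sub>R C}"
    and "z \<in> interior P \<Longrightarrow> z \<in> {p, p - A, p - B, p - C}"
proof -
  note f = fan_corner[OF F]
  obtain x y where xy: "z = p + (x *\<^sub>R A + y *\<^sub>R B)" "x \<in> \<int> \<and> y \<in> \<int>"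
    using fan_coordinates[OF F, of z] z by blast
  obtain i j where ij: "x = of_int i" "y = of_int j" using xy by (auto elim!: Ints_cases)
  have "2 * x - y \<le> 2 \<and> 2 * y - x \<le> 2 \<and> - 2 \<le> x + y" using fan_bounds(1)[OF F] z xy by blast
  then have "2 * i - j \<le> 2" "2 * j - i \<le> 2" "- 2 \<le> i + j" unfolding ij by linarith+
  then have "(i, j) \<in> {(0, 0), (1, 0), (0, 1), (-1, -1), (-1, 0), (0, -1), (1, 1), (-2, 0), (0, -2), (2, 2)}"
    by (simp, presburger)
  then show "z \<in> {p, p + A, p + B, p + C, p - A, p - B, p - C, p - 2 *\<^sub>R A, p - 2 *\<^sub>R B, p - 2 *\<^sub>R C}"
    unfolding xy(1) ij f(10) by (auto simp: algebra_simps)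
  assume "z \<in> interior P"
  then have "2 * x - y < 2 \<and> 2 * y - x < 2 \<and> - 2 < x + y" using fan_bounds(2)[OF F] xy by blast
  then have "2 * i - j < 2" "2 * j - i < 2" "- 2 < i + j" unfolding ij by linarith+
  then have "(i, j) \<in> {(0, 0), (-1, 0), (0, -1), (1, 1)}"
    by (simp, presburger)
  then show "z \<in> {p, p - A, p - B, p - C}"
    unfolding xy(1) ij f(10) by (auto simp: algebra_simps)
qed

lemma fan_genus:
  assumes F: "fan p A B C"
  shows "card (interior P \<inter> integer_lattice) = 4"
proof -
  note f = fan_corner[OF F]
  have "C \<in> integer_lattice" using fan_corner(1)[OF fan_rotate[OF F]] .
  then have "{p, p - A, p - B, p - C} \<subseteq> interior P \<inter> integer_lattice"
    using fan_corner(9)[OF fan_rotate[OF fan_rotate[OF F]]] fan_corner(9)[OF fan_rotate[OF F]]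
      f(1-3,6,9) lattice_simps(2)[OF f(3)] by simp
  moreover have "z \<in> {p, p - A, p - B, p - C}" if "z \<in> interior P \<inter> integer_lattice" for z
  proof -
    have "z \<in> P" using that interior_subset by blast
    then show ?thesis using fan_lattice_points(2)[OF F] that by blast
  qed
  ultimately have "interior P \<inter> integer_lattice = {p, p - A, p - B, p - C}" by blast
  moreover have "cross2 A B \<noteq> 0" using f(4) by auto
  from distinct_hexagon_points[OF this f(10), of p] have "card {p, p - A, p - B, p - C} = 4" by simp
  ultimately show ?thesis by simp
qed

section \<open>The triangles around a fan of three corners\<close>

lemma no_four_verts:
  assumes "T \<in> \<Delta>" "{a, b, c, d} \<subseteq> verts T" "distinct [a, b, c, d]"
  shows False
proof -
  have "card {a, b, c, d} = 4" using distinct_card[OF assms(3)] by simp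
  then show False using card_mono[OF finite_verts[OF assms(1)] assms(2)] card_verts[OF assms(1)] by simp
qed

text \<open>
  The segment from an outer point beyond the side \<open>A B\<close> to a point that does not belong there either passes
  through a lattice point, or crosses a side of the cell \<open>p, p + A, p + B\<close>, whose ends must then be
  vertices of \<open>T\<close> as well.  In both cases \<open>T\<close> has too many lattice points.
\<close>

lemma fan_far:
  assumes F: "fan p A B C" and T: "T \<in> \<Delta>" "u \<in> verts T" "w \<in> verts T"
    and u: "u \<in> {p - C, p - 2 *\<^sub>R C}" and w: "w \<in> {p, p + C, p - A, p - 2 *\<^sub>R A}"
  shows False
proof -
  note f = fan_corner[OF F]
  let ?K = "convex hull {p, p + A, p + B}"
  have conv: "convex T" using cell_eq_hull[OF T(1)] convex_convex_hull by metis
  have uw: "u \<in> T" "w \<in> T" using T vert_in by blast+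
  have mid: "(1 - s) *\<^sub>R u + s *\<^sub>R w \<in> T" if "0 \<le> s" "s \<le> 1" for s
    using convexD[OF conv uw, of "1 - s" s] that by simp
  have "cross2 A B \<noteq> 0" using f(4) by auto
  note D = distinct_hexagon_points[OF this f(10), of p]
  have ne: "u \<noteq> w" using D u w by auto
  have lat: "p \<in> integer_lattice" "p - C \<in> integer_lattice" "p + B \<in> integer_lattice"
    using f(1-3) fan_corner(1)[OF fan_rotate[OF F]] lattice_simps(1,2) by auto
  have through: False if "(1 - s) *\<^sub>R u + s *\<^sub>R w = v" "0 < s" "s < 1" "v \<in> integer_lattice" for s v
    using vert_not_between[OF T(1) _ uw that(2,3)] that ne by blast
  have face: "x \<in> verts T \<and> y \<in> verts T"
    if "(1 - s) *\<^sub>R u + s *\<^sub>R w = (1 - t) *\<^sub>R x + t *\<^sub>R y" "0 \<le> s" "s \<le> 1" "0 < t" "t < 1"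
      "x \<in> {p, p + A, p + B}" "y \<in> {p, p + A, p + B}" for s t x y
  proof -
    have xy: "x \<in> verts ?K" "y \<in> verts ?K" using that f(12) by auto
    have "(1 - t) *\<^sub>R x + t *\<^sub>R y \<in> T" using mid[OF that(2,3)] that(1) by simp
    then have "x \<in> T" "y \<in> T"
      using face_of_common[OF f(11) T(1) _ vert_in[OF xy(1)] vert_in[OF xy(2)] that(4,5)] by blast+
    then show ?thesis using xy vert_lattice by (auto simp: verts_def)
  qed
  have edge: False if "(1 - s) *\<^sub>R u + s *\<^sub>R w = (1 - t) *\<^sub>R p + t *\<^sub>R (p + B)" "0 \<le> s" "s \<le> 1" "0 < t" "t < 1"
      "w \<in> {p - A, p - 2 *\<^sub>R A}" for s t
  proof -
    have "p \<in> verts T \<and> p + B \<in> verts T" using face[OF that(1-5)] by blast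
    moreover have "distinct [u, w, p, p + B]" using D u that(6) by auto
    ultimately show False using no_four_verts[OF T(1), of u w p "p + B"] T by blast
  qed
  \<comment> \<open>Each case meets one of: the lattice point between \<open>u\<close> and \<open>w\<close>, the side \<open>A B\<close> (case 1), the side from \<open>p\<close> to \<open>p + B\<close>.\<close>
  consider "u = p - C" "w = p" | "u = p - C" "w = p + C" | "u = p - C" "w = p - A"
    | "u = p - C" "w = p - 2 *\<^sub>R A" | "u = p - 2 *\<^sub>R C" "w = p" | "u = p - 2 *\<^sub>R C" "w = p + C"
    | "u = p - 2 *\<^sub>R C" "w = p - A" | "u = p - 2 *\<^sub>R C" "w = p - 2 *\<^sub>R A"
    using u w by blast
  then show False
  proof cases
    case 1
    have "p + A \<in> verts T \<and> p + B \<in> verts T"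
      by (rule face[of "1/2" "1/2"]) (simp_all add: 1 f(10) vec_eq_iff field_simps)
    moreover have "distinct [u, w, p + A, p + B]" unfolding 1 using D by auto
    ultimately show False using no_four_verts[OF T(1), of u w "p + A" "p + B"] T by blast
  next
    case 2
    show False by (rule through[OF _ _ _ lat(1), of "1/2"]) (simp_all add: 2 vec_eq_iff field_simps)
  next
    case 3
    show False by (rule edge[of "1/2" "1/2"]) (simp_all add: 3 f(10) vec_eq_iff field_simps)
  next
    case 4
    show False by (rule edge[of "1/3" "2/3"]) (simp_all add: 4 f(10) vec_eq_iff field_simps)
  next
    case 5
    show False by (rule through[OF _ _ _ lat(2), of "1/2"]) (simp_all add: 5 vec_eq_iff field_simps)
  next
    case 6
    show False by (rule through[OF _ _ _ lat(1), of "2/3"]) (simp_all add: 6 vec_eq_iff field_simps)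
  next
    case 7
    show False by (rule edge[of "2/3" "2/3"]) (simp_all add: 7 f(10) vec_eq_iff field_simps)
  next
    case 8
    show False by (rule through[OF _ _ _ lat(3), of "1/2"]) (simp_all add: 8 f(10) vec_eq_iff field_simps)
  qed
qed

text \<open>
  Only three of the four triangles on these four points belong to the cone over \<open>m\<close>; the remaining one is
  too large for a cell.
\<close>

lemma cell_in_cone:
  assumes T: "T \<in> \<Delta>" "verts T \<subseteq> {m, x, y, z}" and d: "distinct [m, x, y, z]"
    and big: "\<bar>cross2 (y - x) (z - x)\<bar> \<noteq> 1"
  shows "T \<in> cone_triangles m x y z"
proof -
  let ?X = "{m, x, y, z}"
  have "card ?X = 4" using distinct_card[OF d] by simp
  then have "card (?X - verts T) = 1"
    using card_Diff_subset[OF finite_verts[OF T(1)] T(2)] card_verts[OF T(1)] by simp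
  then obtain v where v: "?X - verts T = {v}" by (meson card_1_singletonE)
  then have V: "verts T = ?X - {v}" using T(2) by blast
  have hull: "T = convex hull (verts T)" by (rule cell_eq_hull[OF T(1)])
  have "v \<in> ?X" using v by blast
  then consider "v = m" | "v = x" | "v = y" | "v = z" by blast
  then show ?thesis
  proof cases
    case 1
    then have "verts T = {x, y, z}" using V d by auto
    then show ?thesis using cell_unit[OF T(1)] big by blast
  next
    case 2
    then have "verts T = {m, y, z}" using V d by auto
    then show ?thesis using hull unfolding cone_triangles_def by simp
  next
    case 3
    then have "verts T = {m, x, z}" using V d by auto
    then show ?thesis using hull unfolding cone_triangles_def by simp
  next
    case 4
    then have "verts T = {m, x, y}" using V d by auto
    then show ?thesis using hull unfolding cone_triangles_def by simp
  qed
qed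

lemma fan_outer_cell:
  assumes F: "fan p A B C" and T: "T \<in> \<Delta>" "u \<in> verts T" "u \<in> {p - C, p - 2 *\<^sub>R C}"
  shows "T \<in> cone_triangles (p - C) (p - 2 *\<^sub>R C) (p + A) (p + B)"
proof (rule cell_in_cone[OF T(1)])
  note f = fan_corner[OF F]
  have c0: "cross2 A B \<noteq> 0" using f(4) by auto
  note D = distinct_hexagon_points[OF this f(10), of p]
  show "distinct [p - C, p - 2 *\<^sub>R C, p + A, p + B]" using D by auto
  show "verts T \<subseteq> {p - C, p - 2 *\<^sub>R C, p + A, p + B}"
  proof
    fix w assume w: "w \<in> verts T"
    then have "w \<in> P" "w \<in> integer_lattice" using vert_in vert_lattice cell_subset[OF T(1)] by blast+
    then have "w \<in> {p, p + A, p + B, p + C, p - A, p - B, p - C, p - 2 *\<^sub>R A, p - 2 *\<^sub>R B, p - 2 *\<^sub>R C}"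
      by (rule fan_lattice_points(1)[OF F])
    moreover have "w \<notin> {p, p + C, p - A, p - 2 *\<^sub>R A}" using fan_far[OF F T(1,2) w T(3)] by blast
    moreover have "w \<notin> {p, p + C, p - B, p - 2 *\<^sub>R B}" using fan_far[OF fan_swap[OF F] T(1,2) w T(3)] by blast
    ultimately show "w \<in> {p - C, p - 2 *\<^sub>R C, p + A, p + B}" by blast
  qed
  have "cross2 (p + A - (p - 2 *\<^sub>R C)) (p + B - (p - 2 *\<^sub>R C)) = - 3 * cross2 A B"
    unfolding f(10) by (simp add: cross2_def algebra_simps)
  then show "\<bar>cross2 (p + A - (p - 2 *\<^sub>R C)) (p + B - (p - 2 *\<^sub>R C))\<bar> \<noteq> 1"
    using f(4) by (simp add: abs_mult)
qed

lemma card_cone_triangles: "finite (cone_triangles m x y z)" "card (cone_triangles m x y z) \<le> 3"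
  unfolding cone_triangles_def by (simp_all add: card_insert_if)

definition fan_cells :: "real^2 \<Rightarrow> real^2 \<Rightarrow> real^2 \<Rightarrow> real^2 \<Rightarrow> (real^2) set set" where
  "fan_cells p A B C =
     cone_triangles p (p + A) (p + B) (p + C) \<union>
     cone_triangles (p - C) (p - 2 *\<^sub>R C) (p + A) (p + B) \<union>
     cone_triangles (p - A) (p - 2 *\<^sub>R A) (p + B) (p + C) \<union>
     cone_triangles (p - B) (p - 2 *\<^sub>R B) (p + A) (p + C)"

lemma fan_cells_superset:
  assumes F: "fan p A B C"
  shows "\<Delta> \<subseteq> fan_cells p A B C"
proof
  fix T assume T: "T \<in> \<Delta>"
  note f = fan_corner[OF F]
  have lat: "w \<in> {p, p + A, p + B, p + C, p - A, p - B, p - C, p - 2 *\<^sub>R A, p - 2 *\<^sub>R B, p - 2 *\<^sub>R C}"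
    if "w \<in> verts T" for w
    using fan_lattice_points(1)[OF F] that vert_in vert_lattice cell_subset[OF T] by blast
  consider w where "w \<in> verts T" "w \<in> {p - C, p - 2 *\<^sub>R C}" | w where "w \<in> verts T" "w \<in> {p - A, p - 2 *\<^sub>R A}"
    | w where "w \<in> verts T" "w \<in> {p - B, p - 2 *\<^sub>R B}" | "verts T \<subseteq> {p, p + A, p + B, p + C}"
    using lat by blast
  then show "T \<in> fan_cells p A B C"
  proof cases
    case 1
    then show ?thesis using fan_outer_cell[OF F T] unfolding fan_cells_def by blast
  next
    case 2
    then show ?thesis using fan_outer_cell[OF fan_rotate[OF fan_rotate[OF F]] T] unfolding fan_cells_def by blast
  next
    case 3
    then show ?thesis using fan_outer_cell[OF fan_swap[OF fan_rotate[OF F]] T] unfolding fan_cells_def by blast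
  next
    case 4
    have c0: "cross2 A B \<noteq> 0" using f(4) by auto
    have "T \<in> cone_triangles p (p + A) (p + B) (p + C)"
    proof (rule cell_in_cone[OF T 4])
      show "distinct [p, p + A, p + B, p + C]" using distinct_hexagon_points[OF c0 f(10), of p] by auto
      have "cross2 (p + B - (p + A)) (p + C - (p + A)) = 3 * cross2 A B"
        unfolding f(10) by (simp add: cross2_def algebra_simps)
      then show "\<bar>cross2 (p + B - (p + A)) (p + C - (p + A))\<bar> \<noteq> 1"
        using f(4) by (simp add: abs_mult)
    qed
    then show ?thesis unfolding fan_cells_def by blast
  qed
qed

text \<open>
  The polygon has area six, and every cell has area one half.
\<close>

lemma fan_card_cells:
  assumes F: "fan p A B C" shows "12 \<le> card \<Delta>"
proof -
  note f = fan_corner[OF F]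
  have cell: "T \<in> lmeasurable \<and> measure lebesgue T = 1 / 2" if T: "T \<in> \<Delta>" for T
  proof -
    obtain x y z where "T = convex hull {x, y, z}" using T by (metis cell_triangle)
    then have "T \<in> lmeasurable" using measure_hull_triangle(1) by simp
    then show ?thesis using unimodular T unfolding unimodular_triangulation_def by blast
  qed
  have "cross2 (p - 2 *\<^sub>R A - (p - 2 *\<^sub>R C)) (p - 2 *\<^sub>R B - (p - 2 *\<^sub>R C)) = 12 * cross2 A B"
    unfolding f(10) by (simp add: cross2_def algebra_simps)
  then have "measure lebesgue P = 6"
    unfolding fan_polygon[OF F] measure_hull_triangle(2) using f(4) by (simp add: abs_mult)
  moreover have "measure lebesgue (\<Union>T\<in>\<Delta>. T) \<le> (\<Sum>T\<in>\<Delta>. measure lebesgue T)"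
    by (rule measure_UNION_le) (use finite_cells cell in \<open>auto simp: fmeasurableD\<close>)
  then have "measure lebesgue (\<Union>\<Delta>) \<le> (\<Sum>T\<in>\<Delta>. measure lebesgue T)" by simp
  ultimately have "6 \<le> real (card \<Delta>) * (1 / 2)" using Union_cells cell by simp
  then show ?thesis by simp
qed

lemma fan_cells_eq:
  assumes F: "fan p A B C" shows "\<Delta> = fan_cells p A B C"
proof (rule card_seteq[OF _ fan_cells_superset[OF F]])
  show "finite (fan_cells p A B C)" unfolding fan_cells_def using card_cone_triangles(1) by simp
  have "card (fan_cells p A B C) \<le> 3 + 3 + 3 + 3"
    unfolding fan_cells_def
    by (intro order_trans[OF card_Un_le] add_mono card_cone_triangles(2))
  then show "card (fan_cells p A B C) \<le> card \<Delta>" using fan_card_cells[OF F] by simp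
qed

end

section \<open>Normal form\<close>

lemma affine_image_hull:
  fixes L :: "real^2 \<Rightarrow> real^2"
  assumes "linear L"
  shows "(\<lambda>x. L x + t) ` (convex hull S) = convex hull ((\<lambda>x. L x + t) ` S)"
proof -
  have "(\<lambda>x. L x + t) ` X = (\<lambda>x. t + x) ` (L ` X)" for X by (simp add: image_image add.commute)
  then show ?thesis by (simp add: convex_hull_linear_image[OF assms] convex_hull_translation)
qed

text \<open>
  The inverse of the matrix with columns \<open>A\<close> and \<open>B\<close> is integral because the determinant is a unit.
\<close>

lemma unimodular_coordinates:
  assumes "A \<in> integer_lattice" "B \<in> integer_lattice" "p \<in> integer_lattice" "\<bar>cross2 A B\<bar> = 1"
  obtains f where "unimodular_map f" "\<And>x y. f (p + (x *\<^sub>R A + y *\<^sub>R B)) = vector [x, y]"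
    "\<And>S. f ` (convex hull S) = convex hull (f ` S)"
proof -
  obtain a1 a2 where a: "A $ 1 = of_int a1" "A $ 2 = of_int a2"
    using assms(1) unfolding integer_lattice_def by (auto elim!: Ints_cases simp: forall_2)
  obtain b1 b2 where b: "B $ 1 = of_int b1" "B $ 2 = of_int b2"
    using assms(2) unfolding integer_lattice_def by (auto elim!: Ints_cases simp: forall_2)
  obtain p1 p2 where p: "p $ 1 = of_int p1" "p $ 2 = of_int p2"
    using assms(3) unfolding integer_lattice_def by (auto elim!: Ints_cases simp: forall_2)
  define d where "d = a1 * b2 - a2 * b1"
  have c: "cross2 A B = of_int d" by (simp add: cross2_def a b d_def)
  then have dd: "d * d = 1" using unit_square[OF assms(4)] by (metis of_int_eq_1_iff of_int_mult)
  then have dr: "real_of_int d * real_of_int d = 1" by (metis of_int_eq_1_iff of_int_mult)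
  define M :: "int^2^2" where "M = vector [vector [d * b2, - d * b1], vector [- d * a2, d * a1]]"
  define N :: "int^2^2" where "N = vector [vector [a1, b1], vector [a2, b2]]"
  define t :: "int^2" where "t = vector [- d * b2 * p1 + d * b1 * p2, d * a2 * p1 - d * a1 * p2]"
  have "d * (a1 * b2) - d * (a2 * b1) = 1" using dd unfolding d_def by (simp add: algebra_simps)
  then have "M ** N = mat 1 \<and> N ** M = mat 1"
    by (auto simp: M_def N_def matrix_matrix_mult_def mat_def vec_eq_iff forall_2 sum_2 algebra_simps)
  then have inv: "invertible M" unfolding invertible_def by blast
  define R :: "real^2^2" where "R = (\<chi> i j. real_of_int (M $ i $ j))"
  define f where "f = (\<lambda>x. R *v x + (\<chi> i. real_of_int (t $ i)))"
  have "unimodular_map f" unfolding unimodular_map_def f_def R_def using inv by blast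
  moreover have "f (p + (x *\<^sub>R A + y *\<^sub>R B)) = vector [x, y]" for x y
  proof -
    have "f (p + (x *\<^sub>R A + y *\<^sub>R B)) $ 1 = x * (real_of_int d * real_of_int d)"
      by (simp add: f_def R_def M_def t_def matrix_vector_mult_def sum_2 a b p)
        (simp add: d_def algebra_simps)
    moreover have "f (p + (x *\<^sub>R A + y *\<^sub>R B)) $ 2 = y * (real_of_int d * real_of_int d)"
      by (simp add: f_def R_def M_def t_def matrix_vector_mult_def sum_2 a b p)
        (simp add: d_def algebra_simps)
    ultimately show ?thesis using dr by (simp add: vec_eq_iff forall_2)
  qed
  moreover have "f ` (convex hull S) = convex hull (f ` S)" for S
    unfolding f_def by (rule affine_image_hull) simp
  ultimately show thesis using that by blast
qed

lemma (in unimodular_complex) fan_antihoneycomb: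
  assumes F: "fan p A B C"
  shows "\<exists>f. unimodular_map f \<and> f ` P = antihoneycomb_triangle4 \<and> (\<lambda>T. f ` T) ` \<Delta> = antihoneycomb_triangulation4"
proof -
  note c = fan_corner[OF F]
  obtain f where f: "unimodular_map f" "\<And>x y. f (p + (x *\<^sub>R A + y *\<^sub>R B)) = vector [x, y]"
    "\<And>S. f ` (convex hull S) = convex hull (f ` S)"
    using unimodular_coordinates[OF c(1-4)] by metis
  have "p = p + (0 *\<^sub>R A + 0 *\<^sub>R B)" "p + A = p + (1 *\<^sub>R A + 0 *\<^sub>R B)" "p + B = p + (0 *\<^sub>R A + 1 *\<^sub>R B)"
    "p + C = p + ((-1) *\<^sub>R A + (-1) *\<^sub>R B)" "p - A = p + ((-1) *\<^sub>R A + 0 *\<^sub>R B)"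
    "p - B = p + (0 *\<^sub>R A + (-1) *\<^sub>R B)" "p - C = p + (1 *\<^sub>R A + 1 *\<^sub>R B)"
    "p - 2 *\<^sub>R A = p + ((-2) *\<^sub>R A + 0 *\<^sub>R B)" "p - 2 *\<^sub>R B = p + (0 *\<^sub>R A + (-2) *\<^sub>R B)"
    "p - 2 *\<^sub>R C = p + (2 *\<^sub>R A + 2 *\<^sub>R B)"
    unfolding c(10) by (simp_all add: algebra_simps)
  then have v: "f p = vector [0, 0]" "f (p + A) = vector [1, 0]" "f (p + B) = vector [0, 1]"
    "f (p + C) = vector [-1, -1]" "f (p - A) = vector [-1, 0]" "f (p - B) = vector [0, -1]"
    "f (p - C) = vector [1, 1]" "f (p - 2 *\<^sub>R A) = vector [-2, 0]" "f (p - 2 *\<^sub>R B) = vector [0, -2]"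
    "f (p - 2 *\<^sub>R C) = vector [2, 2]"
    using f(2) by metis+
  have "f ` P = antihoneycomb_triangle4"
    unfolding fan_polygon[OF F] antihoneycomb_triangle4_def f(3) by (simp add: v)
  moreover have cone: "(\<lambda>T. f ` T) ` cone_triangles m x y z = cone_triangles (f m) (f x) (f y) (f z)" for m x y z
    unfolding cone_triangles_def by (simp add: f(3))
  have "(\<lambda>T. f ` T) ` \<Delta> = antihoneycomb_triangulation4"
    unfolding fan_cells_eq[OF F] fan_cells_def antihoneycomb_triangulation4_def Let_def
    by (simp only: image_Un cone v)
  ultimately show ?thesis using f(1) by blast
qed

theorem theorem10:
  fixes P :: "(real^2) set" and \<Delta> :: "(real^2) set set"
    and G :: "(real^2) set multigraph" and g :: nat
  assumes "lattice_polygon P"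
    and "card (interior P \<inter> integer_lattice) = g"
    and "unimodular_triangulation P \<Delta>"
    and "skeleton_of \<Delta> G"
    and "has_sprawling_triangle G"
  shows "g = 4 \<and>
    (\<exists>f. unimodular_map f \<and> f ` P = antihoneycomb_triangle4 \<and>
         (\<lambda>T. f ` T) ` \<Delta> = antihoneycomb_triangulation4)"
proof -
  interpret unimodular_complex P \<Delta> using assms by unfold_locales
  obtain Z r v1 v2 v3 where hung: "hung_cycle (dual_graph \<Delta>) Z r"
    and vZ: "{v1, v2, v3} \<subseteq> Z" and "card {v1, v2, v3} = 3"
    and load: "\<forall>z \<in> {v1, v2, v3}. loaded (dual_graph \<Delta>) Z r z"
    using hung_cycle_of_dual_graph[OF wf_dual_graph assms(4,5)] by metis
  then have ne: "v1 \<noteq> v2" "v2 \<noteq> v3" "v1 \<noteq> v3" by (auto simp: card_insert_if split: if_splits)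
  have "Z \<noteq> {}" using vZ by blast
  then obtain p where p: "p \<in> integer_lattice" "p \<in> interior P" "\<And>z. z \<in> Z \<Longrightarrow> p \<in> z"
    using cycle_is_star[OF hung] by metis
  have "\<exists>A B. corner p z A B" if "z \<in> {v1, v2, v3}" for z
  proof -
    have z: "z \<in> Z" "loaded (dual_graph \<Delta>) Z r z" using that vZ load by auto
    have "p \<in> verts z" using p(1) p(3)[OF z(1)] by (simp add: verts_def)
    moreover have "z \<in> \<Delta>" using z(1) hung_facts(1)[OF hung] by blast
    ultimately show ?thesis
      using loaded_node[OF hung z _ p(2)] corner_of_loaded_node[OF \<open>z \<in> \<Delta>\<close> _ p(2)] by metis
  qed
  then obtain A1 B1 A2 B2 A3 B3 where "corner p v1 A1 B1" "corner p v2 A2 B2" "corner p v3 A3 B3"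
    by (metis insertCI)
  then obtain A B C where "A + B + C = 0" "corner p v1 A B" "corner p v2 B C" "corner p v3 A C"
    using three_corners ne by metis
  then have "fan p A B C" unfolding fan_def by blast
  then show ?thesis using fan_genus fan_antihoneycomb assms(2) by blast
qed

end
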